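(* Let $(G/H,\mathbf{G})$ be a homogeneous spray manifold with a linear decomposition $\mathfrak{g}=\mathfrak{h}+\mathfrak{m}$, $c(t)$ any smooth curve on $G/H$ with $c(0)=o$ and nowhere-vanishing $\dot{c}(t)$, and $\overline{c}(t)$ the smooth curve on $G$ satisfying $\overline{c}(0)=e$, $c(t)=\overline{c}(t)\cdot o$ and $w(t)=(L_{\overline{c}(t)^{-1}})_*(\dot{\overline{c}}(t))\in\mathfrak{m}\backslash\{0\}$ for each $t$. Suppose $Y(t)=(\overline{c}(t))_*(y(t))$ is a nowhere-vanishing smooth vector field along $c(t)$ (with $y(t)\in\mathfrak{m}\backslash\{0\}$). Then $Y(t)$ is nonlinearly parallel along $c(t)$ if and only if $y(t)$ satisfies $$\tfrac{\mathrm{d}}{\mathrm{d}t}y(t)+N(y(t),w(t))=0$$ everywhere.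
   Context: A spray structure on a smooth manifold $M$ is a smooth tangent vector field $\mathbf{G}$ on the slit tangent bundle $TM\backslash 0$ which, in every standard local coordinate $(x^i,y^j)$ (i.e. $x=(x^i)\in M$, $y=y^j\partial_{x^j}\in T_xM$), has the form $\mathbf{G}=y^i\partial_{x^i}-2\mathbf{G}^i\partial_{y^i}$, where $\mathbf{G}^i(x,\lambda y)=\lambda^2\mathbf{G}^i(x,y)$ for all $\lambda>0$. Denote $\mathbf{N}^i_j=\frac{\partial}{\partial y^j}\mathbf{G}^i$. A smooth curve $c(t)$ with nowhere-vanishing $\dot c(t)$ is a geodesic if $(c(t),\dot c(t))$ is an integral curve of $\mathbf{G}$. A nowhere-vanishing smooth vector field $X(t)=X^i(t)\partial_{x^i}|_{c(t)}$ along a smooth curve $c(t)$ is nonlinearly parallel if $\widetilde{D}_{\dot c(t)}X(t)=(\frac{\mathrm{d}}{\mathrm{d}t}X^i(t)+\dot c^j(t)\mathbf{N}^i_j(c(t),X(t)))\partial_{x^i}|_{c(t)}=0$. Homogeneous spray manifold $(G/H,\mathbf{G})$: $G$ is a Lie group, $H$ a closed subgroup, $o=eH$, and $\mathbf{G}$ is a spray structure on $G/H$ with $(g_* )_*\mathbf{G}=\mathbf{G}$ for all $g\in G$. A linear decomposition $\mathfrak{g}=\mathfrak{h}+\mathfrak{m}$ is a direct sum of vector spaces ($\mathfrak{g}=\mathrm{Lie}(G)=T_eG$, $\mathfrak{h}=\mathrm{Lie}(H)$); $\mathfrak{m}$ is identified with $T_o(G/H)$ via the differential at $e$ of $g\mapsto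 g\cdot o$; $[\cdot,\cdot]_\mathfrak{m}$ is the Lie bracket of $\mathfrak{g}$ followed by projection to $\mathfrak{m}$. $L_g$ is left translation on $G$, and $g_*$ is the tangent map of the action of $g$ on $G/H$. Fact: any smooth curve $c(t)$ on $G/H$ with $c(0)=o$ and nowhere-vanishing $\dot c(t)$ has a unique lift $\overline{c}(t)$ to $G$, defined around $t=0$, with $\overline{c}(0)=e$, $c(t)=\overline{c}(t)\cdot o$ and $(L_{\overline{c}(t)^{-1}})_*(\dot{\overline{c}}(t))\in\mathfrak{m}\backslash\{0\}$. The parameter $t$ ranges over an open interval containing $0$ on which both $c$ and $\overline{c}$ are defined. Spray vector field: for $y\in\mathfrak{m}\backslash\{0\}$ let $c_y(t)$ be the geodesic with $c_y(0)=o$, $\dot c_y(0)=y$, and $\overline{c}_y(t)$ its lift; then $\eta(y)=-\frac{\mathrm{d}}{\mathrm{d}t}|_{t=0}(L_{\overline{c}_y(t)^{-1}})_*(\dot{\overline{c}}_y(t))$, a smooth map $\mathfrak{m}\backslash\{0\}\to\mathfrak{m}$. Connection operator: $N:\mathfrak{m}\backslash\{0\}\times\mathfrak{m}\to\mathfrak{m}$, $N(y,u)=\frac12D\eta(y,u)-\frac12[y,u]_\mathfrak{m}$ with $D\eta(y,u)=\frac{\mathrm{d}}{\mathrm{d}t}|_{t=0}\eta(y+tu)$. *)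

theory Defs
  imports "HOL-Analysis.Analysis" "HOL-Algebra.Left_Coset" "HOL-Library.Function_Algebras"
begin

section \<open>Functions into a real vector space as a real vector space\<close>

instantiation "fun" :: (type, real_vector) real_vector
begin

definition scaleR_fun :: "real \<Rightarrow> ('a \<Rightarrow> 'b) \<Rightarrow> 'a \<Rightarrow> 'b"
  where "scaleR_fun r f = (\<lambda>x. r *\<^sub>R f x)"

instance
  by standard (simp_all add: scaleR_fun_def fun_eq_iff scaleR_add_left scaleR_add_right)

end

lemma scaleR_fun_apply [simp]: "(r *\<^sub>R f) x = r *\<^sub>R f x"
  by (simp add: scaleR_fun_def)

section \<open>Smooth manifolds, given by atlases\<close>

text \<open>
  Smoothness of a function on an open subset of a finite-dimensional space: all iterated
  directional derivatives exist as Frechet differentiable functions.  The predicate is only used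
  for open sets.
\<close>

primrec Ck_on :: "nat \<Rightarrow> 'a::euclidean_space set \<Rightarrow> ('a \<Rightarrow> 'b::real_normed_vector) \<Rightarrow> bool" where
  "Ck_on 0 S f \<longleftrightarrow> continuous_on S f"
| "Ck_on (Suc k) S f \<longleftrightarrow>
     (\<forall>x\<in>S. f differentiable (at x)) \<and> (\<forall>v. Ck_on k S (\<lambda>x. frechet_derivative f (at x) v))"

definition smooth_on :: "'a::euclidean_space set \<Rightarrow> ('a \<Rightarrow> 'b::real_normed_vector) \<Rightarrow> bool"
  where "smooth_on S f \<longleftrightarrow> (\<forall>k. Ck_on k S f)"

text \<open>
  A chart is a domain together with a coordinate map (whose values off the domain are irrelevant).
  A manifold is represented by any atlas (not necessarily maximal) of its smooth structure; its set
  of points is the union of the chart domains, and its topology is the one induced by the charts.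
\<close>

type_synonym ('m, 'e) chart = "'m set \<times> ('m \<Rightarrow> 'e)"

definition points :: "('m, 'e) chart set \<Rightarrow> 'm set"
  where "points A = \<Union> (fst ` A)"

definition chart_inv :: "('m, 'e) chart \<Rightarrow> 'e \<Rightarrow> 'm"
  where "chart_inv \<kappa> = inv_into (fst \<kappa>) (snd \<kappa>)"

definition local_rep :: "('m, 'e) chart \<Rightarrow> ('n, 'f) chart \<Rightarrow> ('m \<Rightarrow> 'n) \<Rightarrow> 'e \<Rightarrow> 'f"
  where "local_rep \<kappa> \<kappa>' f = snd \<kappa>' \<circ> f \<circ> chart_inv \<kappa>"

definition smooth_map ::
  "('m, 'e::euclidean_space) chart set \<Rightarrow> ('n, 'f::euclidean_space) chart set \<Rightarrow> ('m \<Rightarrow> 'n) \<Rightarrow> bool"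
  where "smooth_map A B f \<longleftrightarrow>
    f \<in> points A \<rightarrow> points B \<and>
    (\<forall>\<kappa>\<in>A. \<forall>\<kappa>'\<in>B.
       open (snd \<kappa> ` (fst \<kappa> \<inter> f -` fst \<kappa>')) \<and>
       smooth_on (snd \<kappa> ` (fst \<kappa> \<inter> f -` fst \<kappa>')) (local_rep \<kappa> \<kappa>' f))"

definition manifold_topology :: "('m, 'e::euclidean_space) chart set \<Rightarrow> 'm topology"
  where "manifold_topology A =
    topology (\<lambda>W. W \<subseteq> points A \<and> (\<forall>\<kappa>\<in>A. open (snd \<kappa> ` (W \<inter> fst \<kappa>))))"

text \<open>
  Compatibility of the charts (smoothness of all transition maps between open sets) is smoothness
  of the identity.
\<close>

definition smooth_atlas :: "('m, 'e::euclidean_space) chart set \<Rightarrow> bool"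
  where "smooth_atlas A \<longleftrightarrow>
    (\<forall>\<kappa>\<in>A. inj_on (snd \<kappa>) (fst \<kappa>) \<and> open (snd \<kappa> ` fst \<kappa>)) \<and>
    smooth_map A A (\<lambda>p. p) \<and>
    Hausdorff_space (manifold_topology A) \<and>
    second_countable (manifold_topology A)"

definition product_atlas :: "('m, 'e) chart set \<Rightarrow> ('n, 'f) chart set \<Rightarrow> ('m \<times> 'n, 'e \<times> 'f) chart set"
  where "product_atlas A B =
    {(fst \<kappa> \<times> fst \<kappa>', map_prod (snd \<kappa>) (snd \<kappa>')) | \<kappa> \<kappa>'. \<kappa> \<in> A \<and> \<kappa>' \<in> B}"

section \<open>Tangent vectors\<close>

text \<open>
  A tangent vector at \<open>p\<close> is the family of its components in all charts around \<open>p\<close>, related by the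
  Jacobians of the coordinate changes.  The components in charts not containing \<open>p\<close> are set to \<open>0\<close>,
  so that the tangent space is a linear subspace of the function type.
\<close>

type_synonym ('m, 'e) tvec = "('m, 'e) chart \<Rightarrow> 'e"

definition tangent_space :: "('m, 'e::euclidean_space) chart set \<Rightarrow> 'm \<Rightarrow> ('m, 'e) tvec set"
  where "tangent_space A p =
    {v. (\<forall>\<kappa>. \<not> (\<kappa> \<in> A \<and> p \<in> fst \<kappa>) \<longrightarrow> v \<kappa> = 0) \<and>
        (\<forall>\<kappa>\<in>A. \<forall>\<kappa>'\<in>A. p \<in> fst \<kappa> \<inter> fst \<kappa>' \<longrightarrow>
           v \<kappa>' = frechet_derivative (local_rep \<kappa> \<kappa>' (\<lambda>q. q)) (at (snd \<kappa> p)) (v \<kappa>))}"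

definition tangent_chart ::
  "('m, 'e::euclidean_space) chart set \<Rightarrow> ('m, 'e) chart \<Rightarrow> ('m \<times> ('m, 'e) tvec, 'e \<times> 'e) chart"
  where "tangent_chart A \<kappa> =
    ({\<xi>. fst \<xi> \<in> fst \<kappa> \<and> snd \<xi> \<in> tangent_space A (fst \<xi>)}, (\<lambda>\<xi>. (snd \<kappa> (fst \<xi>), snd \<xi> \<kappa>)))"

definition tangent_bundle ::
  "('m, 'e::euclidean_space) chart set \<Rightarrow> ('m \<times> ('m, 'e) tvec, 'e \<times> 'e) chart set"
  where "tangent_bundle A = tangent_chart A ` A"

definition slit_chart ::
  "('m, 'e::euclidean_space) chart set \<Rightarrow> ('m, 'e) chart \<Rightarrow> ('m \<times> ('m, 'e) tvec, 'e \<times> 'e) chart"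
  where "slit_chart A \<kappa> = ({\<xi> \<in> fst (tangent_chart A \<kappa>). snd \<xi> \<noteq> 0}, snd (tangent_chart A \<kappa>))"

definition slit_bundle ::
  "('m, 'e::euclidean_space) chart set \<Rightarrow> ('m \<times> ('m, 'e) tvec, 'e \<times> 'e) chart set"
  where "slit_bundle A = slit_chart A ` A"

text \<open>The differential of \<open>f\<close> at \<open>p\<close>, computed in an arbitrary chart around \<open>p\<close>.\<close>

definition pushforward ::
  "('m, 'e::euclidean_space) chart set \<Rightarrow> ('n, 'f::euclidean_space) chart set \<Rightarrow> ('m \<Rightarrow> 'n) \<Rightarrow>
   'm \<Rightarrow> ('m, 'e) tvec \<Rightarrow> ('n, 'f) tvec"
  where "pushforward A B f p v = (\<lambda>\<kappa>'.
    if \<kappa>' \<in> B \<and> f p \<in> fst \<kappa>'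
    then let \<kappa> = (SOME \<kappa>. \<kappa> \<in> A \<and> p \<in> fst \<kappa>)
         in frechet_derivative (local_rep \<kappa> \<kappa>' f) (at (snd \<kappa> p)) (v \<kappa>)
    else 0)"

definition tangent_map ::
  "('m, 'e::euclidean_space) chart set \<Rightarrow> ('n, 'f::euclidean_space) chart set \<Rightarrow> ('m \<Rightarrow> 'n) \<Rightarrow>
   'm \<times> ('m, 'e) tvec \<Rightarrow> 'n \<times> ('n, 'f) tvec"
  where "tangent_map A B f \<xi> = (f (fst \<xi>), pushforward A B f (fst \<xi>) (snd \<xi>))"

definition smooth_vector_field ::
  "('m, 'e::euclidean_space) chart set \<Rightarrow> ('m \<Rightarrow> ('m, 'e) tvec) \<Rightarrow> bool"
  where "smooth_vector_field A X \<longleftrightarrow> smooth_map A (tangent_bundle A) (\<lambda>p. (p, X p))"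

text \<open>In coordinates, \<open>[X, Y]\<^sup>i = X\<^sup>j \<partial>\<^sub>j Y\<^sup>i - Y\<^sup>j \<partial>\<^sub>j X\<^sup>i\<close>.\<close>

definition vf_bracket ::
  "('m, 'e::euclidean_space) chart set \<Rightarrow> ('m \<Rightarrow> ('m, 'e) tvec) \<Rightarrow> ('m \<Rightarrow> ('m, 'e) tvec) \<Rightarrow>
   'm \<Rightarrow> ('m, 'e) tvec"
  where "vf_bracket A X Y p = (\<lambda>\<kappa>.
    if \<kappa> \<in> A \<and> p \<in> fst \<kappa>
    then frechet_derivative (\<lambda>x. Y (chart_inv \<kappa> x) \<kappa>) (at (snd \<kappa> p)) (X p \<kappa>)
       - frechet_derivative (\<lambda>x. X (chart_inv \<kappa> x) \<kappa>) (at (snd \<kappa> p)) (Y p \<kappa>)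
    else 0)"

section \<open>Curves\<close>

definition open_interval :: "real set \<Rightarrow> bool"
  where "open_interval I \<longleftrightarrow> open I \<and> is_interval I"

definition smooth_curve :: "('m, 'e::euclidean_space) chart set \<Rightarrow> real set \<Rightarrow> (real \<Rightarrow> 'm) \<Rightarrow> bool"
  where "smooth_curve A I c \<longleftrightarrow> smooth_map {(I, \<lambda>t. t)} A c"

definition velocity :: "('m, 'e::euclidean_space) chart set \<Rightarrow> (real \<Rightarrow> 'm) \<Rightarrow> real \<Rightarrow> ('m, 'e) tvec"
  where "velocity A c t = (\<lambda>\<kappa>.
    if \<kappa> \<in> A \<and> c t \<in> fst \<kappa> then vector_derivative (snd \<kappa> \<circ> c) (at t) else 0)"

definition smooth_field_along ::
  "('m, 'e::euclidean_space) chart set \<Rightarrow> real set \<Rightarrow> (real \<Rightarrow> 'm) \<Rightarrow> (real \<Rightarrow> ('m, 'e) tvec) \<Rightarrow> bool"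
  where "smooth_field_along A I c X \<longleftrightarrow> smooth_curve (tangent_bundle A) I (\<lambda>t. (c t, X t))"

text \<open>The derivative of a curve in one fixed tangent space.\<close>

definition tvec_deriv :: "(real \<Rightarrow> ('m, 'e::euclidean_space) tvec) \<Rightarrow> real \<Rightarrow> ('m, 'e) tvec"
  where "tvec_deriv v t = (\<lambda>\<kappa>. vector_derivative (\<lambda>s. v s \<kappa>) (at t))"

section \<open>Sprays\<close>

type_synonym ('m, 'e) slit_field =
  "'m \<times> ('m, 'e) tvec \<Rightarrow> ('m \<times> ('m, 'e) tvec, 'e \<times> 'e) tvec"

text \<open>
  The components of a vector field on the slit tangent bundle at the point with standard local
  coordinates \<open>(x, y)\<close>.  The pair \<open>(a, b)\<close> stands for \<open>a\<^sup>i \<partial>\<^sub>x\<^sub>i + b\<^sup>i \<partial>\<^sub>y\<^sub>i\<close>.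
\<close>

definition slit_components ::
  "('m, 'e::euclidean_space) chart set \<Rightarrow> ('m, 'e) slit_field \<Rightarrow> ('m, 'e) chart \<Rightarrow> 'e \<Rightarrow> 'e \<Rightarrow> 'e \<times> 'e"
  where "slit_components A S \<kappa> x y = S (chart_inv (slit_chart A \<kappa>) (x, y)) (slit_chart A \<kappa>)"

definition spray_coeff ::
  "('m, 'e::euclidean_space) chart set \<Rightarrow> ('m, 'e) slit_field \<Rightarrow> ('m, 'e) chart \<Rightarrow> 'e \<Rightarrow> 'e \<Rightarrow> 'e"
  where "spray_coeff A S \<kappa> x y = - (1/2) *\<^sub>R snd (slit_components A S \<kappa> x y)"

definition spray :: "('m, 'e::euclidean_space) chart set \<Rightarrow> ('m, 'e) slit_field \<Rightarrow> bool"
  where "spray A S \<longleftrightarrow>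
    smooth_vector_field (slit_bundle A) S \<and>
    (\<forall>\<kappa>\<in>A. \<forall>x\<in>snd \<kappa> ` fst \<kappa>. \<forall>y. y \<noteq> 0 \<longrightarrow>
       slit_components A S \<kappa> x y = (y, - 2 *\<^sub>R spray_coeff A S \<kappa> x y) \<and>
       (\<forall>l>0. spray_coeff A S \<kappa> x (l *\<^sub>R y) = l\<^sup>2 *\<^sub>R spray_coeff A S \<kappa> x y))"

text \<open>The contraction \<open>u\<^sup>j N\<^sup>i\<^sub>j(x, y)\<close>, where \<open>N\<^sup>i\<^sub>j\<close> is the partial derivative of \<open>G\<^sup>i\<close> in \<open>y\<^sup>j\<close>.\<close>

definition spray_N ::
  "('m, 'e::euclidean_space) chart set \<Rightarrow> ('m, 'e) slit_field \<Rightarrow> ('m, 'e) chart \<Rightarrow> 'e \<Rightarrow> 'e \<Rightarrow> 'e \<Rightarrow> 'e"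
  where "spray_N A S \<kappa> x y u = frechet_derivative (spray_coeff A S \<kappa> x) (at y) u"

definition geodesic ::
  "('m, 'e::euclidean_space) chart set \<Rightarrow> ('m, 'e) slit_field \<Rightarrow> real set \<Rightarrow> (real \<Rightarrow> 'm) \<Rightarrow> bool"
  where "geodesic A S I c \<longleftrightarrow>
    smooth_curve A I c \<and> (\<forall>t\<in>I. velocity A c t \<noteq> 0) \<and>
    (\<forall>t\<in>I. velocity (slit_bundle A) (\<lambda>s. (c s, velocity A c s)) t = S (c t, velocity A c t))"

definition cov_deriv ::
  "('m, 'e::euclidean_space) chart set \<Rightarrow> ('m, 'e) slit_field \<Rightarrow> (real \<Rightarrow> 'm) \<Rightarrow>
   (real \<Rightarrow> ('m, 'e) tvec) \<Rightarrow> real \<Rightarrow> ('m, 'e) tvec"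
  where "cov_deriv A S c X t = (\<lambda>\<kappa>.
    if \<kappa> \<in> A \<and> c t \<in> fst \<kappa>
    then vector_derivative (\<lambda>s. X s \<kappa>) (at t)
       + spray_N A S \<kappa> (snd \<kappa> (c t)) (X t \<kappa>) (velocity A c t \<kappa>)
    else 0)"

definition nonlinearly_parallel ::
  "('m, 'e::euclidean_space) chart set \<Rightarrow> ('m, 'e) slit_field \<Rightarrow> real set \<Rightarrow> (real \<Rightarrow> 'm) \<Rightarrow>
   (real \<Rightarrow> ('m, 'e) tvec) \<Rightarrow> bool"
  where "nonlinearly_parallel A S I c X \<longleftrightarrow>
    smooth_field_along A I c X \<and> (\<forall>t\<in>I. X t \<noteq> 0) \<and> (\<forall>t\<in>I. cov_deriv A S c X t = 0)"

section \<open>Lie groups\<close>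

definition lie_group :: "('g, 'z) monoid_scheme \<Rightarrow> ('g, 'e::euclidean_space) chart set \<Rightarrow> bool"
  where "lie_group G A \<longleftrightarrow>
    group G \<and> smooth_atlas A \<and> points A = carrier G \<and>
    smooth_map (product_atlas A A) A (\<lambda>(g, h). g \<otimes>\<^bsub>G\<^esub> h) \<and>
    smooth_map A A (m_inv G)"

definition lie_algebra ::
  "('g, 'z) monoid_scheme \<Rightarrow> ('g, 'e::euclidean_space) chart set \<Rightarrow> ('g, 'e) tvec set"
  where "lie_algebra G A = tangent_space A \<one>\<^bsub>G\<^esub>"

definition left_translation_deriv ::
  "('g, 'z) monoid_scheme \<Rightarrow> ('g, 'e::euclidean_space) chart set \<Rightarrow> 'g \<Rightarrow> 'g \<Rightarrow>
   ('g, 'e) tvec \<Rightarrow> ('g, 'e) tvec"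
  where "left_translation_deriv G A g = pushforward A A (\<lambda>h. g \<otimes>\<^bsub>G\<^esub> h)"

text \<open>The bracket of the left-invariant vector fields with values \<open>u\<close> and \<open>v\<close> at the unit element.\<close>

definition lie_bracket ::
  "('g, 'z) monoid_scheme \<Rightarrow> ('g, 'e::euclidean_space) chart set \<Rightarrow>
   ('g, 'e) tvec \<Rightarrow> ('g, 'e) tvec \<Rightarrow> ('g, 'e) tvec"
  where "lie_bracket G A u v =
    vf_bracket A (\<lambda>g. left_translation_deriv G A g \<one>\<^bsub>G\<^esub> u)
      (\<lambda>g. left_translation_deriv G A g \<one>\<^bsub>G\<^esub> v) \<one>\<^bsub>G\<^esub>"

text \<open>
  For a closed (hence embedded) subgroup \<open>H\<close>, the subspace \<open>Lie(H)\<close> of \<open>Lie(G)\<close>: the initial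
  velocities of the smooth curves in \<open>H\<close> through the unit element.
\<close>

definition lie_subalgebra ::
  "('g, 'z) monoid_scheme \<Rightarrow> ('g, 'e::euclidean_space) chart set \<Rightarrow> 'g set \<Rightarrow> ('g, 'e) tvec set"
  where "lie_subalgebra G A H =
    {velocity A \<gamma> 0 | \<gamma> I. open_interval I \<and> 0 \<in> I \<and> smooth_curve A I \<gamma> \<and> \<gamma> ` I \<subseteq> H \<and> \<gamma> 0 = \<one>\<^bsub>G\<^esub>}"

definition linear_decomposition ::
  "('g, 'z) monoid_scheme \<Rightarrow> ('g, 'e::euclidean_space) chart set \<Rightarrow> 'g set \<Rightarrow> ('g, 'e) tvec set \<Rightarrow> bool"
  where "linear_decomposition G A H m \<longleftrightarrow>
    subspace m \<and>
    {a + b | a b. a \<in> lie_subalgebra G A H \<and> b \<in> m} = lie_algebra G A \<and>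
    lie_subalgebra G A H \<inter> m = {0}"

definition proj_m ::
  "('g, 'z) monoid_scheme \<Rightarrow> ('g, 'e::euclidean_space) chart set \<Rightarrow> 'g set \<Rightarrow> ('g, 'e) tvec set \<Rightarrow>
   ('g, 'e) tvec \<Rightarrow> ('g, 'e) tvec"
  where "proj_m G A H m x = (THE z. z \<in> m \<and> x - z \<in> lie_subalgebra G A H)"

section \<open>Homogeneous spray manifolds\<close>

text \<open>
  Points of \<open>G/H\<close> are the left cosets; the base point \<open>o\<close> is the coset \<open>H\<close> itself, and \<open>g\<close> acts by
  \<open>C \<mapsto> g <# C\<close>.  The smooth structure of \<open>G/H\<close> is the unique one for which the projection
  \<open>g \<mapsto> g <# H\<close> is a smooth submersion.
\<close>

definition homogeneous_space ::
  "('g, 'z) monoid_scheme \<Rightarrow> ('g, 'e::euclidean_space) chart set \<Rightarrow> 'g set \<Rightarrow>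
   ('g set, 'f::euclidean_space) chart set \<Rightarrow> bool"
  where "homogeneous_space G A H B \<longleftrightarrow>
    lie_group G A \<and> subgroup H G \<and> closedin (manifold_topology A) H \<and>
    smooth_atlas B \<and> points B = lcosets\<^bsub>G\<^esub> H \<and>
    smooth_map A B (\<lambda>g. g <#\<^bsub>G\<^esub> H) \<and>
    (\<forall>g\<in>carrier G. pushforward A B (\<lambda>g. g <#\<^bsub>G\<^esub> H) g ` tangent_space A g
                     = tangent_space B (g <#\<^bsub>G\<^esub> H))"

definition homogeneous_spray_manifold ::
  "('g, 'z) monoid_scheme \<Rightarrow> ('g, 'e::euclidean_space) chart set \<Rightarrow> 'g set \<Rightarrow>
   ('g set, 'f::euclidean_space) chart set \<Rightarrow> ('g set, 'f) slit_field \<Rightarrow> bool"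
  where "homogeneous_spray_manifold G A H B S \<longleftrightarrow>
    homogeneous_space G A H B \<and> spray B S \<and>
    (\<forall>g\<in>carrier G. \<forall>\<xi>\<in>points (slit_bundle B).
       pushforward (slit_bundle B) (slit_bundle B) (tangent_map B B (\<lambda>C. g <#\<^bsub>G\<^esub> C)) \<xi> (S \<xi>)
         = S (tangent_map B B (\<lambda>C. g <#\<^bsub>G\<^esub> C) \<xi>))"

text \<open>The identification of \<open>m\<close> with the tangent space of \<open>G/H\<close> at \<open>o\<close>.\<close>

definition m_to_tangent ::
  "('g, 'z) monoid_scheme \<Rightarrow> ('g, 'e::euclidean_space) chart set \<Rightarrow> 'g set \<Rightarrow>
   ('g set, 'f::euclidean_space) chart set \<Rightarrow> ('g, 'e) tvec \<Rightarrow> ('g set, 'f) tvec"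
  where "m_to_tangent G A H B = pushforward A B (\<lambda>g. g <#\<^bsub>G\<^esub> H) \<one>\<^bsub>G\<^esub>"

definition left_velocity ::
  "('g, 'z) monoid_scheme \<Rightarrow> ('g, 'e::euclidean_space) chart set \<Rightarrow> (real \<Rightarrow> 'g) \<Rightarrow> real \<Rightarrow> ('g, 'e) tvec"
  where "left_velocity G A cb t =
    left_translation_deriv G A (inv\<^bsub>G\<^esub> (cb t)) (cb t) (velocity A cb t)"

definition horizontal_lift ::
  "('g, 'z) monoid_scheme \<Rightarrow> ('g, 'e::euclidean_space) chart set \<Rightarrow> 'g set \<Rightarrow> ('g, 'e) tvec set \<Rightarrow>
   real set \<Rightarrow> (real \<Rightarrow> 'g set) \<Rightarrow> (real \<Rightarrow> 'g) \<Rightarrow> bool"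
  where "horizontal_lift G A H m I c cb \<longleftrightarrow>
    smooth_curve A I cb \<and> cb 0 = \<one>\<^bsub>G\<^esub> \<and>
    (\<forall>t\<in>I. c t = cb t <#\<^bsub>G\<^esub> H \<and> left_velocity G A cb t \<in> m - {0})"

text \<open>
  All geodesics \<open>c\<close> with the prescribed initial data, on whatever interval, and all their lifts have
  the same germ at \<open>0\<close>, so the value below is determined by \<open>y \<in> m - {0}\<close>.
\<close>

definition spray_vector_field ::
  "('g, 'z) monoid_scheme \<Rightarrow> ('g, 'e::euclidean_space) chart set \<Rightarrow> 'g set \<Rightarrow>
   ('g set, 'f::euclidean_space) chart set \<Rightarrow> ('g set, 'f) slit_field \<Rightarrow> ('g, 'e) tvec set \<Rightarrow>
   ('g, 'e) tvec \<Rightarrow> ('g, 'e) tvec"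
  where "spray_vector_field G A H B S m y = (THE z. \<exists>I c cb.
    open_interval I \<and> 0 \<in> I \<and>
    geodesic B S I c \<and> c 0 = H \<and> velocity B c 0 = m_to_tangent G A H B y \<and>
    horizontal_lift G A H m I c cb \<and>
    z = - tvec_deriv (left_velocity G A cb) 0)"

definition connection_operator ::
  "('g, 'z) monoid_scheme \<Rightarrow> ('g, 'e::euclidean_space) chart set \<Rightarrow> 'g set \<Rightarrow>
   ('g set, 'f::euclidean_space) chart set \<Rightarrow> ('g set, 'f) slit_field \<Rightarrow> ('g, 'e) tvec set \<Rightarrow>
   ('g, 'e) tvec \<Rightarrow> ('g, 'e) tvec \<Rightarrow> ('g, 'e) tvec"
  where "connection_operator G A H B S m y u =
    (1/2) *\<^sub>R tvec_deriv (\<lambda>t. spray_vector_field G A H B S m (y + t *\<^sub>R u)) 0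
    - (1/2) *\<^sub>R proj_m G A H m (lie_bracket G A y u)"

end

theory Submission
  imports Defs
begin

text \<open>
  The theorem is a computation in two charts, \<open>\<epsilon>\<close> around the unit element of \<open>G\<close> and \<open>\<beta>\<close> around the
  base point \<open>o\<close> of \<open>G/H\<close>, made possible by invariance.  Let \<open>T\<close> be the differential of the projection
  \<open>G \<rightarrow> G/H\<close> at the unit element; it maps \<open>m\<close> isomorphically onto \<open>T\<^sub>o(G/H)\<close>, with inverse \<open>J\<close>.  Let \<open>Q(w, u)\<close> be
  the derivative of \<open>(g, h) \<mapsto> g h H\<close> at the unit, in the direction \<open>u\<close> of \<open>h\<close> and then in the direction
  \<open>w\<close> of \<open>g\<close>.

  Fix a time \<open>t\<close> and let \<open>F\<close> be the action of \<open>cb(t)\<close>, read in the chart \<open>\<beta>\<close> and a chart around \<open>c(t)\<close>.  The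
  curve \<open>cb(t)\<^sup>-\<^sup>1 cb\<close> passes through the unit element with velocity \<open>w\<close>, and differentiating the field
  \<open>Y = cb\<^sub>* y\<close> through it gives
    \<open>Y' = D\<^sup>2F(T w, T y) + DF(Q(w, y) + T y')\<close>
  (\<open>translated_field_derivative\<close>).  Invariance of the spray says how its coefficients change under \<open>F\<close>; the
  change involves the same second derivative \<open>D\<^sup>2F\<close> (\<open>coeff_invariance\<close>, \<open>spray_N_invariance\<close>), which therefore
  cancels in the covariant derivative.  With \<open>G\<^sub>0\<close> the spray coefficients at \<open>o\<close> and \<open>N\<^sub>0\<close> their derivative,
  the covariant derivative of \<open>Y\<close> is
    \<open>DF(T y' + N\<^sub>0(T y)(T w) + Q(w, y))\<close>
  (\<open>cov_deriv_component\<close>), and \<open>DF\<close> is injective.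

  It remains to recognise \<open>N\<^sub>0(T y)(T w) + Q(w, y)\<close> as the image of the connection operator.  The same
  computation for the velocity field of \<open>c\<close> itself shows that \<open>c\<close> is a geodesic only if
  \<open>T w' = - 2 G\<^sub>0(T w) - Q(w, w)\<close>, so that \<open>\<eta>(y) = J(2 G\<^sub>0(T y) + Q(y, y))\<close> (\<open>spray_vector_field_eq\<close>).  The value
  \<open>\<eta>(y)\<close> is meaningful because a geodesic and a lift exist: together they solve a translation-invariant
  ordinary differential equation for \<open>(cb, w)\<close> (\<open>eta_exists\<close>).  Polarising \<open>\<eta>\<close> gives the symmetric part of
  \<open>Q\<close>, and the antisymmetric part is the Lie bracket, \<open>T [y, u] = Q(y, u) - Q(u, y)\<close> (\<open>T_lie_bracket\<close>); half
  the sum minus half the difference is \<open>Q(u, y)\<close> (\<open>connection_operator_eq\<close>).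

  Three facts about manifolds support this.  A submersion has smooth local right inverses, whence the
  action on \<open>G/H\<close> is smooth, and every vector in the kernel of its differential is tangent to the fibre,
  whence \<open>Lie(H)\<close> is the kernel of \<open>T\<close>; both follow from the smooth inverse function theorem.  Finally, \<open>y\<close>
  is only known through \<open>Y\<close>; it is differentiable because it solves a linear system whose coefficients
  depend differentiably on time.
\<close>

section \<open>Frechet derivatives\<close>

abbreviation dif :: "('a::real_normed_vector \<Rightarrow> 'b::real_normed_vector) \<Rightarrow> 'a \<Rightarrow> 'a \<Rightarrow> 'b"
  where "dif f x \<equiv> frechet_derivative f (at x)"

lemma dif_eqI: "(f has_derivative f') (at x) \<Longrightarrow> dif f x = f'"
  by (rule frechet_derivative_at[symmetric])

lemma has_derivative_dif: "f differentiable at x \<Longrightarrow> (f has_derivative dif f x) (at x)"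
  by (simp add: frechet_derivative_works[symmetric])

lemma linear_dif: "f differentiable at x \<Longrightarrow> linear (dif f x)"
  using has_derivative_dif has_derivative_linear by blast

lemma dif_cong:
  assumes "open S" "x \<in> S" "\<And>z. z \<in> S \<Longrightarrow> f z = g z"
  shows "dif f x = dif g x" "f differentiable at x \<longleftrightarrow> g differentiable at x"
proof -
  have *: "(f has_derivative f') (at x) \<longleftrightarrow> (g has_derivative f') (at x)" for f'
    using assms has_derivative_transform_within_open[of f f' x UNIV S g]
      has_derivative_transform_within_open[of g f' x UNIV S f] by auto
  show "dif f x = dif g x" by (simp add: frechet_derivative_def *)
  show "f differentiable at x \<longleftrightarrow> g differentiable at x" by (simp add: differentiable_def *)
qed

lemma linear_eq_sum_Basis:
  fixes L :: "'a::euclidean_space \<Rightarrow> 'b::real_vector"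
  assumes "linear L"
  shows "L v = (\<Sum>b\<in>Basis. (v \<bullet> b) *\<^sub>R L b)"
  using linear_sum[OF assms, of "\<lambda>b. (v \<bullet> b) *\<^sub>R b" Basis]
  by (simp add: linear_scale[OF assms] euclidean_representation)

lemma dif_compose:
  assumes "f differentiable at (g x)" "g differentiable at x"
  shows "dif (\<lambda>x. f (g x)) x = (\<lambda>v. dif f (g x) (dif g x v))"
    and "(\<lambda>x. f (g x)) differentiable at x"
proof -
  have "((f \<circ> g) has_derivative (dif f (g x) \<circ> dif g x)) (at x)"
    using assms by (intro diff_chain_at has_derivative_dif)
  then have *: "((\<lambda>x. f (g x)) has_derivative (\<lambda>v. dif f (g x) (dif g x v))) (at x)"
    by (simp add: o_def)
  show "dif (\<lambda>x. f (g x)) x = (\<lambda>v. dif f (g x) (dif g x v))" by (rule dif_eqI[OF *])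
  show "(\<lambda>x. f (g x)) differentiable at x" using * by (auto simp: differentiable_def)
qed

section \<open>Smooth functions\<close>

lemma Ck_on_cong:
  assumes "open S" "\<And>x. x \<in> S \<Longrightarrow> f x = g x"
  shows "Ck_on k S f \<longleftrightarrow> Ck_on k S g"
  using assms
proof (induction k arbitrary: f g)
  case 0
  then show ?case by (simp cong: continuous_on_cong)
next
  case (Suc k)
  have d: "dif f x = dif g x" "f differentiable at x \<longleftrightarrow> g differentiable at x" if "x \<in> S" for x
    using dif_cong[OF Suc.prems(1) that, of f g] Suc.prems(2) by auto
  have "Ck_on k S (\<lambda>x. dif f x v) \<longleftrightarrow> Ck_on k S (\<lambda>x. dif g x v)" for v
    by (rule Suc.IH) (use Suc.prems(1) d in auto)
  with d show ?case by simp
qed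

lemma Ck_on_subset: "Ck_on k S f \<Longrightarrow> T \<subseteq> S \<Longrightarrow> Ck_on k T f"
  by (induction k arbitrary: f) (auto intro: continuous_on_subset)

lemma Ck_on_Suc_lower: "Ck_on (Suc k) S f \<Longrightarrow> Ck_on k S f"
proof (induction k arbitrary: f)
  case 0
  then show ?case
    by (auto intro!: continuous_at_imp_continuous_on differentiable_imp_continuous_within)
next
  case (Suc k)
  then show ?case by (metis Ck_on.simps(2))
qed

lemma Ck_on_open_cover:
  assumes "\<And>x. x \<in> S \<Longrightarrow> \<exists>U. open U \<and> x \<in> U \<and> Ck_on k U f"
  shows "Ck_on k S f"
  using assms
proof (induction k arbitrary: f)
  case 0
  have "isCont f x" if "x \<in> S" for x
    using 0[OF that] by (auto simp: continuous_on_eq_continuous_at)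
  then show ?case by (simp add: continuous_at_imp_continuous_on)
next
  case (Suc k)
  show ?case
  proof (simp, intro conjI ballI allI)
    show "f differentiable at x" if "x \<in> S" for x using Suc.prems[OF that] by auto
    show "Ck_on k S (\<lambda>x. dif f x v)" for v
      by (rule Suc.IH) (use Suc.prems in force)
  qed
qed

lemma Ck_on_const: "Ck_on k S (\<lambda>x. c)"
  by (induction k arbitrary: c) (auto simp: frechet_derivative_const)

lemma Ck_on_bounded_linear_compose:
  assumes "bounded_linear L" "open S" "Ck_on k S f"
  shows "Ck_on k S (\<lambda>x. L (f x))"
  using assms(3)
proof (induction k arbitrary: f)
  case 0
  then show ?case using assms(1) by (auto intro: bounded_linear.continuous_on)
next
  case (Suc k)
  have *: "((\<lambda>x. L (f x)) has_derivative (\<lambda>v. L (dif f x v))) (at x)" if "x \<in> S" for x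
    using Suc.prems that by (intro bounded_linear.has_derivative[OF assms(1)] has_derivative_dif) auto
  have "Ck_on k S (\<lambda>x. dif (\<lambda>x. L (f x)) x v)" for v
    using Suc.IH[of "\<lambda>x. dif f x v"] Suc.prems
      Ck_on_cong[OF assms(2), of "\<lambda>x. dif (\<lambda>x. L (f x)) x v" "\<lambda>x. L (dif f x v)" k]
    by (simp add: dif_eqI[OF *])
  with * show ?case by (auto simp: differentiable_def)
qed

lemma Ck_on_linear: "bounded_linear L \<Longrightarrow> Ck_on k S L"
proof (induction k)
  case 0
  then show ?case by (simp add: linear_continuous_on)
next
  case (Suc k)
  then have "dif L x = L" for x by (intro dif_eqI bounded_linear_imp_has_derivative)
  with Suc show ?case
    by (auto simp: Ck_on_const intro: bounded_linear_imp_differentiable)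
qed

lemma Ck_on_add:
  assumes "open S" "Ck_on k S f" "Ck_on k S g"
  shows "Ck_on k S (\<lambda>x. f x + g x)"
  using assms(2,3)
proof (induction k arbitrary: f g)
  case 0
  then show ?case by (auto intro: continuous_on_add)
next
  case (Suc k)
  have *: "((\<lambda>x. f x + g x) has_derivative (\<lambda>v. dif f x v + dif g x v)) (at x)" if "x \<in> S" for x
    using Suc.prems that by (intro has_derivative_add has_derivative_dif) auto
  have "Ck_on k S (\<lambda>x. dif (\<lambda>x. f x + g x) x v)" for v
    using Suc.IH[of "\<lambda>x. dif f x v" "\<lambda>x. dif g x v"] Suc.prems
      Ck_on_cong[OF assms(1), of "\<lambda>x. dif (\<lambda>x. f x + g x) x v" "\<lambda>x. dif f x v + dif g x v" k]
    by (simp add: dif_eqI[OF *])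
  with * show ?case by (auto simp: differentiable_def)
qed

lemma Ck_on_bilinear:
  assumes "bounded_bilinear B" "open S" "Ck_on k S f" "Ck_on k S g"
  shows "Ck_on k S (\<lambda>x. B (f x) (g x))"
  using assms(3,4)
proof (induction k arbitrary: f g)
  case 0
  then show ?case using bounded_bilinear.continuous_on[OF assms(1)] by auto
next
  case (Suc k)
  have *: "((\<lambda>x. B (f x) (g x)) has_derivative (\<lambda>v. B (f x) (dif g x v) + B (dif f x v) (g x))) (at x)"
    if "x \<in> S" for x
    using Suc.prems that by (intro bounded_bilinear.FDERIV[OF assms(1)] has_derivative_dif) auto
  have "Ck_on k S (\<lambda>x. B (f x) (dif g x v) + B (dif f x v) (g x))" for v
    using Suc.prems Ck_on_Suc_lower[OF Suc.prems(1)] Ck_on_Suc_lower[OF Suc.prems(2)]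
    by (intro Ck_on_add assms(2) Suc.IH) auto
  then have "Ck_on k S (\<lambda>x. dif (\<lambda>x. B (f x) (g x)) x v)" for v
    using Ck_on_cong[OF assms(2), of "\<lambda>x. dif (\<lambda>x. B (f x) (g x)) x v"
        "\<lambda>x. B (f x) (dif g x v) + B (dif f x v) (g x)" k]
    by (simp add: dif_eqI[OF *])
  with * show ?case by (auto simp: differentiable_def)
qed

lemma Ck_on_sum:
  assumes "open S" "\<And>i. i \<in> A \<Longrightarrow> Ck_on k S (f i)"
  shows "Ck_on k S (\<lambda>x. \<Sum>i\<in>A. f i x)"
  using assms(2)
  by (induction A rule: infinite_finite_induct) (auto intro: Ck_on_const Ck_on_add assms(1))

lemma Ck_on_linear_combination:
  fixes f :: "'b::euclidean_space \<Rightarrow> 'a::euclidean_space \<Rightarrow> 'c::real_normed_vector"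
  assumes "open S" "\<And>b. b \<in> Basis \<Longrightarrow> Ck_on k S (f b)" "Ck_on k S g"
  shows "Ck_on k S (\<lambda>x. \<Sum>b\<in>Basis. (g x \<bullet> b) *\<^sub>R f b x)"
  using assms
  by (intro Ck_on_sum Ck_on_bilinear[OF bounded_bilinear_scaleR] 
      Ck_on_bounded_linear_compose[OF bounded_linear_inner_left]) auto

text \<open>
  The derivative of a composite is a linear combination of the partial derivatives of \<open>f\<close> along \<open>g\<close>, which
  reduces the order by one.
\<close>

lemma Ck_on_compose:
  fixes f :: "'b::euclidean_space \<Rightarrow> 'c::real_normed_vector"
    and g :: "'a::euclidean_space \<Rightarrow> 'b"
  assumes "open S" "open T" "g ` S \<subseteq> T" "Ck_on k T f" "Ck_on k S g"
  shows "Ck_on k S (\<lambda>x. f (g x))"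
  using assms(4,5)
proof (induction k arbitrary: f)
  case 0
  then show ?case using assms(3) continuous_on_compose2 by auto
next
  case (Suc k)
  have d: "dif (\<lambda>x. f (g x)) x = (\<lambda>v. dif f (g x) (dif g x v))"
      "(\<lambda>x. f (g x)) differentiable at x" if "x \<in> S" for x
    using dif_compose[of f g x] Suc.prems assms(3) that by auto
  have eq: "dif (\<lambda>x. f (g x)) x v = (\<Sum>b\<in>Basis. (dif g x v \<bullet> b) *\<^sub>R dif f (g x) b)" if "x \<in> S" for x v
    unfolding d[OF that] using Suc.prems(1) assms(3) that 
    by (intro linear_eq_sum_Basis linear_dif) auto
  have "Ck_on k S (\<lambda>x. \<Sum>b\<in>Basis. (dif g x v \<bullet> b) *\<^sub>R dif f (g x) b)" for v
    using Suc.prems(1) Ck_on_Suc_lower[OF Suc.prems(2)] Suc.prems(2)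
    by (intro Ck_on_linear_combination assms(1) Suc.IH) auto
  then have "Ck_on k S (\<lambda>x. dif (\<lambda>x. f (g x)) x v)" for v
    by (subst Ck_on_cong[OF assms(1) eq]) simp_all
  with d show ?case by simp
qed

lemma smooth_on_subset: "smooth_on S f \<Longrightarrow> T \<subseteq> S \<Longrightarrow> smooth_on T f"
  by (auto simp: smooth_on_def intro: Ck_on_subset)

lemma smooth_on_cong:
  "open S \<Longrightarrow> (\<And>x. x \<in> S \<Longrightarrow> f x = g x) \<Longrightarrow> smooth_on S f \<longleftrightarrow> smooth_on S g"
  using Ck_on_cong[of S f g] by (simp add: smooth_on_def)

lemma smooth_on_eq:
  "open S \<Longrightarrow> smooth_on S f \<Longrightarrow> (\<And>x. x \<in> S \<Longrightarrow> g x = f x) \<Longrightarrow> smooth_on S g"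
  using smooth_on_cong[of S g f] by blast

lemma smooth_on_open_cover:
  assumes "\<And>x. x \<in> S \<Longrightarrow> \<exists>U. open U \<and> x \<in> U \<and> smooth_on U f"
  shows "smooth_on S f"
  unfolding smooth_on_def
proof (intro allI Ck_on_open_cover)
  show "\<exists>U. open U \<and> x \<in> U \<and> Ck_on k U f" if "x \<in> S" for k x
    using assms[OF that] by (auto simp: smooth_on_def)
qed

lemma smooth_on_differentiable: "smooth_on S f \<Longrightarrow> x \<in> S \<Longrightarrow> f differentiable at x"
  unfolding smooth_on_def by (drule spec[of _ "Suc 0"]) simp

lemma smooth_on_has_derivative: "smooth_on S f \<Longrightarrow> x \<in> S \<Longrightarrow> (f has_derivative dif f x) (at x)"
  using smooth_on_differentiable has_derivative_dif by blast

lemma smooth_on_continuous_on: "smooth_on S f \<Longrightarrow> continuous_on S f"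
  by (auto simp: smooth_on_def dest: spec[of _ 0])

lemma smooth_on_dif_direction: "smooth_on S f \<Longrightarrow> smooth_on S (\<lambda>x. dif f x v)"
  unfolding smooth_on_def
proof
  show "Ck_on k S (\<lambda>x. dif f x v)" if "\<forall>k. Ck_on k S f" for k
    using that[rule_format, of "Suc k"] by simp
qed

lemma smooth_on_const: "smooth_on S (\<lambda>x. c)"
  by (simp add: smooth_on_def Ck_on_const)

lemma smooth_on_linear: "bounded_linear L \<Longrightarrow> smooth_on S L"
  by (simp add: smooth_on_def Ck_on_linear)

lemma smooth_on_ident: "smooth_on S (\<lambda>x. x)"
  by (simp add: smooth_on_linear bounded_linear_ident)

lemma smooth_on_linear_compose:
  "bounded_linear L \<Longrightarrow> open S \<Longrightarrow> smooth_on S f \<Longrightarrow> smooth_on S (\<lambda>x. L (f x))"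
  by (simp add: smooth_on_def Ck_on_bounded_linear_compose)

lemma smooth_on_add:
  "open S \<Longrightarrow> smooth_on S f \<Longrightarrow> smooth_on S g \<Longrightarrow> smooth_on S (\<lambda>x. f x + g x)"
  by (simp add: smooth_on_def Ck_on_add)

lemma smooth_on_scaleR_const:
  "open S \<Longrightarrow> smooth_on S f \<Longrightarrow> smooth_on S (\<lambda>x. r *\<^sub>R f x)"
  by (rule smooth_on_linear_compose[OF bounded_linear_scaleR_right])

lemma smooth_on_minus: "open S \<Longrightarrow> smooth_on S f \<Longrightarrow> smooth_on S (\<lambda>x. - f x)"
  using smooth_on_scaleR_const[of S f "-1"] by simp

lemma smooth_on_diff:
  "open S \<Longrightarrow> smooth_on S f \<Longrightarrow> smooth_on S g \<Longrightarrow> smooth_on S (\<lambda>x. f x - g x)"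
  using smooth_on_add[of S f "\<lambda>x. - g x"] smooth_on_minus[of S g] by simp

lemma smooth_on_Pair:
  assumes "open S" "smooth_on S f" "smooth_on S g"
  shows "smooth_on S (\<lambda>x. (f x, g x))"
proof -
  have "smooth_on S (\<lambda>x. (f x, 0) + (0, g x))"
    using smooth_on_linear_compose[OF
        bounded_linear_Pair[OF bounded_linear_ident bounded_linear_zero] assms(1,2)]
      smooth_on_linear_compose[OF
        bounded_linear_Pair[OF bounded_linear_zero bounded_linear_ident] assms(1,3)]
    by (rule smooth_on_add[OF assms(1)])
  then show ?thesis by simp
qed

lemma smooth_on_compose:
  fixes f :: "'b::euclidean_space \<Rightarrow> 'c::real_normed_vector"
    and g :: "'a::euclidean_space \<Rightarrow> 'b"
  assumes "open S" "open T" "g ` S \<subseteq> T" "smooth_on T f" "smooth_on S g"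
  shows "smooth_on S (\<lambda>x. f (g x))"
  using assms by (simp add: smooth_on_def Ck_on_compose)

text \<open>
  In particular the tangent map \<open>(x, v) \<mapsto> (f x, Df(x) v)\<close> of a smooth \<open>f\<close> is smooth jointly in both arguments.
\<close>

lemma smooth_on_dif_apply:
  fixes f :: "'b::euclidean_space \<Rightarrow> 'c::real_normed_vector"
    and g h :: "'a::euclidean_space \<Rightarrow> 'b"
  assumes "open S" "open T" "g ` S \<subseteq> T" "smooth_on T f" "smooth_on S g" "smooth_on S h"
  shows "smooth_on S (\<lambda>x. dif f (g x) (h x))"
proof -
  have "smooth_on S (\<lambda>x. \<Sum>b\<in>Basis. (h x \<bullet> b) *\<^sub>R dif f (g x) b)"
    using assms smooth_on_compose[OF assms(1-3) smooth_on_dif_direction[OF assms(4)] assms(5)]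
    by (auto simp: smooth_on_def intro!: Ck_on_linear_combination)
  moreover have "dif f (g x) (h x) = (\<Sum>b\<in>Basis. (h x \<bullet> b) *\<^sub>R dif f (g x) b)" if "x \<in> S" for x
    using assms(3,4) that by (intro linear_eq_sum_Basis linear_dif smooth_on_differentiable) auto
  ultimately show ?thesis by (rule smooth_on_eq[OF assms(1)]) simp
qed

section \<open>Linear systems depending on a parameter\<close>

text \<open>
  A product can be differentiated where one factor is differentiable and vanishes, even if the other factor
  is merely continuous.  This starts the regularity argument for linear systems below.
\<close>

lemma has_derivative_scaleR_vanishing:
  fixes f :: "'a::real_normed_vector \<Rightarrow> 'b::real_normed_vector"
  assumes f: "(f has_derivative f') (at x)" and "f x = 0" and g: "isCont g x"
  shows "((\<lambda>z. g z *\<^sub>R f z) has_derivative (\<lambda>h. g x *\<^sub>R f' h)) (at x)"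
proof -
  have bl: "bounded_linear f'" using f by (rule has_derivative_bounded_linear)
  obtain K where K: "\<And>h. norm (f' h) \<le> norm h * K" "K \<ge> 0"
    using bounded_linear.nonneg_bounded[OF bl] by blast
  obtain d where d: "d > 0" "\<And>y. norm (y - x) < d \<Longrightarrow> norm (f y - f x - f' (y - x)) \<le> norm (y - x)"
    using f unfolding has_derivative_at_alt by (metis mult_1 zero_less_one)
  have f_le: "norm (f y) \<le> (1 + K) * norm (y - x)" if "norm (y - x) < d" for y
  proof -
    have "norm (f y) \<le> norm (f y - f x - f' (y - x)) + norm (f' (y - x))"
      using norm_triangle_ineq[of "f y - f x - f' (y - x)" "f' (y - x)"] \<open>f x = 0\<close> by simp
    also have "\<dots> \<le> norm (y - x) + norm (y - x) * K" using d(2)[OF that] K(1) by (rule add_mono)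
    finally show ?thesis by (simp add: algebra_simps)
  qed
  have "((\<lambda>z. (g z - g x) *\<^sub>R f z) has_derivative (\<lambda>h. 0)) (at x)"
    unfolding has_derivative_at_alt
  proof (intro conjI allI impI)
    fix e :: real assume "e > 0"
    then have "e / (1 + K) > 0" using K(2) by simp
    then obtain d' where d': "d' > 0" "\<And>y. dist y x < d' \<Longrightarrow> dist (g y) (g x) < e / (1 + K)"
      using g unfolding continuous_at_eps_delta by blast
    show "\<exists>d>0. \<forall>y. norm (y - x) < d \<longrightarrow>
        norm ((g y - g x) *\<^sub>R f y - (g x - g x) *\<^sub>R f x - 0) \<le> e * norm (y - x)"
    proof (intro exI[of _ "min d d'"] conjI allI impI)
      fix y assume y: "norm (y - x) < min d d'"
      have "norm ((g y - g x) *\<^sub>R f y) \<le> e / (1 + K) * ((1 + K) * norm (y - x))"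
        unfolding norm_scaleR
        using d'(2)[of y] f_le[of y] y K(2) by (intro mult_mono) (auto simp: dist_norm)
      then show "norm ((g y - g x) *\<^sub>R f y - (g x - g x) *\<^sub>R f x - 0) \<le> e * norm (y - x)"
        using K(2) by simp
    qed (use d d' in auto)
  qed (rule bounded_linear_zero)
  from has_derivative_add[OF this bounded_linear.has_derivative[OF bounded_linear_scaleR_right f, of "g x"]]
  show ?thesis by (simp add: algebra_simps)
qed

text \<open>
  Solutions of \<open>M k = v\<close> inherit the regularity of \<open>M\<close> and \<open>v\<close>: with a left inverse \<open>L\<close> of \<open>M(x)\<close>,
  the solution satisfies \<open>k = L v - (L M - 1) k\<close>, where the factor \<open>L M - 1\<close> vanishes at \<open>x\<close>.  This form
  avoids inverting matrices with variable entries.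
\<close>

locale linear_system =
  fixes M :: "'a::real_normed_vector \<Rightarrow> 'f::euclidean_space \<Rightarrow> 'g::euclidean_space"
    and k :: "'a \<Rightarrow> 'f" and v :: "'a \<Rightarrow> 'g" and U :: "'a set" and x :: 'a
  assumes open_U: "open U" and x_in: "x \<in> U"
    and lin: "\<And>z. z \<in> U \<Longrightarrow> linear (M z)"
    and sol: "\<And>z. z \<in> U \<Longrightarrow> M z (k z) = v z"
    and inj: "inj (M x)"
begin

lemma fixed_point_form:
  obtains L where "linear L" "\<And>z. L (M x z) = z"
    "\<And>z. z \<in> U \<Longrightarrow> k z = L (v z) - (\<Sum>b\<in>Basis. (k z \<bullet> b) *\<^sub>R (L (M z b) - b))"
proof -
  obtain L where L: "linear L" "L \<circ> M x = id"
    using linear_injective_left_inverse[OF lin[OF x_in] inj] by blast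
  have "k z = L (v z) - (\<Sum>b\<in>Basis. (k z \<bullet> b) *\<^sub>R (L (M z b) - b))" if "z \<in> U" for z
  proof -
    have "linear (\<lambda>a. L (M z a))"
      using linear_compose[OF lin[OF that] L(1)] by (simp add: o_def)
    from linear_eq_sum_Basis[OF this, of "k z"]
    show ?thesis
      by (simp add: sol[OF that] scaleR_diff_right sum_subtractf euclidean_representation)
  qed
  from that[OF L(1) _ this] show ?thesis using L(2) by (simp add: fun_eq_iff)
qed

lemma isCont_solution:
  assumes M: "\<And>b. b \<in> Basis \<Longrightarrow> isCont (\<lambda>z. M z b) x" and v: "isCont v x"
  shows "isCont k x"
proof -
  obtain L where L: "linear L" "\<And>z. L (M x z) = z"
    "\<And>z. z \<in> U \<Longrightarrow> k z = L (v z) - (\<Sum>b\<in>Basis. (k z \<bullet> b) *\<^sub>R (L (M z b) - b))"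
    using fixed_point_form by blast
  have bl: "bounded_linear L" using L(1) by (simp add: linear_linear)
  define r where "r z = (\<Sum>b\<in>Basis. norm (L (M z b) - b))" for z
  have r0: "r x = 0" by (simp add: r_def L(2))
  have r_cont: "isCont r x" unfolding r_def
    by (intro continuous_intros bounded_linear.isCont[OF bl] M)
  have Lv: "isCont (\<lambda>z. L (v z)) x" by (intro bounded_linear.isCont[OF bl] v)
  have est: "norm (k z - L (v z)) \<le> norm (k z) * r z" if "z \<in> U" for z
  proof -
    have "a = b - c \<Longrightarrow> norm (a - b) = norm c" for a b c :: 'f by simp
    from this[OF L(3)[OF that]]
    have "norm (k z - L (v z)) = norm (\<Sum>b\<in>Basis. (k z \<bullet> b) *\<^sub>R (L (M z b) - b))" .
    also have "\<dots> \<le> (\<Sum>b\<in>Basis. norm (k z) * norm (L (M z b) - b))"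
      by (rule sum_norm_le) (auto intro!: mult_right_mono simp: Basis_le_norm)
    finally show ?thesis by (simp add: r_def sum_distrib_left)
  qed
  have k0: "k x = L (v x)" using est[OF x_in] r0 by simp
  have r_nonneg: "r z \<ge> 0" for z by (simp add: r_def sum_nonneg)
  have "\<forall>\<^sub>F z in at x. r z < 1 / 2"
    using order_tendstoD(2)[of r "r x" "at x" "1/2"] r_cont r0 by (simp add: isCont_def)
  moreover have "\<forall>\<^sub>F z in at x. z \<in> U"
    using open_U x_in by (simp add: eventually_at_in_open')
  ultimately have "\<forall>\<^sub>F z in at x. norm (k z - k x) \<le> norm (L (v z) - L (v x)) + 2 * norm (L (v z)) * r z"
  proof eventually_elim
    case (elim z)
    have "norm (k z) \<le> norm (k z - L (v z)) + norm (L (v z))"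
      using norm_triangle_ineq[of "k z - L (v z)" "L (v z)"] by simp
    also have "\<dots> \<le> norm (k z) * (1/2) + norm (L (v z))"
      using est[OF elim(2)] elim(1) mult_left_mono[of "r z" "1/2" "norm (k z)"] by simp
    finally have "norm (k z) \<le> 2 * norm (L (v z))" by simp
    then have "norm (k z) * r z \<le> 2 * norm (L (v z)) * r z" 
      using r_nonneg by (rule mult_right_mono)
    moreover have "norm (k z - k x) \<le> norm (k z - L (v z)) + norm (L (v z) - L (v x))"
      unfolding k0 using norm_triangle_ineq[of "k z - L (v z)" "L (v z) - L (v x)"] by simp
    ultimately show ?case using est[OF elim(2)] by simp
  qed
  moreover have "((\<lambda>z. norm (L (v z) - L (v x)) + 2 * norm (L (v z)) * r z) \<longlongrightarrow>
      norm (L (v x) - L (v x)) + 2 * norm (L (v x)) * r x) (at x)"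
    using Lv r_cont unfolding isCont_def by (intro tendsto_intros)
  then have "((\<lambda>z. norm (L (v z) - L (v x)) + 2 * norm (L (v z)) * r z) \<longlongrightarrow> 0) (at x)"
    by (simp add: r0)
  ultimately have "((\<lambda>z. k z - k x) \<longlongrightarrow> 0) (at x)"
    by (rule Lim_null_comparison)
  then show ?thesis by (simp add: isCont_def LIM_zero_iff)
qed

lemma differentiable_solution:
  assumes M: "\<And>b. b \<in> Basis \<Longrightarrow> (\<lambda>z. M z b) differentiable (at x)" and v: "v differentiable (at x)"
  shows "k differentiable (at x)"
proof -
  obtain L where L: "linear L" "\<And>z. L (M x z) = z"
    "\<And>z. z \<in> U \<Longrightarrow> k z = L (v z) - (\<Sum>b\<in>Basis. (k z \<bullet> b) *\<^sub>R (L (M z b) - b))"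
    using fixed_point_form by blast
  have bl: "bounded_linear L" using L(1) by (simp add: linear_linear)
  have k: "isCont k x"
    using M v by (intro isCont_solution differentiable_imp_continuous_within)
  have "(\<lambda>z. (k z \<bullet> b) *\<^sub>R (L (M z b) - b)) differentiable (at x)" if b: "b \<in> Basis" for b
  proof -
    have "((\<lambda>z. L (M z b) - b) has_derivative (\<lambda>h. L (dif (\<lambda>z. M z b) x h) - 0)) (at x)"
      by (intro derivative_intros bounded_linear.has_derivative[OF bl] has_derivative_dif M b)
    from has_derivative_scaleR_vanishing[OF this, of "\<lambda>z. k z \<bullet> b"] show ?thesis
      using k by (auto simp: L(2) differentiable_def intro!: continuous_intros)
  qed
  moreover have "(\<lambda>z. L (v z)) differentiable (at x)"
    using bounded_linear.has_derivative[OF bl has_derivative_dif[OF v]] by (auto simp: differentiable_def)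
  ultimately have "(\<lambda>z. L (v z) - (\<Sum>b\<in>Basis. (k z \<bullet> b) *\<^sub>R (L (M z b) - b))) differentiable (at x)"
    by (intro differentiable_diff differentiable_sum) auto
  then show ?thesis
    by (subst dif_cong(2)[OF open_U x_in L(3)]) simp_all
qed

end

text \<open>
  Differentiating \<open>M k = v\<close> shows that each directional derivative of \<open>k\<close> solves a system with the same matrix,
  so that the order of differentiability can be raised step by step.
\<close>

lemma Ck_on_linear_system:
  fixes M :: "'a::euclidean_space \<Rightarrow> 'f::euclidean_space \<Rightarrow> 'g::euclidean_space"
  assumes S: "open S" and lin: "\<And>z. z \<in> S \<Longrightarrow> linear (M z)" and inj: "\<And>z. z \<in> S \<Longrightarrow> inj (M z)"
    and "\<And>b. Ck_on n S (\<lambda>z. M z b)" and "\<And>z. z \<in> S \<Longrightarrow> M z (k z) = v z" and "Ck_on n S v"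
  shows "Ck_on n S k"
  using assms(4-6)
proof (induction n arbitrary: k v)
  case 0
  have "isCont k x" if "x \<in> S" for x
  proof -
    interpret linear_system M k v S x using S that lin 0(2) inj by (intro linear_system.intro) auto
    show ?thesis using 0 that S by (intro isCont_solution) (auto simp: continuous_on_eq_continuous_at)
  qed
  then show ?case by (simp add: continuous_at_imp_continuous_on)
next
  case (Suc n)
  have k: "k differentiable (at x)" if "x \<in> S" for x
  proof -
    interpret linear_system M k v S x using S that lin Suc(3) inj by (intro linear_system.intro) auto
    show ?thesis using Suc.prems that by (intro differentiable_solution) auto
  qed
  have kn: "Ck_on n S k"
    using Suc.prems by (intro Suc.IH[of k v]) (auto intro: Ck_on_Suc_lower simp del: Ck_on.simps)
  define v' where "v' w x = dif v x w - (\<Sum>b\<in>Basis. (k x \<bullet> b) *\<^sub>R dif (\<lambda>z. M z b) x w)" for w x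
  have "M x (dif k x w) = v' w x" if x: "x \<in> S" for x w
  proof -
    have M_sum: "M z a = (\<Sum>b\<in>Basis. (a \<bullet> b) *\<^sub>R M z b)" if "z \<in> S" for z a
      using linear_eq_sum_Basis[OF lin[OF that]] .
    have "((\<lambda>z. \<Sum>b\<in>Basis. (k z \<bullet> b) *\<^sub>R M z b) has_derivative
       (\<lambda>w. \<Sum>b\<in>Basis. (k x \<bullet> b) *\<^sub>R dif (\<lambda>z. M z b) x w + (dif k x w \<bullet> b) *\<^sub>R M x b)) (at x)"
      using Suc.prems(1) x 
      by (intro derivative_intros has_derivative_dif k) auto
    moreover have "dif v x = dif (\<lambda>z. \<Sum>b\<in>Basis. (k z \<bullet> b) *\<^sub>R M z b) x"
      by (rule dif_cong(1)[OF S x]) (use Suc.prems(2) M_sum in metis)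
    ultimately have "dif v x w = (\<Sum>b\<in>Basis. (k x \<bullet> b) *\<^sub>R dif (\<lambda>z. M z b) x w) + M x (dif k x w)"
      by (simp add: dif_eqI M_sum[OF x, of "dif k x w"] sum.distrib)
    then show ?thesis by (simp add: v'_def)
  qed
  moreover have "Ck_on n S (v' w)" for w
  proof -
    have "Ck_on n S (\<lambda>x. dif v x w + - 1 *\<^sub>R (\<Sum>b\<in>Basis. (k x \<bullet> b) *\<^sub>R dif (\<lambda>z. M z b) x w))"
      using Suc.prems
      by (intro Ck_on_add[OF S] Ck_on_bounded_linear_compose[OF bounded_linear_scaleR_right S]
          Ck_on_linear_combination S kn) auto
    then show ?thesis by (simp add: v'_def[abs_def])
  qed
  ultimately have "Ck_on n S (\<lambda>x. dif k x w)" for w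
    using Suc.prems(1) by (intro Suc.IH[of _ "v' w"]) (auto intro: Ck_on_Suc_lower simp del: Ck_on.simps)
  with k show ?case by simp
qed

section \<open>The smooth inverse function theorem\<close>

text \<open>
  The \<open>C\<^sup>1\<close> theorem yields the local inverse \<open>g\<close>.  Its derivatives solve the linear system
  \<open>Df(g y) (Dg(y) w) = w\<close>, whose coefficients are as smooth as \<open>g\<close>; this bootstraps \<open>g\<close> to all orders.
\<close>

theorem smooth_inverse_function_theorem:
  fixes f :: "'a::euclidean_space \<Rightarrow> 'a"
  assumes U: "open U" and f: "smooth_on U f" and x0: "x0 \<in> U" and inj: "inj (dif f x0)"
  obtains U' V g where "open U'" "U' \<subseteq> U" "x0 \<in> U'" "open V" "f x0 \<in> V"
    "homeomorphism U' V f g" "smooth_on V g"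
proof -
  let ?f' = "\<lambda>x. Blinfun (dif f x)"
  have bl: "bounded_linear (dif f x)" if "x \<in> U" for x
    using linear_dif[OF smooth_on_differentiable[OF f that]] by (simp add: linear_linear)
  have app: "blinfun_apply (?f' x) = dif f x" if "x \<in> U" for x
    using bl[OF that] by (rule bounded_linear_Blinfun_apply)
  obtain L where L: "linear L" "L \<circ> dif f x0 = id"
    using linear_injective_left_inverse[OF linear_dif[OF smooth_on_differentiable[OF f x0]] inj] by blast
  have "continuous_on U ?f'"
  proof (rule continuous_on_blinfun_componentwise)
    fix i :: 'a
    have "continuous_on U (\<lambda>x. dif f x i)"
      by (intro smooth_on_continuous_on smooth_on_dif_direction f)
    then show "continuous_on U (\<lambda>x. blinfun_apply (?f' x) i)"
      by (rule continuous_on_eq) (simp add: app)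
  qed
  moreover have "(f has_derivative blinfun_apply (?f' x)) (at x)" if "x \<in> U" for x
    using smooth_on_has_derivative[OF f that] by (simp add: app[OF that])
  moreover have "Blinfun L o\<^sub>L ?f' x0 = id_blinfun"
    using L by (intro blinfun_eqI) 
      (simp add: app[OF x0] bounded_linear_Blinfun_apply linear_linear fun_eq_iff)
  ultimately obtain U' V g g' where ift: "open U'" "U' \<subseteq> U" "x0 \<in> U'" "open V" "f x0 \<in> V"
    and hom: "homeomorphism U' V f g"
    and g': "\<And>y. y \<in> V \<Longrightarrow> (g has_derivative (g' y)) (at y)"
      "\<And>y. y \<in> V \<Longrightarrow> g' y = inv_into UNIV (blinfun_apply (?f' (g y)))"
    and bij: "\<And>y. y \<in> V \<Longrightarrow> bij (blinfun_apply (?f' (g y)))"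
    using U x0 inverse_function_theorem[of U f ?f' x0 "Blinfun L"] by metis
  have gV: "g y \<in> U" if "y \<in> V" for y
    using hom that ift(2) by (auto simp: homeomorphism_def)
  have bij': "bij (dif f (g y))" if "y \<in> V" for y
    using bij[OF that] app[OF gV[OF that]] by simp
  have solves: "dif f (g y) (dif g y w) = w" if "y \<in> V" for y w
    using g'(2)[OF that] app[OF gV[OF that]] bij'[OF that] 
    by (simp add: dif_eqI[OF g'(1)[OF that]] bij_is_surj surj_f_inv_f)
  have "Ck_on k V g" for k
  proof (induction k)
    case 0
    then show ?case using hom by (simp add: homeomorphism_def)
  next
    case (Suc k)
    have "Ck_on k V (\<lambda>y. dif g y w)" for w
    proof (rule Ck_on_linear_system[OF \<open>open V\<close>, of "\<lambda>y. dif f (g y)" _ _ "\<lambda>y. w"])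
      show "linear (dif f (g y))" "inj (dif f (g y))" if "y \<in> V" for y
        using that gV bij' f by (auto intro: linear_dif smooth_on_differentiable bij_is_inj)
      show "Ck_on k V (\<lambda>y. dif f (g y) b)" for b
        using smooth_on_dif_direction[OF f, of b] gV
        by (intro Ck_on_compose[OF \<open>open V\<close> U _ _ Suc]) (auto simp: smooth_on_def)
    qed (use solves Ck_on_const in auto)
    then show ?case using g'(1) by (auto simp: differentiable_def)
  qed
  then show ?thesis using that ift hom by (auto simp: smooth_on_def)
qed

section \<open>Symmetry of second derivatives\<close>

lemma DERIV_along_line:
  fixes f :: "'a::real_normed_vector \<Rightarrow> real"
  assumes "f differentiable (at (x + s *\<^sub>R u))"
  shows "((\<lambda>s. f (x + s *\<^sub>R u)) has_real_derivative dif f (x + s *\<^sub>R u) u) (at s)"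
proof -
  have "((\<lambda>s. x + s *\<^sub>R u) has_derivative (\<lambda>h. h *\<^sub>R u)) (at s)"
    by (auto intro!: derivative_eq_intros)
  from diff_chain_at[OF this has_derivative_dif[OF assms]]
  show ?thesis
    by (simp add: o_def has_field_derivative_def linear_scale[OF linear_dif[OF assms]] mult_commute_abs)
qed

text \<open>
  The second difference is symmetric in \<open>u\<close> and \<open>v\<close>.  Applying the mean value theorem twice, in either order,
  expresses it by either mixed derivative at a nearby point.
\<close>

lemma second_difference_eq_second_derivative:
  fixes f :: "'a::euclidean_space \<Rightarrow> real"
  assumes f: "smooth_on (ball x \<delta>) f" and h: "h > 0" "h * (norm u + norm v) < \<delta>"
  obtains z where "z \<in> ball x \<delta>"
    "f (x + h *\<^sub>R u + h *\<^sub>R v) - f (x + h *\<^sub>R u) - f (x + h *\<^sub>R v) + f x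
      = h\<^sup>2 * dif (\<lambda>x. dif f x u) z v"
proof -
  have in_ball: "x + s *\<^sub>R u + t *\<^sub>R v \<in> ball x \<delta>" if "0 \<le> s" "s \<le> h" "0 \<le> t" "t \<le> h" for s t
  proof -
    have "norm (s *\<^sub>R u + t *\<^sub>R v) \<le> \<bar>s\<bar> * norm u + \<bar>t\<bar> * norm v"
      by (metis norm_scaleR norm_triangle_ineq)
    also have "\<dots> \<le> h * norm u + h * norm v" using that by (intro add_mono mult_right_mono) auto
    finally have "norm (s *\<^sub>R u + t *\<^sub>R v) < \<delta>" using h(2) by (simp add: algebra_simps)
    then have "dist x (x + (s *\<^sub>R u + t *\<^sub>R v)) < \<delta>"
      unfolding dist_norm by (metis add_diff_cancel_left' norm_minus_commute)
    then show ?thesis by (simp add: add.assoc)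
  qed
  note f_diff = smooth_on_differentiable[OF f]
  note g_diff = smooth_on_differentiable[OF smooth_on_dif_direction[OF f, of u]]
  define a where "a s = f ((x + h *\<^sub>R v) + s *\<^sub>R u) - f (x + s *\<^sub>R u)" for s
  have "DERIV a s :> dif f ((x + h *\<^sub>R v) + s *\<^sub>R u) u - dif f (x + s *\<^sub>R u) u" if "0 \<le> s" "s \<le> h" for s
    unfolding a_def[abs_def] using in_ball[OF that, of 0] in_ball[OF that, of h] h
    by (intro DERIV_diff DERIV_along_line f_diff) (auto simp: algebra_simps)
  from MVT2[OF h(1) this] obtain \<xi> where \<xi>: "0 < \<xi>" "\<xi> < h"
    "a h - a 0 = h * (dif f ((x + h *\<^sub>R v) + \<xi> *\<^sub>R u) u - dif f (x + \<xi> *\<^sub>R u) u)"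
    by auto
  have "DERIV (\<lambda>t. dif f ((x + \<xi> *\<^sub>R u) + t *\<^sub>R v) u) t :> dif (\<lambda>x. dif f x u) ((x + \<xi> *\<^sub>R u) + t *\<^sub>R v) v"
    if "0 \<le> t" "t \<le> h" for t
    using in_ball[of \<xi> t] that \<xi> by (intro DERIV_along_line g_diff) auto
  from MVT2[OF h(1) this] obtain \<eta> where \<eta>: "0 < \<eta>" "\<eta> < h"
    "dif f ((x + \<xi> *\<^sub>R u) + h *\<^sub>R v) u - dif f (x + \<xi> *\<^sub>R u) u
      = h * dif (\<lambda>x. dif f x u) (x + \<xi> *\<^sub>R u + \<eta> *\<^sub>R v) v"
    by auto
  have "f (x + h *\<^sub>R u + h *\<^sub>R v) - f (x + h *\<^sub>R u) - f (x + h *\<^sub>R v) + f x = a h - a 0"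
    by (simp add: a_def algebra_simps)
  also have "\<dots> = h\<^sup>2 * dif (\<lambda>x. dif f x u) (x + \<xi> *\<^sub>R u + \<eta> *\<^sub>R v) v"
    using \<xi>(3) \<eta>(3) by (simp add: power2_eq_square add_ac)
  finally show ?thesis using that in_ball[of \<xi> \<eta>] \<xi> \<eta> by auto
qed

lemma second_derivative_symmetric_real:
  fixes f :: "'a::euclidean_space \<Rightarrow> real"
  assumes S: "open S" "x \<in> S" and f: "smooth_on S f"
  shows "dif (\<lambda>x. dif f x u) x v = dif (\<lambda>x. dif f x v) x u"
proof (rule dist_eq_0_iff[THEN iffD1], rule ccontr)
  let ?P = "\<lambda>u v x. dif (\<lambda>x. dif f x u) x v"
  assume *: "dist (?P u v x) (?P v u x) \<noteq> 0"
  define e where "e = dist (?P u v x) (?P v u x) / 2"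
  have e: "e > 0" using * by (simp add: e_def)
  have cont: "isCont (?P u v) x" for u v
    using smooth_on_continuous_on[OF smooth_on_dif_direction[OF smooth_on_dif_direction[OF f]]] S
    by (simp add: continuous_on_eq_continuous_at)
  obtain d1 where d1: "d1 > 0" "\<And>z. dist z x < d1 \<Longrightarrow> dist (?P u v z) (?P u v x) < e"
    using cont[of u v] e unfolding continuous_at_eps_delta by blast
  obtain d2 where d2: "d2 > 0" "\<And>z. dist z x < d2 \<Longrightarrow> dist (?P v u z) (?P v u x) < e"
    using cont[of v u] e unfolding continuous_at_eps_delta by blast
  obtain d3 where d3: "d3 > 0" "ball x d3 \<subseteq> S" using S by (auto simp: open_contains_ball)
  define d where "d = min d1 (min d2 d3)"
  have d: "d > 0" using d1 d2 d3 by (simp add: d_def)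
  define h where "h = d / (norm u + norm v + 1)"
  have h: "h > 0" using d by (simp add: h_def add_nonneg_pos)
  have "h * (norm u + norm v) = d * ((norm u + norm v) / (norm u + norm v + 1))" by (simp add: h_def)
  also have "\<dots> < d * 1" using d by (intro mult_strict_left_mono) (auto simp: add_nonneg_pos)
  finally have h': "h * (norm u + norm v) < d" by simp
  have sm: "smooth_on (ball x d) f" using d3 by (auto intro!: smooth_on_subset[OF f] simp: d_def)
  obtain z1 where z1: "z1 \<in> ball x d"
    "f (x + h *\<^sub>R u + h *\<^sub>R v) - f (x + h *\<^sub>R u) - f (x + h *\<^sub>R v) + f x = h\<^sup>2 * ?P u v z1"
    using second_difference_eq_second_derivative[OF sm h h'] by blast
  obtain z2 where z2: "z2 \<in> ball x d"
    "f (x + h *\<^sub>R v + h *\<^sub>R u) - f (x + h *\<^sub>R v) - f (x + h *\<^sub>R u) + f x = h\<^sup>2 * ?P v u z2"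
    using second_difference_eq_second_derivative[OF sm h, of v u] h' by (auto simp: add.commute)
  have "h\<^sup>2 * ?P u v z1 = h\<^sup>2 * ?P v u z2"
    unfolding z1(2)[symmetric] z2(2)[symmetric] by (simp add: algebra_simps)
  then have "?P u v z1 = ?P v u z2" using h by simp
  moreover have "dist (?P u v z1) (?P u v x) < e" "dist (?P v u z2) (?P v u x) < e"
    using z1(1) z2(1) d1(2)[of z1] d2(2)[of z2] by (auto simp: d_def dist_commute)
  ultimately have "dist (?P u v x) (?P v u x) < 2 * e"
    using dist_triangle_half_r[of "?P u v z1" "?P u v x" "2 * e" "?P v u x"] by simp
  then show False by (simp add: e_def)
qed

theorem second_derivative_symmetric:
  fixes f :: "'a::euclidean_space \<Rightarrow> 'b::euclidean_space"
  assumes S: "open S" "x \<in> S" and f: "smooth_on S f"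
  shows "dif (\<lambda>x. dif f x u) x v = dif (\<lambda>x. dif f x v) x u"
proof (rule euclidean_eqI)
  fix b :: 'b assume "b \<in> Basis"
  have fb: "smooth_on S (\<lambda>x. f x \<bullet> b)"
    by (rule smooth_on_linear_compose[OF bounded_linear_inner_left S(1) f])
  have inner_dif: "dif (\<lambda>z. g z \<bullet> b) z u = dif g z u \<bullet> b" if "g differentiable (at z)" for g :: "'a \<Rightarrow> 'b" and z u
    using dif_eqI[OF bounded_linear.has_derivative[OF bounded_linear_inner_left has_derivative_dif[OF that]]]
    by simp
  have "dif (\<lambda>x. dif (\<lambda>x. f x \<bullet> b) x u) x v = dif (\<lambda>x. dif f x u) x v \<bullet> b" for u v
  proof -
    have "dif (\<lambda>x. dif (\<lambda>x. f x \<bullet> b) x u) x = dif (\<lambda>x. dif f x u \<bullet> b) x"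
      using f by (intro dif_cong(1)[OF S] inner_dif smooth_on_differentiable)
    then show ?thesis
      using smooth_on_differentiable[OF smooth_on_dif_direction[OF f] S(2)] by (simp add: inner_dif)
  qed
  with second_derivative_symmetric_real[OF S fb, of u v]
  show "dif (\<lambda>x. dif f x u) x v \<bullet> b = dif (\<lambda>x. dif f x v) x u \<bullet> b" by simp
qed

lemma dif_fst_snd:
  fixes f :: "'a::euclidean_space \<times> 'b::euclidean_space \<Rightarrow> 'c::real_normed_vector"
  assumes "f differentiable (at (a, b))"
  shows "dif (\<lambda>x. f (x, b)) a u = dif f (a, b) (u, 0)" and "dif (\<lambda>x. f (a, x)) b v = dif f (a, b) (0, v)"
proof -
  have 1: "((\<lambda>x. (x, b)) has_derivative (\<lambda>u. (u, 0))) (at a)" 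
    and 2: "((\<lambda>x. (a, x)) has_derivative (\<lambda>u. (0, u))) (at b)"
    by (auto intro!: derivative_eq_intros)
  have "((\<lambda>x. f (x, b)) has_derivative (\<lambda>u. dif f (a, b) (u, 0))) (at a)"
    using diff_chain_at[OF 1, of f "dif f (a, b)"] has_derivative_dif[OF assms] by (simp add: o_def)
  then show "dif (\<lambda>x. f (x, b)) a u = dif f (a, b) (u, 0)" by (simp add: dif_eqI)
  have "((\<lambda>x. f (a, x)) has_derivative (\<lambda>u. dif f (a, b) (0, u))) (at b)"
    using diff_chain_at[OF 2, of f "dif f (a, b)"] has_derivative_dif[OF assms] by (simp add: o_def)
  then show "dif (\<lambda>x. f (a, x)) b v = dif f (a, b) (0, v)" by (simp add: dif_eqI)
qed

definition dif2 :: "('a::real_normed_vector \<Rightarrow> 'b::real_normed_vector) \<Rightarrow> 'a \<Rightarrow> 'a \<Rightarrow> 'a \<Rightarrow> 'b"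
  where "dif2 f x u v = dif (\<lambda>z. dif f z v) x u"

lemma dif2_symmetric:
  fixes f :: "'a::euclidean_space \<Rightarrow> 'b::euclidean_space"
  shows "open S \<Longrightarrow> x \<in> S \<Longrightarrow> smooth_on S f \<Longrightarrow> dif2 f x u v = dif2 f x v u"
  unfolding dif2_def by (rule second_derivative_symmetric)

lemma linear_dif2_left:
  assumes "smooth_on S f" "x \<in> S"
  shows "linear (\<lambda>u. dif2 f x u v)"
  unfolding dif2_def
  using linear_dif[OF smooth_on_differentiable[OF smooth_on_dif_direction[OF assms(1)] assms(2)]] .

lemma has_derivative_dif_direction:
  "x \<in> S \<Longrightarrow> smooth_on S f \<Longrightarrow> ((\<lambda>z. dif f z v) has_derivative (\<lambda>u. dif2 f x u v)) (at x)"
  unfolding dif2_def by (rule smooth_on_has_derivative[OF smooth_on_dif_direction])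

lemma dif2_eq_sum_Basis:
  fixes f :: "'a::euclidean_space \<Rightarrow> 'b::real_normed_vector"
  assumes S: "open S" "x \<in> S" and f: "smooth_on S f"
  shows "dif2 f x u v = (\<Sum>b\<in>Basis. (v \<bullet> b) *\<^sub>R dif2 f x u b)"
proof -
  have "((\<lambda>z. \<Sum>b\<in>Basis. (v \<bullet> b) *\<^sub>R dif f z b) has_derivative
      (\<lambda>h. \<Sum>b\<in>Basis. (v \<bullet> b) *\<^sub>R dif2 f x h b)) (at x)"
    by (intro derivative_intros has_derivative_dif_direction[OF S(2) f])
  moreover have "dif (\<lambda>z. dif f z v) x = dif (\<lambda>z. \<Sum>b\<in>Basis. (v \<bullet> b) *\<^sub>R dif f z b) x"
    by (rule dif_cong(1)[OF S]) (rule linear_eq_sum_Basis[OF linear_dif[OF smooth_on_differentiable[OF f]]])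
  ultimately show ?thesis unfolding dif2_def[of f x u v] by (simp add: dif_eqI)
qed

text \<open>
  The product rule for the pairing of a moving differential with a moving vector.  The second-order
  computations below rest on it.
\<close>

lemma has_derivative_dif_apply:
  fixes f :: "'a::euclidean_space \<Rightarrow> 'b::real_normed_vector" and p v :: "'d::real_normed_vector \<Rightarrow> 'a"
  assumes S: "open S" "p x \<in> S" and f: "smooth_on S f"
    and p: "(p has_derivative p') (at x)" and v: "(v has_derivative v') (at x)"
  shows "((\<lambda>z. dif f (p z) (v z)) has_derivative (\<lambda>h. dif2 f (p x) (p' h) (v x) + dif f (p x) (v' h))) (at x)"
proof -
  have lin: "linear (dif f z)" if "z \<in> S" for z
    using smooth_on_differentiable[OF f that] by (rule linear_dif)
  note g = has_derivative_dif_direction[OF S(2) f]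
  have gp: "((\<lambda>z. dif f (p z) b) has_derivative (\<lambda>h. dif2 f (p x) (p' h) b)) (at x)" for b
    using diff_chain_at[OF p g] by (simp add: o_def)
  have 1: "((\<lambda>z. \<Sum>b\<in>Basis. (v z \<bullet> b) *\<^sub>R dif f (p z) b) has_derivative
      (\<lambda>h. \<Sum>b\<in>Basis. (v x \<bullet> b) *\<^sub>R dif2 f (p x) (p' h) b + (v' h \<bullet> b) *\<^sub>R dif f (p x) b)) (at x)"
    by (intro derivative_intros gp v)
  note 2 = dif2_eq_sum_Basis[OF S f]
  have "isCont p x" using p by (rule has_derivative_continuous)
  then obtain N where N: "open N" "x \<in> N" "\<And>z. z \<in> N \<Longrightarrow> p z \<in> S"
    using S continuous_at_open[of x p] by metis
  have "((\<lambda>z. dif f (p z) (v z)) has_derivative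
      (\<lambda>h. \<Sum>b\<in>Basis. (v x \<bullet> b) *\<^sub>R dif2 f (p x) (p' h) b + (v' h \<bullet> b) *\<^sub>R dif f (p x) b)) (at x)"
    by (rule has_derivative_transform_within_open[OF 1 N(1,2)]) (rule linear_eq_sum_Basis[OF lin[OF N(3)], symmetric])
  moreover have "(\<Sum>b\<in>Basis. (v x \<bullet> b) *\<^sub>R dif2 f (p x) (p' h) b + (v' h \<bullet> b) *\<^sub>R dif f (p x) b)
      = dif2 f (p x) (p' h) (v x) + dif f (p x) (v' h)" for h
    unfolding sum.distrib 2[symmetric] linear_eq_sum_Basis[OF lin[OF S(2)], symmetric] ..
  ultimately show ?thesis by simp
qed

lemma linear_dif2_right:
  fixes f :: "'a::euclidean_space \<Rightarrow> 'b::real_normed_vector"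
  assumes S: "open S" "x \<in> S" and f: "smooth_on S f"
  shows "linear (\<lambda>v. dif2 f x u v)"
proof -
  have "linear (\<lambda>v. \<Sum>b\<in>Basis. (v \<bullet> b) *\<^sub>R dif2 f x u b)"
    by (rule linearI) (simp_all add: inner_add_left scaleR_add_left sum.distrib scaleR_sum_right)
  then show ?thesis by (subst dif2_eq_sum_Basis[OF S f])
qed

section \<open>Local solutions of autonomous differential equations\<close>

text \<open>
  The directional derivatives are bounded on the compact ball, which bounds the operator norm.
\<close>

lemma smooth_on_imp_lipschitz_on_cball:
  fixes f :: "'a::euclidean_space \<Rightarrow> 'b::real_normed_vector"
  assumes f: "smooth_on U f" and sub: "cball x0 r \<subseteq> U"
  obtains L where "L \<ge> 0"
    "\<And>x y. x \<in> cball x0 r \<Longrightarrow> y \<in> cball x0 r \<Longrightarrow> norm (f x - f y) \<le> L * norm (x - y)"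
proof -
  have "\<exists>K. \<forall>x\<in>cball x0 r. norm (dif f x b) \<le> K" for b
  proof -
    have "continuous_on (cball x0 r) (\<lambda>x. dif f x b)"
      using smooth_on_continuous_on[OF smooth_on_dif_direction[OF f]] sub continuous_on_subset by blast
    then have "compact ((\<lambda>x. dif f x b) ` cball x0 r)" by (intro compact_continuous_image) auto
    then show ?thesis by (force dest: compact_imp_bounded simp: bounded_iff)
  qed
  then obtain K where K: "\<And>b x. x \<in> cball x0 r \<Longrightarrow> norm (dif f x b) \<le> K b" by metis
  define L where "L = (\<Sum>b\<in>Basis. \<bar>K b\<bar>)"
  have onorm: "onorm (dif f x) \<le> L" if "x \<in> cball x0 r" for x
  proof (rule onorm_le)
    fix v
    have "x \<in> U" using that sub by blast
    then have "norm (dif f x v) = norm (\<Sum>b\<in>Basis. (v \<bullet> b) *\<^sub>R dif f x b)"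
      using linear_eq_sum_Basis[OF linear_dif[OF smooth_on_differentiable[OF f]]] by metis
    also have "\<dots> \<le> (\<Sum>b\<in>Basis. norm v * \<bar>K b\<bar>)"
      using K[OF that] by (intro sum_norm_le) (auto intro!: mult_mono Basis_le_norm intro: order_trans[OF _ abs_ge_self])
    finally show "norm (dif f x v) \<le> L * norm v" by (simp add: L_def sum_distrib_left mult.commute)
  qed
  show ?thesis
  proof (rule that)
    show "L \<ge> 0" by (simp add: L_def sum_nonneg)
    show "norm (f x - f y) \<le> L * norm (x - y)" if "x \<in> cball x0 r" "y \<in> cball x0 r" for x y
      by (rule differentiable_bound[OF convex_cball _ onorm that])
        (use sub smooth_on_has_derivative[OF f] in \<open>blast intro: has_derivative_at_withinI\<close>)
  qed
qed

text \<open>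
  Picard iteration: for short times the integral operator is a contraction of the space of bounded continuous
  functions.  Solutions are kept on the whole line by freezing time outside of \<open>[-\<epsilon>, \<epsilon>]\<close>.
\<close>

lemma lipschitz_ode_local_solution:
  fixes g :: "'a::euclidean_space \<Rightarrow> 'a"
  assumes L: "L \<ge> 0" "\<And>x y. norm (g x - g y) \<le> L * norm (x - y)"
  obtains \<epsilon> x where "\<epsilon> > 0" "x 0 = x0"
    "\<And>t. \<bar>t\<bar> < \<epsilon> \<Longrightarrow> (x has_vector_derivative g (x t)) (at t)"
proof -
  \<comment> \<open>Both integrals in the operator start at \<open>-\<epsilon>\<close>, so its Lipschitz constant is at most \<open>4 \<epsilon> L\<close>.\<close>
  define \<epsilon> where "\<epsilon> = 1 / (8 * (L + 1))"
  have \<epsilon>: "\<epsilon> > 0" "4 * \<epsilon> * L \<le> 1 / 2" using L(1) by (auto simp: \<epsilon>_def field_simps)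
  have g_cont: "continuous_on UNIV g"
  proof (rule lipschitz_on_continuous_on)
    show "L-lipschitz_on UNIV g" using L by (auto simp: lipschitz_on_def dist_norm)
  qed
  define h where "h \<phi> t = integral {- \<epsilon>..t} (\<lambda>s. g (apply_bcontfun \<phi> s))" for \<phi> :: "real \<Rightarrow>\<^sub>C 'a" and t
  define \<tau> :: "real \<Rightarrow> real" where "\<tau> t = max (- \<epsilon>) (min \<epsilon> t)" for t
  have \<tau>: "\<tau> t \<in> {- \<epsilon>..\<epsilon>}" for t using \<epsilon> by (auto simp: \<tau>_def)
  have \<tau>_id: "\<tau> t = t" if "\<bar>t\<bar> \<le> \<epsilon>" for t using that by (auto simp: \<tau>_def)
  have cont: "continuous_on S (\<lambda>s. g (apply_bcontfun \<phi> s))" for \<phi> S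
    by (rule continuous_on_compose2[OF g_cont]) auto
  have h_deriv: "(h \<phi> has_vector_derivative g (apply_bcontfun \<phi> t)) (at t within {- \<epsilon>..\<epsilon>})"
    if "t \<in> {- \<epsilon>..\<epsilon>}" for \<phi> t
    unfolding h_def[abs_def] using integral_has_vector_derivative[OF cont that] .
  have h_cont: "continuous_on {- \<epsilon>..\<epsilon>} (h \<phi>)" for \<phi>
    using h_deriv has_vector_derivative_continuous continuous_on_eq_continuous_within by blast
  define T where "T \<phi> t = x0 + (h \<phi> (\<tau> t) - h \<phi> 0)" for \<phi> t
  have T_bcont: "T \<phi> \<in> bcontfun" for \<phi>
  proof -
    have "continuous_on UNIV (\<lambda>t. h \<phi> (\<tau> t))"
      using \<epsilon>(1) by (intro continuous_on_compose2[OF h_cont]) (auto intro!: continuous_intros simp: \<tau>_def)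
    moreover have "bounded (range (T \<phi>))"
    proof -
      have "bounded ((\<lambda>t. x0 + (h \<phi> t - h \<phi> 0)) ` {- \<epsilon>..\<epsilon>})"
        by (intro compact_imp_bounded compact_continuous_image continuous_intros h_cont) auto
      then show ?thesis by (rule bounded_subset) (use \<tau> in \<open>auto simp: T_def[abs_def]\<close>)
    qed
    ultimately show ?thesis by (auto simp: bcontfun_def T_def[abs_def] intro!: continuous_intros)
  qed
  have h_lip: "norm (h \<phi> t - h \<psi> t) \<le> 2 * \<epsilon> * L * dist \<phi> \<psi>" if "t \<in> {- \<epsilon>..\<epsilon>}" for \<phi> \<psi> t
  proof -
    have "h \<phi> t - h \<psi> t = integral {- \<epsilon>..t} (\<lambda>s. g (apply_bcontfun \<phi> s) - g (apply_bcontfun \<psi> s))"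
      unfolding h_def by (subst integral_diff) (auto intro!: integrable_continuous_interval cont)
    also have "norm \<dots> \<le> L * dist \<phi> \<psi> * (t - - \<epsilon>)"
    proof (rule integral_bound)
      fix s
      have "norm (g (apply_bcontfun \<phi> s) - g (apply_bcontfun \<psi> s)) \<le> L * dist (apply_bcontfun \<phi> s) (apply_bcontfun \<psi> s)"
        using L(2) by (simp add: dist_norm)
      also have "\<dots> \<le> L * dist \<phi> \<psi>" by (intro mult_left_mono dist_bounded L)
      finally show "norm (g (apply_bcontfun \<phi> s) - g (apply_bcontfun \<psi> s)) \<le> L * dist \<phi> \<psi>" .
    qed (use that in \<open>auto intro!: continuous_intros cont\<close>)
    also have "\<dots> \<le> L * dist \<phi> \<psi> * (2 * \<epsilon>)" using that L(1) by (intro mult_left_mono) auto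
    finally show ?thesis by (simp add: mult_ac)
  qed
  have "\<exists>!\<phi>. Bcontfun (T \<phi>) = \<phi>"
  proof (rule banach_fix_type)
    show "\<forall>\<phi> \<psi>. dist (Bcontfun (T \<phi>)) (Bcontfun (T \<psi>)) \<le> 1/2 * dist \<phi> \<psi>"
    proof (intro allI dist_bound)
      fix \<phi> \<psi> t
      have "dist (T \<phi> t) (T \<psi> t) = norm ((h \<phi> (\<tau> t) - h \<psi> (\<tau> t)) - (h \<phi> 0 - h \<psi> 0))"
        by (simp add: T_def dist_norm algebra_simps)
      also have "\<dots> \<le> 2 * \<epsilon> * L * dist \<phi> \<psi> + 2 * \<epsilon> * L * dist \<phi> \<psi>"
        using \<epsilon> by (intro norm_triangle_le_diff add_mono h_lip \<tau>) auto
      also have "\<dots> = (4 * \<epsilon> * L) * dist \<phi> \<psi>" by simp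
      also have "\<dots> \<le> 1/2 * dist \<phi> \<psi>" using \<epsilon>(2) by (intro mult_right_mono) auto
      finally show "dist (apply_bcontfun (Bcontfun (T \<phi>)) t) (apply_bcontfun (Bcontfun (T \<psi>)) t) \<le> 1/2 * dist \<phi> \<psi>"
        by (simp add: Bcontfun_inverse[OF T_bcont])
    qed
  qed auto
  then obtain \<phi> where "Bcontfun (T \<phi>) = \<phi>" by blast
  then have \<phi>: "apply_bcontfun \<phi> = T \<phi>" using Bcontfun_inverse[OF T_bcont] by metis
  show ?thesis
  proof (rule that[OF \<epsilon>(1)])
    show "apply_bcontfun \<phi> 0 = x0" using \<epsilon> by (subst \<phi>) (simp add: T_def \<tau>_id)
    fix t :: real assume t: "\<bar>t\<bar> < \<epsilon>"
    have "(h \<phi> has_vector_derivative g (apply_bcontfun \<phi> t)) (at t)"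
      using h_deriv[of t \<phi>] t at_within_interior[of t "{- \<epsilon>..\<epsilon>}"] by (simp add: abs_less_iff)
    then have "((\<lambda>t. x0 + (h \<phi> t - h \<phi> 0)) has_vector_derivative g (apply_bcontfun \<phi> t)) (at t)"
      by (auto intro!: derivative_eq_intros)
    then show "(apply_bcontfun \<phi> has_vector_derivative g (apply_bcontfun \<phi> t)) (at t)"
    proof (rule has_vector_derivative_transform_within_open)
      show "open {- \<epsilon><..<\<epsilon>}" "t \<in> {- \<epsilon><..<\<epsilon>}" using t by auto
      show "x0 + (h \<phi> s - h \<phi> 0) = apply_bcontfun \<phi> s" if "s \<in> {- \<epsilon><..<\<epsilon>}" for s
        using that \<tau>_id[of s] by (subst \<phi>) (simp add: T_def abs_le_iff)
    qed
  qed
qed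

lemma smooth_on_ode_solution:
  fixes x :: "real \<Rightarrow> 'a::euclidean_space"
  assumes J: "open J" and U: "open U" and f: "smooth_on U f"
    and x: "\<And>t. t \<in> J \<Longrightarrow> x t \<in> U"
      "\<And>t. t \<in> J \<Longrightarrow> (x has_vector_derivative f (x t)) (at t)"
  shows "smooth_on J x"
  unfolding smooth_on_def
proof
  have dx: "dif x t = (\<lambda>v. v *\<^sub>R f (x t))" "x differentiable (at t)" if "t \<in> J" for t
    using x(2)[OF that] by (auto simp: has_vector_derivative_def differentiable_def intro: dif_eqI)
  show "Ck_on k J x" for k
  proof (induction k)
    case 0
    then show ?case
      using dx(2) by (auto intro!: continuous_at_imp_continuous_on differentiable_imp_continuous_within)
  next
    case (Suc k)
    have "Ck_on k J (\<lambda>t. f (x t))"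
      using f x(1) by (intro Ck_on_compose[OF J U _ _ Suc]) (auto simp: smooth_on_def)
    then have "Ck_on k J (\<lambda>t. v *\<^sub>R f (x t))" for v
      by (rule Ck_on_bounded_linear_compose[OF bounded_linear_scaleR_right J])
    then have "Ck_on k J (\<lambda>t. dif x t v)" for v
      by (subst Ck_on_cong[OF J, of _ "\<lambda>t. v *\<^sub>R f (x t)"]) (simp_all add: dx)
    then show ?case using dx(2) by simp
  qed
qed

text \<open>
  Composing \<open>f\<close> with the nearest-point projection onto a small ball makes it globally Lipschitz; by continuity,
  a solution for the modified right-hand side stays in the ball for a short time, where nothing was changed.
\<close>

theorem smooth_ode_local_solution:
  fixes f :: "'a::euclidean_space \<Rightarrow> 'a"
  assumes U: "open U" and f: "smooth_on U f" and x0: "x0 \<in> U"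
  obtains \<epsilon> x where "\<epsilon> > 0" "x 0 = x0" "smooth_on {- \<epsilon><..<\<epsilon>} x"
    "\<And>t. t \<in> {- \<epsilon><..<\<epsilon>} \<Longrightarrow> x t \<in> U"
    "\<And>t. t \<in> {- \<epsilon><..<\<epsilon>} \<Longrightarrow> (x has_vector_derivative f (x t)) (at t)"
proof -
  obtain r where r: "r > 0" "cball x0 r \<subseteq> U" using U x0 by (auto simp: open_contains_cball)
  obtain L where L: "L \<ge> 0"
    "\<And>x y. x \<in> cball x0 r \<Longrightarrow> y \<in> cball x0 r \<Longrightarrow> norm (f x - f y) \<le> L * norm (x - y)"
    using smooth_on_imp_lipschitz_on_cball[OF f r(2)] by blast
  define g where "g x = f (closest_point (cball x0 r) x)" for x
  have ne: "cball x0 r \<noteq> {}" using r by simp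
  have g_lip: "norm (g x - g y) \<le> L * norm (x - y)" for x y
  proof -
    have "norm (g x - g y) \<le> L * norm (closest_point (cball x0 r) x - closest_point (cball x0 r) y)"
      unfolding g_def using ne by (intro L(2) closest_point_in_set) auto
    also have "\<dots> \<le> L * norm (x - y)"
      using closest_point_lipschitz[OF convex_cball closed_cball ne] L(1)
      by (intro mult_left_mono) (simp_all add: dist_norm)
    finally show ?thesis .
  qed
  obtain \<epsilon> x where x: "\<epsilon> > 0" "x 0 = x0" "\<And>t. \<bar>t\<bar> < \<epsilon> \<Longrightarrow> (x has_vector_derivative g (x t)) (at t)"
    using lipschitz_ode_local_solution[OF L(1) g_lip] by blast
  have "isCont x 0" using x(1) x(3)[of 0] has_vector_derivative_continuous by auto
  then obtain d where d: "d > 0" "\<And>t. dist t 0 < d \<Longrightarrow> dist (x t) (x 0) < r"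
    using r(1) unfolding continuous_at_eps_delta by blast
  define \<delta> where "\<delta> = min \<epsilon> d"
  have inU: "x t \<in> cball x0 r" if "t \<in> {- \<delta><..<\<delta>}" for t
    using d(2)[of t] that x(2) by (auto simp: \<delta>_def dist_commute abs_less_iff min_def split: if_splits)
  have deriv: "(x has_vector_derivative f (x t)) (at t)" if "t \<in> {- \<delta><..<\<delta>}" for t
  proof -
    have "g (x t) = f (x t)" using inU[OF that] by (simp add: g_def closest_point_self)
    then show ?thesis
      using x(3)[of t] that by (auto simp: \<delta>_def abs_less_iff min_def split: if_splits)
  qed
  show ?thesis
  proof (rule that[of \<delta> x])
    show "smooth_on {- \<delta><..<\<delta>} x"
      using inU r(2) deriv by (intro smooth_on_ode_solution[OF _ U f]) auto
  qed (use x(1,2) d(1) in \<open>simp add: \<delta>_def\<close>, rule x(2), use inU r(2) in blast, rule deriv)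
qed

section \<open>Smooth maps in charts\<close>

text \<open>
  The differential part of the notion of a smooth atlas.  It passes to products and to the slit tangent bundle,
  where the calculus of smooth maps and differentials is applied as well.
\<close>

definition compatible_charts :: "('m, 'e::euclidean_space) chart set \<Rightarrow> bool"
  where "compatible_charts A \<longleftrightarrow>
    (\<forall>\<kappa>\<in>A. inj_on (snd \<kappa>) (fst \<kappa>) \<and> open (snd \<kappa> ` fst \<kappa>)) \<and> smooth_map A A (\<lambda>p. p)"

lemma smooth_atlas_imp_compatible_charts: "smooth_atlas A \<Longrightarrow> compatible_charts A"
  by (simp add: smooth_atlas_def compatible_charts_def)

definition rep_dom :: "('m, 'e) chart \<Rightarrow> ('n, 'f) chart \<Rightarrow> ('m \<Rightarrow> 'n) \<Rightarrow> 'e set"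
  where "rep_dom \<kappa> \<kappa>' f = snd \<kappa> ` (fst \<kappa> \<inter> f -` fst \<kappa>')"

lemma smooth_map_iff:
  "smooth_map A B f \<longleftrightarrow> f \<in> points A \<rightarrow> points B \<and>
    (\<forall>\<kappa>\<in>A. \<forall>\<kappa>'\<in>B. open (rep_dom \<kappa> \<kappa>' f) \<and> smooth_on (rep_dom \<kappa> \<kappa>' f) (local_rep \<kappa> \<kappa>' f))"
  by (simp add: smooth_map_def rep_dom_def)

lemma smooth_mapD:
  assumes "smooth_map A B f"
  shows "p \<in> points A \<Longrightarrow> f p \<in> points B"
    and "\<kappa> \<in> A \<Longrightarrow> \<kappa>' \<in> B \<Longrightarrow> open (rep_dom \<kappa> \<kappa>' f)"
    and "\<kappa> \<in> A \<Longrightarrow> \<kappa>' \<in> B \<Longrightarrow> smooth_on (rep_dom \<kappa> \<kappa>' f) (local_rep \<kappa> \<kappa>' f)"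
  using assms by (auto simp: smooth_map_iff)

lemma points_iff: "p \<in> points A \<longleftrightarrow> (\<exists>\<kappa>\<in>A. p \<in> fst \<kappa>)"
  by (auto simp: points_def)

lemma local_rep_apply: "local_rep \<kappa> \<kappa>' f x = snd \<kappa>' (f (chart_inv \<kappa> x))"
  by (simp add: local_rep_def)

lemma chart_inv_in: "x \<in> snd \<kappa> ` fst \<kappa> \<Longrightarrow> chart_inv \<kappa> x \<in> fst \<kappa>"
  by (simp add: chart_inv_def inv_into_into)

lemma chart_chart_inv: "x \<in> snd \<kappa> ` fst \<kappa> \<Longrightarrow> snd \<kappa> (chart_inv \<kappa> x) = x"
  by (simp add: chart_inv_def f_inv_into_f)

lemma compatible_chartsD:
  assumes "compatible_charts A" "\<kappa> \<in> A"
  shows "inj_on (snd \<kappa>) (fst \<kappa>)" and "open (snd \<kappa> ` fst \<kappa>)"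
    and "p \<in> fst \<kappa> \<Longrightarrow> chart_inv \<kappa> (snd \<kappa> p) = p"
    and "p \<in> fst \<kappa> \<Longrightarrow> snd \<kappa> p \<in> rep_dom \<kappa> \<kappa>' f \<longleftrightarrow> f p \<in> fst \<kappa>'"
    and "x \<in> rep_dom \<kappa> \<kappa>' f \<longleftrightarrow> x \<in> snd \<kappa> ` fst \<kappa> \<and> f (chart_inv \<kappa> x) \<in> fst \<kappa>'"
proof -
  show inj: "inj_on (snd \<kappa>) (fst \<kappa>)" and "open (snd \<kappa> ` fst \<kappa>)"
    using assms by (auto simp: compatible_charts_def)
  show inv: "p \<in> fst \<kappa> \<Longrightarrow> chart_inv \<kappa> (snd \<kappa> p) = p" for p
    using inj by (simp add: chart_inv_def)
  show "x \<in> rep_dom \<kappa> \<kappa>' f \<longleftrightarrow> x \<in> snd \<kappa> ` fst \<kappa> \<and> f (chart_inv \<kappa> x) \<in> fst \<kappa>'" for x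
    by (auto simp: rep_dom_def inv)
  then show "p \<in> fst \<kappa> \<Longrightarrow> snd \<kappa> p \<in> rep_dom \<kappa> \<kappa>' f \<longleftrightarrow> f p \<in> fst \<kappa>'"
    by (simp add: inv)
qed

lemma compatible_charts_id: "compatible_charts A \<Longrightarrow> smooth_map A A (\<lambda>p. p)"
  by (simp add: compatible_charts_def)

lemma open_inter_vimage:
  "continuous_on U g \<Longrightarrow> open U \<Longrightarrow> open T \<Longrightarrow> open (U \<inter> g -` T)"
  by (rule continuous_open_preimage)

definition smooth_near ::
  "('m, 'e::euclidean_space) chart set \<Rightarrow> ('n, 'f::euclidean_space) chart set \<Rightarrow> ('m \<Rightarrow> 'n) \<Rightarrow> 'm \<Rightarrow> bool"
  where "smooth_near A B f p \<longleftrightarrow> (\<exists>\<kappa>\<in>A. \<exists>\<kappa>'\<in>B. \<exists>U. p \<in> fst \<kappa> \<and> open U \<and> snd \<kappa> p \<in> U \<and> U \<subseteq> snd \<kappa> ` fst \<kappa> \<and>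
    (\<forall>x\<in>U. f (chart_inv \<kappa> x) \<in> fst \<kappa>') \<and> smooth_on U (local_rep \<kappa> \<kappa>' f))"

lemma smooth_nearI:
  "\<kappa> \<in> A \<Longrightarrow> \<kappa>' \<in> B \<Longrightarrow> p \<in> fst \<kappa> \<Longrightarrow> open U \<Longrightarrow> snd \<kappa> p \<in> U \<Longrightarrow> U \<subseteq> snd \<kappa> ` fst \<kappa> \<Longrightarrow>
    (\<And>x. x \<in> U \<Longrightarrow> f (chart_inv \<kappa> x) \<in> fst \<kappa>') \<Longrightarrow> smooth_on U (local_rep \<kappa> \<kappa>' f) \<Longrightarrow>
    smooth_near A B f p"
  unfolding smooth_near_def by blast

text \<open>
  Smoothness is required in all pairs of charts, but one pair around every point suffices, since the coordinate
  changes are smooth.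
\<close>

lemma smooth_map_local:
  assumes A: "compatible_charts A" and B: "compatible_charts B"
    and loc: "\<And>p. p \<in> points A \<Longrightarrow> smooth_near A B f p"
  shows "smooth_map A B f"
  unfolding smooth_map_iff
proof (intro conjI ballI)
  show "f \<in> points A \<rightarrow> points B"
  proof
    fix p assume "p \<in> points A"
    from loc[OF this] show "f p \<in> points B"
      unfolding points_iff smooth_near_def using compatible_chartsD(3)[OF A] by metis
  qed
next
  fix \<kappa>1 \<kappa>1' assume \<kappa>1: "\<kappa>1 \<in> A" and \<kappa>1': "\<kappa>1' \<in> B"
  have "\<exists>U'. open U' \<and> x \<in> U' \<and> U' \<subseteq> rep_dom \<kappa>1 \<kappa>1' f \<and> smooth_on U' (local_rep \<kappa>1 \<kappa>1' f)"
    if x: "x \<in> rep_dom \<kappa>1 \<kappa>1' f" for x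
  proof -
    define p where "p = chart_inv \<kappa>1 x"
    have p: "p \<in> fst \<kappa>1" "snd \<kappa>1 p = x" "f p \<in> fst \<kappa>1'"
      using x by (auto simp: compatible_chartsD(5)[OF A \<kappa>1] p_def chart_inv_in chart_chart_inv)
    then have "p \<in> points A" using \<kappa>1 points_iff by metis
    from loc[OF this] obtain \<kappa> \<kappa>' U where *: "\<kappa> \<in> A" "\<kappa>' \<in> B" "open U" "U \<subseteq> snd \<kappa> ` fst \<kappa>"
      "p \<in> fst \<kappa>" "snd \<kappa> p \<in> U" "\<And>x. x \<in> U \<Longrightarrow> f (chart_inv \<kappa> x) \<in> fst \<kappa>'"
      "smooth_on U (local_rep \<kappa> \<kappa>' f)"
      unfolding smooth_near_def by blast
    define \<tau> where "\<tau> = local_rep \<kappa>1 \<kappa> (\<lambda>p. p)"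
    define T where "T = rep_dom \<kappa>1 \<kappa> (\<lambda>p. p)"
    define \<tau>' where "\<tau>' = local_rep \<kappa>' \<kappa>1' (\<lambda>p. p)"
    define T' where "T' = rep_dom \<kappa>' \<kappa>1' (\<lambda>p. p)"
    define g where "g = local_rep \<kappa> \<kappa>' f"
    have T: "open T" "smooth_on T \<tau>" and T': "open T'" "smooth_on T' \<tau>'"
      using smooth_mapD[OF compatible_charts_id[OF A]] smooth_mapD[OF compatible_charts_id[OF B]] * \<kappa>1 \<kappa>1'
      by (auto simp: T_def \<tau>_def T'_def \<tau>'_def)
    have g: "smooth_on U g" using * by (simp add: g_def)
    define W where "W = U \<inter> g -` T'"
    have W: "open W" unfolding W_def using smooth_on_continuous_on[OF g] * T' by (intro open_inter_vimage)
    define U' where "U' = T \<inter> \<tau> -` W"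
    have U': "open U'" unfolding U'_def using smooth_on_continuous_on[OF T(2)] W T by (intro open_inter_vimage)
    have pt: "local_rep \<kappa>1 \<kappa>1' f z = \<tau>' (g (\<tau> z)) \<and> z \<in> rep_dom \<kappa>1 \<kappa>1' f" if "z \<in> U'" for z
    proof -
      define q where "q = chart_inv \<kappa>1 z"
      have q: "q \<in> fst \<kappa>1" "q \<in> fst \<kappa>" "snd \<kappa>1 q = z" "\<tau> z = snd \<kappa> q" "chart_inv \<kappa> (\<tau> z) = q"
        using that by (auto simp: U'_def T_def compatible_chartsD(5)[OF A \<kappa>1] q_def chart_inv_in chart_chart_inv
            \<tau>_def local_rep_apply compatible_chartsD(3)[OF A \<open>\<kappa> \<in> A\<close>])
      have "\<tau> z \<in> U" "g (\<tau> z) \<in> T'" using that by (auto simp: U'_def W_def)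
      with q *(7)[of "\<tau> z"] have "f q \<in> fst \<kappa>'" "g (\<tau> z) = snd \<kappa>' (f q)"
        by (auto simp: g_def local_rep_apply)
      with \<open>g (\<tau> z) \<in> T'\<close> have "f q \<in> fst \<kappa>1'" "chart_inv \<kappa>' (g (\<tau> z)) = f q"
        by (auto simp: T'_def compatible_chartsD(3,4)[OF B \<open>\<kappa>' \<in> B\<close>])
      then show ?thesis using q 
        by (auto simp: \<tau>'_def local_rep_apply compatible_chartsD(5)[OF A \<kappa>1] q_def[symmetric])
    qed
    have "smooth_on U' (\<lambda>z. \<tau>' (g (\<tau> z)))"
    proof (rule smooth_on_compose[OF U' T'(1) _ T'(2)])
      show "smooth_on U' (\<lambda>z. g (\<tau> z))"
        by (rule smooth_on_compose[OF U' \<open>open U\<close> _ g smooth_on_subset[OF T(2)]]) (auto simp: U'_def W_def)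
    qed (auto simp: U'_def W_def)
    then have "smooth_on U' (local_rep \<kappa>1 \<kappa>1' f)" by (rule smooth_on_eq[OF U']) (use pt in blast)
    moreover have "x \<in> U'"
    proof -
      have "x \<in> T" using p * by (auto simp: T_def compatible_chartsD(5)[OF A \<kappa>1] p_def[symmetric])
      moreover have "\<tau> x = snd \<kappa> p" by (simp add: \<tau>_def local_rep_apply p_def)
      moreover have "g (snd \<kappa> p) = snd \<kappa>' (f p)"
        by (simp add: g_def local_rep_apply compatible_chartsD(3)[OF A \<open>\<kappa> \<in> A\<close> \<open>p \<in> fst \<kappa>\<close>])
      moreover have "f p \<in> fst \<kappa>'"
        using *(7)[OF \<open>snd \<kappa> p \<in> U\<close>] by (simp add: compatible_chartsD(3)[OF A \<open>\<kappa> \<in> A\<close> \<open>p \<in> fst \<kappa>\<close>])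
      ultimately show ?thesis using * p
        by (simp add: U'_def W_def T'_def compatible_chartsD(4)[OF B \<open>\<kappa>' \<in> B\<close>])
    qed
    ultimately show ?thesis using U' pt by blast
  qed
  then obtain N where N: "\<And>x. x \<in> rep_dom \<kappa>1 \<kappa>1' f \<Longrightarrow> open (N x) \<and> x \<in> N x \<and> 
      N x \<subseteq> rep_dom \<kappa>1 \<kappa>1' f \<and> smooth_on (N x) (local_rep \<kappa>1 \<kappa>1' f)" by metis
  show "open (rep_dom \<kappa>1 \<kappa>1' f)" using N by (subst open_subopen) blast
  show "smooth_on (rep_dom \<kappa>1 \<kappa>1' f) (local_rep \<kappa>1 \<kappa>1' f)"
    using N by (intro smooth_on_open_cover) blast
qed

lemma chart_inv_chart: "inj_on (snd \<kappa>) (fst \<kappa>) \<Longrightarrow> p \<in> fst \<kappa> \<Longrightarrow> chart_inv \<kappa> (snd \<kappa> p) = p"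
  by (simp add: chart_inv_def)

lemma smooth_map_cong:
  assumes inj: "\<And>\<kappa>. \<kappa> \<in> A \<Longrightarrow> inj_on (snd \<kappa>) (fst \<kappa>)"
    and eq: "\<And>p. p \<in> points A \<Longrightarrow> f p = g p" and f: "smooth_map A B f"
  shows "smooth_map A B g"
  unfolding smooth_map_iff
proof (intro conjI ballI)
  show "g \<in> points A \<rightarrow> points B" using smooth_mapD(1)[OF f] eq by auto
  fix \<kappa> \<kappa>' assume k: "\<kappa> \<in> A" "\<kappa>' \<in> B"
  have eq': "f x = g x" if "x \<in> fst \<kappa>" for x using that k eq points_iff by metis
  then have "fst \<kappa> \<inter> g -` fst \<kappa>' = fst \<kappa> \<inter> f -` fst \<kappa>'" by auto
  then have dom: "rep_dom \<kappa> \<kappa>' g = rep_dom \<kappa> \<kappa>' f" by (simp add: rep_dom_def)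
  show op: "open (rep_dom \<kappa> \<kappa>' g)" using smooth_mapD(2)[OF f k] dom by simp
  show "smooth_on (rep_dom \<kappa> \<kappa>' g) (local_rep \<kappa> \<kappa>' g)"
  proof (rule smooth_on_eq[OF op])
    show "smooth_on (rep_dom \<kappa> \<kappa>' g) (local_rep \<kappa> \<kappa>' f)" using smooth_mapD(3)[OF f k] dom by simp
    show "local_rep \<kappa> \<kappa>' g x = local_rep \<kappa> \<kappa>' f x" if "x \<in> rep_dom \<kappa> \<kappa>' g" for x
      using that eq' by (auto simp: rep_dom_def local_rep_apply chart_inv_chart[OF inj[OF k(1)]])
  qed
qed

text \<open>
  The representatives compose only where the intermediate point lies in the intermediate chart, which is a
  neighbourhood of every point that is mapped into this chart.
\<close>

lemma local_rep_compose_near: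
  assumes A: "compatible_charts A" and B: "compatible_charts B"
    and f: "smooth_map A B f" and g: "smooth_map B C g"
    and k: "\<kappa> \<in> A" "\<kappa>' \<in> B" "\<kappa>'' \<in> C" and p: "p \<in> fst \<kappa>" "f p \<in> fst \<kappa>'" "g (f p) \<in> fst \<kappa>''"
  obtains U where "open U" "snd \<kappa> p \<in> U" "U \<subseteq> rep_dom \<kappa> \<kappa>' f" "U \<subseteq> rep_dom \<kappa> \<kappa>'' (\<lambda>x. g (f x))"
    "local_rep \<kappa> \<kappa>' f ` U \<subseteq> rep_dom \<kappa>' \<kappa>'' g"
    "\<And>x. x \<in> U \<Longrightarrow> local_rep \<kappa> \<kappa>'' (\<lambda>x. g (f x)) x = local_rep \<kappa>' \<kappa>'' g (local_rep \<kappa> \<kappa>' f x)"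
proof
  let ?U = "rep_dom \<kappa> \<kappa>' f \<inter> local_rep \<kappa> \<kappa>' f -` rep_dom \<kappa>' \<kappa>'' g"
  show "open ?U"
    using smooth_mapD[OF f] smooth_mapD[OF g] k
    by (intro open_inter_vimage smooth_on_continuous_on) auto
  show "snd \<kappa> p \<in> ?U"
    using p by (simp add: compatible_chartsD(3,4)[OF A k(1)] compatible_chartsD(4)[OF B k(2)] local_rep_apply)
  show "local_rep \<kappa> \<kappa>'' (\<lambda>x. g (f x)) x = local_rep \<kappa>' \<kappa>'' g (local_rep \<kappa> \<kappa>' f x)" if "x \<in> ?U" for x
    using that by (auto simp: compatible_chartsD(5)[OF A k(1)] local_rep_apply compatible_chartsD(3)[OF B k(2)])
  show "?U \<subseteq> rep_dom \<kappa> \<kappa>'' (\<lambda>x. g (f x))"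
    by (auto simp: compatible_chartsD(5)[OF A k(1)] compatible_chartsD(4)[OF B k(2)] local_rep_apply)
qed auto

lemma smooth_map_compose:
  assumes A: "compatible_charts A" and B: "compatible_charts B" and C: "compatible_charts C"
    and f: "smooth_map A B f" and g: "smooth_map B C g"
  shows "smooth_map A C (\<lambda>x. g (f x))"
proof (rule smooth_map_local[OF A C])
  fix p assume "p \<in> points A"
  then obtain \<kappa> \<kappa>' \<kappa>'' where k: "\<kappa> \<in> A" "\<kappa>' \<in> B" "\<kappa>'' \<in> C"
    and p: "p \<in> fst \<kappa>" "f p \<in> fst \<kappa>'" "g (f p) \<in> fst \<kappa>''"
    using smooth_mapD(1)[OF f] smooth_mapD(1)[OF g] by (metis points_iff)
  obtain U where U: "open U" "snd \<kappa> p \<in> U" "U \<subseteq> rep_dom \<kappa> \<kappa>' f" "U \<subseteq> rep_dom \<kappa> \<kappa>'' (\<lambda>x. g (f x))"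
    "local_rep \<kappa> \<kappa>' f ` U \<subseteq> rep_dom \<kappa>' \<kappa>'' g"
    and eq: "\<And>x. x \<in> U \<Longrightarrow> local_rep \<kappa> \<kappa>'' (\<lambda>x. g (f x)) x = local_rep \<kappa>' \<kappa>'' g (local_rep \<kappa> \<kappa>' f x)"
    using local_rep_compose_near[OF A B f g k p] by blast
  have "smooth_on U (\<lambda>x. local_rep \<kappa>' \<kappa>'' g (local_rep \<kappa> \<kappa>' f x))"
    by (rule smooth_on_compose[OF U(1) smooth_mapD(2)[OF g k(2,3)] U(5) smooth_mapD(3)[OF g k(2,3)]
          smooth_on_subset[OF smooth_mapD(3)[OF f k(1,2)] U(3)]])
  then have "smooth_on U (local_rep \<kappa> \<kappa>'' (\<lambda>x. g (f x)))" by (rule smooth_on_eq[OF U(1)]) (rule eq)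
  from smooth_nearI[OF k(1,3) p(1) U(1,2) _ _ this]
  show "smooth_near A C (\<lambda>x. g (f x)) p"
    using U(4) by (auto simp: compatible_chartsD(5)[OF A k(1)] subset_iff)
qed

text \<open>
  With one of the two maps the identity, this chain rule also describes the effect of a change of charts.
\<close>

lemma dif_local_rep_compose:
  assumes "compatible_charts A" "compatible_charts B" "smooth_map A B f" "smooth_map B C g"
    and "\<kappa> \<in> A" "\<kappa>' \<in> B" "\<kappa>'' \<in> C" "p \<in> fst \<kappa>" "f p \<in> fst \<kappa>'" "g (f p) \<in> fst \<kappa>''"
  shows "dif (local_rep \<kappa> \<kappa>'' (\<lambda>x. g (f x))) (snd \<kappa> p) v
    = dif (local_rep \<kappa>' \<kappa>'' g) (snd \<kappa>' (f p)) (dif (local_rep \<kappa> \<kappa>' f) (snd \<kappa> p) v)"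
proof -
  obtain U where U: "open U" "snd \<kappa> p \<in> U" "U \<subseteq> rep_dom \<kappa> \<kappa>' f"
    "U \<subseteq> rep_dom \<kappa> \<kappa>'' (\<lambda>x. g (f x))" "local_rep \<kappa> \<kappa>' f ` U \<subseteq> rep_dom \<kappa>' \<kappa>'' g"
    and eq: "\<And>x. x \<in> U \<Longrightarrow> local_rep \<kappa> \<kappa>'' (\<lambda>x. g (f x)) x = local_rep \<kappa>' \<kappa>'' g (local_rep \<kappa> \<kappa>' f x)"
    by (rule local_rep_compose_near[OF assms]) (rule that)
  have fp: "local_rep \<kappa> \<kappa>' f (snd \<kappa> p) = snd \<kappa>' (f p)"
    using assms by (simp add: local_rep_apply compatible_chartsD(3))
  have "dif (local_rep \<kappa> \<kappa>'' (\<lambda>x. g (f x))) (snd \<kappa> p)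
      = dif (\<lambda>x. local_rep \<kappa>' \<kappa>'' g (local_rep \<kappa> \<kappa>' f x)) (snd \<kappa> p)"
    by (rule dif_cong(1)[OF U(1,2) eq])
  also have "\<dots> = (\<lambda>v. dif (local_rep \<kappa>' \<kappa>'' g) (snd \<kappa>' (f p)) (dif (local_rep \<kappa> \<kappa>' f) (snd \<kappa> p) v))"
    unfolding fp[symmetric]
  proof (rule dif_compose(1))
    show "local_rep \<kappa>' \<kappa>'' g differentiable at (local_rep \<kappa> \<kappa>' f (snd \<kappa> p))"
      by (rule smooth_on_differentiable[OF smooth_mapD(3)[OF assms(4,6,7)]]) (use U(2,5) in blast)
    show "local_rep \<kappa> \<kappa>' f differentiable at (snd \<kappa> p)"
      by (rule smooth_on_differentiable[OF smooth_mapD(3)[OF assms(3,5,6)]]) (use U(2,3) in blast)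
  qed
  finally show ?thesis by simp
qed

lemma local_rep_differentiable:
  assumes "compatible_charts A" "smooth_map A B f" "\<kappa> \<in> A" "\<kappa>' \<in> B" "p \<in> fst \<kappa>" "f p \<in> fst \<kappa>'"
  shows "local_rep \<kappa> \<kappa>' f differentiable (at (snd \<kappa> p))"
  using assms by (intro smooth_on_differentiable[OF smooth_mapD(3)[OF assms(2-4)]])
    (simp add: compatible_chartsD(4))

lemma dif_local_rep_id:
  assumes "compatible_charts A" "\<kappa> \<in> A" "p \<in> fst \<kappa>"
  shows "dif (local_rep \<kappa> \<kappa> (\<lambda>p. p)) (snd \<kappa> p) v = v"
proof -
  have "dif (local_rep \<kappa> \<kappa> (\<lambda>p. p)) (snd \<kappa> p) = dif (\<lambda>x. x) (snd \<kappa> p)"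
    using assms compatible_chartsD(2)[OF assms(1,2)]
    by (intro dif_cong(1)[of "snd \<kappa> ` fst \<kappa>"]) (auto simp: local_rep_apply compatible_chartsD(3))
  then show ?thesis by simp
qed

section \<open>Tangent vectors and differentials\<close>

lemma tangent_space_change:
  "v \<in> tangent_space A p \<Longrightarrow> \<kappa> \<in> A \<Longrightarrow> \<kappa>' \<in> A \<Longrightarrow> p \<in> fst \<kappa> \<Longrightarrow> p \<in> fst \<kappa>' \<Longrightarrow>
    v \<kappa>' = dif (local_rep \<kappa> \<kappa>' (\<lambda>q. q)) (snd \<kappa> p) (v \<kappa>)"
  unfolding tangent_space_def by blast

lemma tangent_spaceI:
  assumes "\<And>\<kappa>. \<not> (\<kappa> \<in> A \<and> p \<in> fst \<kappa>) \<Longrightarrow> v \<kappa> = 0"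
    and "\<And>\<kappa> \<kappa>'. \<kappa> \<in> A \<Longrightarrow> \<kappa>' \<in> A \<Longrightarrow> p \<in> fst \<kappa> \<Longrightarrow> p \<in> fst \<kappa>' \<Longrightarrow>
      v \<kappa>' = dif (local_rep \<kappa> \<kappa>' (\<lambda>q. q)) (snd \<kappa> p) (v \<kappa>)"
  shows "v \<in> tangent_space A p"
  using assms unfolding tangent_space_def by blast

lemma tangent_space_off: "v \<in> tangent_space A p \<Longrightarrow> \<not> (\<kappa> \<in> A \<and> p \<in> fst \<kappa>) \<Longrightarrow> v \<kappa> = 0"
  unfolding tangent_space_def by blast

lemma tvec_eqI:
  assumes "v \<in> tangent_space A p" "w \<in> tangent_space A p" "\<kappa> \<in> A" "p \<in> fst \<kappa>" "v \<kappa> = w \<kappa>"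
  shows "v = w"
proof
  fix \<kappa>'
  show "v \<kappa>' = w \<kappa>'"
    using assms tangent_space_change[OF assms(1,3), of \<kappa>'] tangent_space_change[OF assms(2,3), of \<kappa>']
      tangent_space_off[OF assms(1), of \<kappa>'] tangent_space_off[OF assms(2), of \<kappa>'] by metis
qed

lemma subspace_tangent_space:
  assumes A: "compatible_charts A"
  shows "subspace (tangent_space A p)"
proof -
  have lin: "linear (dif (local_rep \<kappa> \<kappa>' (\<lambda>q. q)) (snd \<kappa> p))"
    if "\<kappa> \<in> A" "\<kappa>' \<in> A" "p \<in> fst \<kappa>" "p \<in> fst \<kappa>'" for \<kappa> \<kappa>'
    by (intro linear_dif local_rep_differentiable[OF A compatible_charts_id[OF A]] that)
  show ?thesis
  proof (unfold subspace_def, intro conjI ballI allI)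
    show "0 \<in> tangent_space A p" using linear_0[OF lin] by (auto intro!: tangent_spaceI)
    fix v w :: "('a, 'b) tvec" and r assume v: "v \<in> tangent_space A p"
    show "r *\<^sub>R v \<in> tangent_space A p"
      by (rule tangent_spaceI) (use tangent_space_off[OF v] tangent_space_change[OF v] linear_scale[OF lin] in \<open>metis scaleR_fun_apply scaleR_zero_right\<close>)+
    assume w: "w \<in> tangent_space A p"
    show "v + w \<in> tangent_space A p"
    proof (rule tangent_spaceI)
      show "(v + w) \<kappa> = 0" if "\<not> (\<kappa> \<in> A \<and> p \<in> fst \<kappa>)" for \<kappa>
        using tangent_space_off[OF v that] tangent_space_off[OF w that] by simp
      show "(v + w) \<kappa>' = dif (local_rep \<kappa> \<kappa>' (\<lambda>q. q)) (snd \<kappa> p) ((v + w) \<kappa>)"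
        if k: "\<kappa> \<in> A" "\<kappa>' \<in> A" "p \<in> fst \<kappa>" "p \<in> fst \<kappa>'" for \<kappa> \<kappa>'
        unfolding plus_fun_apply tangent_space_change[OF v k] tangent_space_change[OF w k]
        by (rule linear_add[OF lin[OF k], symmetric])
    qed
  qed
qed

lemma tvec_eq_0_iff:
  assumes "compatible_charts A" "v \<in> tangent_space A p" "\<kappa> \<in> A" "p \<in> fst \<kappa>"
  shows "v = 0 \<longleftrightarrow> v \<kappa> = 0"
  using tvec_eqI[OF assms(2) subspace_0[OF subspace_tangent_space[OF assms(1)]] assms(3,4)] by auto

lemma tangent_vector_exists:
  assumes A: "compatible_charts A" and k: "\<kappa> \<in> A" "p \<in> fst \<kappa>"
  obtains v where "v \<in> tangent_space A p" "v \<kappa> = a"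
proof
  define v where "v \<kappa>' = (if \<kappa>' \<in> A \<and> p \<in> fst \<kappa>' then dif (local_rep \<kappa> \<kappa>' (\<lambda>q. q)) (snd \<kappa> p) a else 0)" for \<kappa>'
  show "v \<in> tangent_space A p"
    unfolding tangent_space_def v_def using k
    by (auto intro: dif_local_rep_compose[OF A A compatible_charts_id[OF A] compatible_charts_id[OF A]])
  show "v \<kappa> = a" using k by (simp add: v_def dif_local_rep_id[OF A])
qed

text \<open>
  The transformation law of tangent vectors and the chain rule make the differential independent of the chart
  that is chosen in its definition.
\<close>

lemma pushforward_eq:
  assumes A: "compatible_charts A" and f: "smooth_map A B f" and v: "v \<in> tangent_space A p"
    and k: "\<kappa> \<in> A" "p \<in> fst \<kappa>" "\<kappa>' \<in> B" "f p \<in> fst \<kappa>'"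
  shows "pushforward A B f p v \<kappa>' = dif (local_rep \<kappa> \<kappa>' f) (snd \<kappa> p) (v \<kappa>)"
proof -
  define \<kappa>1 where "\<kappa>1 = (SOME \<kappa>. \<kappa> \<in> A \<and> p \<in> fst \<kappa>)"
  have k1: "\<kappa>1 \<in> A" "p \<in> fst \<kappa>1" using someI[of "\<lambda>\<kappa>. \<kappa> \<in> A \<and> p \<in> fst \<kappa>" \<kappa>] k by (auto simp: \<kappa>1_def)
  have "pushforward A B f p v \<kappa>' = dif (local_rep \<kappa>1 \<kappa>' f) (snd \<kappa>1 p) (v \<kappa>1)"
    using k by (simp add: pushforward_def \<kappa>1_def[symmetric])
  also have "\<dots> = dif (local_rep \<kappa>1 \<kappa>' f) (snd \<kappa>1 p) (dif (local_rep \<kappa> \<kappa>1 (\<lambda>q. q)) (snd \<kappa> p) (v \<kappa>))"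
    using tangent_space_change[OF v k(1) k1(1) k(2) k1(2)] by simp
  also have "\<dots> = dif (local_rep \<kappa> \<kappa>' f) (snd \<kappa> p) (v \<kappa>)"
    by (rule dif_local_rep_compose[OF A A compatible_charts_id[OF A] f k(1) k1(1) k(3,2) k1(2) k(4), symmetric])
  finally show ?thesis .
qed

lemma pushforward_off: "\<not> (\<kappa>' \<in> B \<and> f p \<in> fst \<kappa>') \<Longrightarrow> pushforward A B f p v \<kappa>' = 0"
  unfolding pushforward_def by (rule if_not_P)

lemma tangent_space_points: "v \<in> tangent_space A p \<Longrightarrow> v \<noteq> 0 \<Longrightarrow> p \<in> points A"
  unfolding points_iff by (metis ext tangent_space_off zero_fun_apply)

lemma pushforward_in_tangent_space:
  assumes A: "compatible_charts A" and B: "compatible_charts B" and f: "smooth_map A B f"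
    and p: "p \<in> points A" and v: "v \<in> tangent_space A p"
  shows "pushforward A B f p v \<in> tangent_space B (f p)"
proof -
  obtain \<kappa> where k: "\<kappa> \<in> A" "p \<in> fst \<kappa>" using p points_iff by metis
  show ?thesis
  proof (rule tangent_spaceI)
    show "pushforward A B f p v \<kappa>' = 0" if "\<not> (\<kappa>' \<in> B \<and> f p \<in> fst \<kappa>')" for \<kappa>'
      using that by (rule pushforward_off)
    show "pushforward A B f p v \<kappa>2
        = dif (local_rep \<kappa>1 \<kappa>2 (\<lambda>q. q)) (snd \<kappa>1 (f p)) (pushforward A B f p v \<kappa>1)"
      if k': "\<kappa>1 \<in> B" "\<kappa>2 \<in> B" "f p \<in> fst \<kappa>1" "f p \<in> fst \<kappa>2" for \<kappa>1 \<kappa>2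
      unfolding pushforward_eq[OF A f v k k'(1,3)] pushforward_eq[OF A f v k k'(2,4)]
      by (rule dif_local_rep_compose[OF A B f compatible_charts_id[OF B] k(1) k'(1,2) k(2) k'(3,4)])
  qed
qed

lemma pushforward_compose:
  assumes A: "compatible_charts A" and B: "compatible_charts B" and C: "compatible_charts C"
    and f: "smooth_map A B f" and g: "smooth_map B C g" and p: "p \<in> points A" and v: "v \<in> tangent_space A p"
  shows "pushforward B C g (f p) (pushforward A B f p v) = pushforward A C (\<lambda>x. g (f x)) p v"
proof
  fix \<kappa>''
  obtain \<kappa> \<kappa>' where k: "\<kappa> \<in> A" "p \<in> fst \<kappa>" "\<kappa>' \<in> B" "f p \<in> fst \<kappa>'"
    using p smooth_mapD(1)[OF f p] points_iff by metis
  show "pushforward B C g (f p) (pushforward A B f p v) \<kappa>'' = pushforward A C (\<lambda>x. g (f x)) p v \<kappa>''"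
  proof (cases "\<kappa>'' \<in> C \<and> g (f p) \<in> fst \<kappa>''")
    case True
    then show ?thesis
      using pushforward_eq[OF B g pushforward_in_tangent_space[OF A B f p v] k(3,4), of \<kappa>'']
        pushforward_eq[OF A f v k] pushforward_eq[OF A smooth_map_compose[OF A B C f g] v k(1,2), of \<kappa>'']
        dif_local_rep_compose[OF A B f g k(1,3) _ k(2,4)]
      by simp
  qed (simp add: pushforward_off)
qed

lemma pushforward_linear_combination:
  assumes A: "compatible_charts A" and f: "smooth_map A B f" and p: "p \<in> points A"
    and v: "v \<in> tangent_space A p" and w: "w \<in> tangent_space A p"
  shows "pushforward A B f p (v + r *\<^sub>R w) = pushforward A B f p v + r *\<^sub>R pushforward A B f p w"
proof
  fix \<kappa>'
  obtain \<kappa> where k: "\<kappa> \<in> A" "p \<in> fst \<kappa>" using p points_iff by metis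
  have vw: "v + r *\<^sub>R w \<in> tangent_space A p"
    using v w subspace_tangent_space[OF A] by (simp add: subspace_add subspace_scale)
  show "pushforward A B f p (v + r *\<^sub>R w) \<kappa>' = (pushforward A B f p v + r *\<^sub>R pushforward A B f p w) \<kappa>'"
  proof (cases "\<kappa>' \<in> B \<and> f p \<in> fst \<kappa>'")
    case True
    then have "linear (dif (local_rep \<kappa> \<kappa>' f) (snd \<kappa> p))"
      using A f k by (intro linear_dif local_rep_differentiable) auto
    then show ?thesis
      using True pushforward_eq[OF A f _ k, of _ \<kappa>'] v w vw
      by (simp add: linear_add linear_scale)
  qed (simp add: pushforward_off)
qed

lemma pushforward_cong:
  fixes A :: "('m, 'e::euclidean_space) chart set" and B :: "('n, 'f::euclidean_space) chart set"
  assumes A: "compatible_charts A" and eq: "\<And>x. x \<in> points A \<Longrightarrow> f x = g x" and p: "p \<in> points A"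
  shows "pushforward A B f p v = pushforward A B g p v"
proof
  fix \<kappa>' :: "('n, 'f) chart"
  define \<kappa> where "\<kappa> = (SOME \<kappa>. \<kappa> \<in> A \<and> p \<in> fst \<kappa>)"
  have "\<exists>\<kappa>. \<kappa> \<in> A \<and> p \<in> fst \<kappa>" using p points_iff by metis
  then have "\<kappa> \<in> A \<and> p \<in> fst \<kappa>" unfolding \<kappa>_def by (rule someI_ex)
  then have k: "\<kappa> \<in> A" "p \<in> fst \<kappa>" by auto
  have eq': "f x = g x" if "x \<in> fst \<kappa>" for x using that k eq points_iff by metis
  have "dif (local_rep \<kappa> \<kappa>' f) (snd \<kappa> p) = dif (local_rep \<kappa> \<kappa>' g) (snd \<kappa> p)"
    using k eq' compatible_chartsD(2,3)[OF A k(1)]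
    by (intro dif_cong(1)[of "snd \<kappa> ` fst \<kappa>"]) (auto simp: local_rep_apply)
  then show "pushforward A B f p v \<kappa>' = pushforward A B g p v \<kappa>'"
    using eq[OF p] by (simp add: pushforward_def \<kappa>_def[symmetric])
qed

lemma pushforward_id:
  assumes A: "compatible_charts A" and p: "p \<in> points A" and v: "v \<in> tangent_space A p"
  shows "pushforward A A (\<lambda>x. x) p v = v"
proof -
  obtain \<kappa> where k: "\<kappa> \<in> A" "p \<in> fst \<kappa>" using p points_iff by metis
  show ?thesis
    using pushforward_eq[OF A compatible_charts_id[OF A] v k k] dif_local_rep_id[OF A k]
    by (intro tvec_eqI[OF pushforward_in_tangent_space[OF A A compatible_charts_id[OF A] p v] v k]) simp
qed

section \<open>Velocities of curves\<close>

lemma compatible_charts_interval: "open I \<Longrightarrow> compatible_charts {(I, \<lambda>t::real. t)}"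
  by (auto simp: compatible_charts_def smooth_map_def local_rep_def chart_inv_def points_def
      intro!: smooth_on_eq[OF _ smooth_on_ident] simp: f_inv_into_f)

text \<open>
  The coordinate vector field of an interval.  Through it, velocities are differentials, so that the chain rule
  for velocities is a case of the functoriality of differentials.
\<close>

definition unit_tvec :: "real set \<Rightarrow> (real, real) tvec"
  where "unit_tvec I = (\<lambda>\<kappa>. if \<kappa> = (I, \<lambda>t. t) then 1 else 0)"

lemma unit_tvec_in: "open I \<Longrightarrow> t \<in> I \<Longrightarrow> unit_tvec I \<in> tangent_space {(I, \<lambda>t. t)} t"
  using dif_local_rep_id[OF compatible_charts_interval, of I "(I, \<lambda>t. t)" t 1]
  by (auto simp: tangent_space_def unit_tvec_def)

lemma points_interval: "points {(I, \<lambda>t. t)} = I"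
  by (simp add: points_def)

lemma smooth_curve_iff:
  assumes "open I"
  shows "smooth_curve A I c \<longleftrightarrow> c ` I \<subseteq> points A \<and>
    (\<forall>\<kappa>\<in>A. open (I \<inter> c -` fst \<kappa>) \<and> smooth_on (I \<inter> c -` fst \<kappa>) (\<lambda>t. snd \<kappa> (c t)))"
proof -
  have "smooth_on (I \<inter> c -` fst \<kappa>) (local_rep (I, \<lambda>t. t) \<kappa> c) \<longleftrightarrow>
      smooth_on (I \<inter> c -` fst \<kappa>) (\<lambda>t. snd \<kappa> (c t))" if "open (I \<inter> c -` fst \<kappa>)" for \<kappa> :: "('a, 'b) chart"
    using that by (intro smooth_on_cong) (auto simp: local_rep_apply chart_inv_def f_inv_into_f)
  then show ?thesis by (auto simp: smooth_curve_def smooth_map_def points_interval image_subset_iff)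
qed

lemma smooth_curve_in_chart:
  assumes A: "compatible_charts A" and I: "open I" and \<kappa>: "\<kappa> \<in> A"
    and c: "\<And>t. t \<in> I \<Longrightarrow> c t \<in> fst \<kappa>" "smooth_on I (\<lambda>t. snd \<kappa> (c t))"
  shows "smooth_curve A I c"
  unfolding smooth_curve_def
proof (rule smooth_map_local[OF compatible_charts_interval[OF I] A])
  fix t assume "t \<in> points {(I, \<lambda>t. t)}"
  moreover have "smooth_on I (local_rep (I, \<lambda>t. t) \<kappa> c)"
    by (rule smooth_on_eq[OF I c(2)]) (simp add: local_rep_apply chart_inv_def f_inv_into_f)
  ultimately show "smooth_near {(I, \<lambda>t. t)} A c t"
    by (intro smooth_nearI[OF _ \<kappa> _ I, of "(I, \<lambda>t. t)"])
      (auto simp: points_interval chart_inv_def[of "(I, \<lambda>t. t)"] f_inv_into_f c(1))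
qed

lemma smooth_curve_open_dom:
  "open I \<Longrightarrow> smooth_curve A I c \<Longrightarrow> \<kappa> \<in> A \<Longrightarrow> open (I \<inter> c -` fst \<kappa>)"
  by (simp add: smooth_curve_iff)

lemma smooth_curve_smooth_on:
  "open I \<Longrightarrow> smooth_curve A I c \<Longrightarrow> \<kappa> \<in> A \<Longrightarrow> smooth_on (I \<inter> c -` fst \<kappa>) (\<lambda>t. snd \<kappa> (c t))"
  by (simp add: smooth_curve_iff)

lemma smooth_curve_points: "open I \<Longrightarrow> smooth_curve A I c \<Longrightarrow> t \<in> I \<Longrightarrow> c t \<in> points A"
  by (auto simp: smooth_curve_iff)

lemma vector_derivative_eq_dif:
  "f differentiable (at t) \<Longrightarrow> vector_derivative f (at t) = dif f t 1" for f :: "real \<Rightarrow> 'a::real_normed_vector"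
  by (simp add: frechet_derivative_eq_vector_derivative)

lemma velocity_has_vector_derivative:
  assumes "open I" "smooth_curve A I c" "t \<in> I" "\<kappa> \<in> A" "c t \<in> fst \<kappa>"
  shows "((\<lambda>s. snd \<kappa> (c s)) has_vector_derivative velocity A c t \<kappa>) (at t)"
proof -
  have "(\<lambda>s. snd \<kappa> (c s)) differentiable (at t)"
    using assms by (intro smooth_on_differentiable[OF smooth_curve_smooth_on[of I A c \<kappa>]]) auto
  then show ?thesis using assms by (simp add: velocity_def vector_derivative_works o_def)
qed

lemma velocity_eq_pushforward:
  assumes I: "open I" and c: "smooth_curve A I c" and t: "t \<in> I"
  shows "velocity A c t = pushforward {(I, \<lambda>t. t)} A c t (unit_tvec I)"
proof
  fix \<kappa>
  show "velocity A c t \<kappa> = pushforward {(I, \<lambda>t. t)} A c t (unit_tvec I) \<kappa>"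
  proof (cases "\<kappa> \<in> A \<and> c t \<in> fst \<kappa>")
    case True
    let ?U = "I \<inter> c -` fst \<kappa>"
    have U: "open ?U" "t \<in> ?U" using smooth_curve_open_dom[OF I c] True t by auto
    have eq: "local_rep (I, \<lambda>t. t) \<kappa> c s = (snd \<kappa> \<circ> c) s" if "s \<in> ?U" for s
      using that by (simp add: local_rep_apply chart_inv_def f_inv_into_f)
    have "(snd \<kappa> \<circ> c) differentiable (at t)"
      using smooth_on_differentiable[OF smooth_curve_smooth_on[OF I c] U(2)] True by (simp add: o_def)
    moreover have "dif (local_rep (I, \<lambda>t. t) \<kappa> c) t = dif (snd \<kappa> \<circ> c) t"
      by (rule dif_cong(1)[OF U eq])
    ultimately have "velocity A c t \<kappa> = dif (local_rep (I, \<lambda>t. t) \<kappa> c) t 1"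
      using True by (simp add: velocity_def vector_derivative_eq_dif)
    moreover have "pushforward {(I, \<lambda>t. t)} A c t (unit_tvec I) \<kappa> = dif (local_rep (I, \<lambda>t. t) \<kappa> c) t 1"
      using pushforward_eq[OF compatible_charts_interval[OF I] c[unfolded smooth_curve_def]
          unit_tvec_in[OF I t], of "(I, \<lambda>t. t)" \<kappa>] t True
      by (simp add: unit_tvec_def)
    ultimately show ?thesis by simp
  qed (auto simp: velocity_def pushforward_off)
qed

lemma velocity_in_tangent_space:
  assumes "compatible_charts A" "open I" "smooth_curve A I c" "t \<in> I"
  shows "velocity A c t \<in> tangent_space A (c t)"
  using assms unfolding velocity_eq_pushforward[OF assms(2-4)]
  by (intro pushforward_in_tangent_space compatible_charts_interval unit_tvec_in)
    (auto simp: points_interval smooth_curve_def)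

lemma smooth_curve_compose:
  assumes "compatible_charts A" "compatible_charts B" "open I" "smooth_curve A I c" "smooth_map A B f"
  shows "smooth_curve B I (\<lambda>t. f (c t))"
  unfolding smooth_curve_def
  by (rule smooth_map_compose[OF compatible_charts_interval[OF assms(3)] assms(1,2)
        assms(4)[unfolded smooth_curve_def] assms(5)])

lemma velocity_compose:
  assumes A: "compatible_charts A" and B: "compatible_charts B" and I: "open I"
    and c: "smooth_curve A I c" and f: "smooth_map A B f" and t: "t \<in> I"
  shows "velocity B (\<lambda>t. f (c t)) t = pushforward A B f (c t) (velocity A c t)"
  unfolding velocity_eq_pushforward[OF I c t] velocity_eq_pushforward[OF I smooth_curve_compose[OF A B I c f] t]
  using pushforward_compose[OF compatible_charts_interval[OF I] A B c[unfolded smooth_curve_def] f _ unit_tvec_in[OF I t]] t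
  by (simp add: points_interval)

lemma velocity_cong:
  fixes A :: "('m, 'e::euclidean_space) chart set"
  assumes "open I" "t \<in> I" "\<And>s. s \<in> I \<Longrightarrow> c s = d s"
  shows "velocity A c t = velocity A d t"
proof -
  have ev: "\<forall>\<^sub>F s in nhds t. s \<in> UNIV \<longrightarrow> (snd \<kappa> \<circ> c) s = (snd \<kappa> \<circ> d) s" for \<kappa> :: "('m, 'e) chart"
    using eventually_nhds_in_open[OF assms(1,2)] by eventually_elim (simp add: assms(3))
  have "vector_derivative (snd \<kappa> \<circ> c) (at t) = vector_derivative (snd \<kappa> \<circ> d) (at t)" for \<kappa> :: "('m, 'e) chart"
    by (rule vector_derivative_cong_eq[OF ev]) auto
  then show ?thesis using assms(2,3) by (simp add: velocity_def cong: if_cong)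
qed

section \<open>Products\<close>

definition prod_chart :: "('m, 'e) chart \<Rightarrow> ('n, 'f) chart \<Rightarrow> ('m \<times> 'n, 'e \<times> 'f) chart"
  where "prod_chart \<kappa> \<kappa>' = (fst \<kappa> \<times> fst \<kappa>', map_prod (snd \<kappa>) (snd \<kappa>'))"

lemma prod_chart_simps [simp]:
  "fst (prod_chart \<kappa> \<kappa>') = fst \<kappa> \<times> fst \<kappa>'" "snd (prod_chart \<kappa> \<kappa>') (p, q) = (snd \<kappa> p, snd \<kappa>' q)"
  by (simp_all add: prod_chart_def)

lemma product_atlas_iff: "K \<in> product_atlas A B \<longleftrightarrow> (\<exists>\<kappa>\<in>A. \<exists>\<kappa>'\<in>B. K = prod_chart \<kappa> \<kappa>')"
  unfolding product_atlas_def prod_chart_def by blast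

lemma prod_chart_in: "\<kappa> \<in> A \<Longrightarrow> \<kappa>' \<in> B \<Longrightarrow> prod_chart \<kappa> \<kappa>' \<in> product_atlas A B"
  by (auto simp: product_atlas_iff)

lemma prod_chart_image: "snd (prod_chart \<kappa> \<kappa>') ` fst (prod_chart \<kappa> \<kappa>') = snd \<kappa> ` fst \<kappa> \<times> snd \<kappa>' ` fst \<kappa>'"
  by (force simp: prod_chart_def)

lemma pointsI: "\<kappa> \<in> A \<Longrightarrow> p \<in> fst \<kappa> \<Longrightarrow> p \<in> points A"
  unfolding points_iff by blast

lemma inj_on_prod_chart:
  "inj_on (snd \<kappa>) (fst \<kappa>) \<Longrightarrow> inj_on (snd \<kappa>') (fst \<kappa>') \<Longrightarrow>
    inj_on (snd (prod_chart \<kappa> \<kappa>')) (fst (prod_chart \<kappa> \<kappa>'))"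
  by (auto simp: prod_chart_def map_prod_inj_on)

lemma chart_inv_prod_chart:
  assumes "inj_on (snd \<kappa>) (fst \<kappa>)" "inj_on (snd \<kappa>') (fst \<kappa>')" "x \<in> snd \<kappa> ` fst \<kappa>" "x' \<in> snd \<kappa>' ` fst \<kappa>'"
  shows "chart_inv (prod_chart \<kappa> \<kappa>') (x, x') = (chart_inv \<kappa> x, chart_inv \<kappa>' x')"
  unfolding chart_inv_def[of "prod_chart \<kappa> \<kappa>'"]
  using assms chart_inv_in[OF assms(3)] chart_inv_in[OF assms(4)] chart_chart_inv[OF assms(3)] chart_chart_inv[OF assms(4)]
  by (intro inv_into_f_eq inj_on_prod_chart) auto

lemma compatible_charts_product:
  assumes A: "compatible_charts A" and B: "compatible_charts B"
  shows "compatible_charts (product_atlas A B)"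
  unfolding compatible_charts_def smooth_map_iff
proof (intro conjI ballI)
  fix K assume "K \<in> product_atlas A B"
  then obtain \<kappa> \<kappa>' where k: "\<kappa> \<in> A" "\<kappa>' \<in> B" and K: "K = prod_chart \<kappa> \<kappa>'" by (auto simp: product_atlas_iff)
  note d = compatible_chartsD[OF A k(1)] compatible_chartsD[OF B k(2)]
  show "inj_on (snd K) (fst K)" unfolding K by (rule inj_on_prod_chart[OF d(1) d(6)])
  show "open (snd K ` fst K)" unfolding K prod_chart_image by (rule open_Times[OF d(2) d(7)])
  fix L assume "L \<in> product_atlas A B"
  then obtain l l' where l: "l \<in> A" "l' \<in> B" and L: "L = prod_chart l l'" by (auto simp: product_atlas_iff)
  let ?R = "rep_dom \<kappa> l (\<lambda>p. p)" and ?R' = "rep_dom \<kappa>' l' (\<lambda>p. p)"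
  note sm = smooth_mapD(2,3)[OF compatible_charts_id[OF A] k(1) l(1)] smooth_mapD(2,3)[OF compatible_charts_id[OF B] k(2) l(2)]
  have dom: "rep_dom K L (\<lambda>p. p) = ?R \<times> ?R'"
    by (force simp: rep_dom_def K L)
  show op: "open (rep_dom K L (\<lambda>p. p))" unfolding dom using sm by (intro open_Times)
  show "smooth_on (rep_dom K L (\<lambda>p. p)) (local_rep K L (\<lambda>p. p))"
  proof (rule smooth_on_eq[OF op])
    have 1: "smooth_on (?R \<times> ?R') (\<lambda>z. local_rep \<kappa> l (\<lambda>p. p) (fst z))"
      by (rule smooth_on_compose[OF open_Times[OF sm(1,3)] sm(1) _ sm(2) smooth_on_linear[OF bounded_linear_fst]]) auto
    have 2: "smooth_on (?R \<times> ?R') (\<lambda>z. local_rep \<kappa>' l' (\<lambda>p. p) (snd z))"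
      by (rule smooth_on_compose[OF open_Times[OF sm(1,3)] sm(3) _ sm(4) smooth_on_linear[OF bounded_linear_snd]]) auto
    show "smooth_on (rep_dom K L (\<lambda>p. p)) (\<lambda>z. (local_rep \<kappa> l (\<lambda>p. p) (fst z), local_rep \<kappa>' l' (\<lambda>p. p) (snd z)))"
      unfolding dom by (rule smooth_on_Pair[OF open_Times[OF sm(1,3)] 1 2])
    show "local_rep K L (\<lambda>p. p) z = (local_rep \<kappa> l (\<lambda>p. p) (fst z), local_rep \<kappa>' l' (\<lambda>p. p) (snd z))"
      if "z \<in> rep_dom K L (\<lambda>p. p)" for z
      using that unfolding dom
      by (cases z) (simp add: K L local_rep_apply d(5,10) chart_inv_prod_chart[OF d(1,6)])
  qed
qed auto

lemma smooth_map_Pair: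
  assumes A: "compatible_charts A" and B: "compatible_charts B" and C: "compatible_charts C"
    and f: "smooth_map A B f" and g: "smooth_map A C g"
  shows "smooth_map A (product_atlas B C) (\<lambda>x. (f x, g x))"
proof (rule smooth_map_local[OF A compatible_charts_product[OF B C]])
  fix p assume "p \<in> points A"
  then obtain \<kappa> \<kappa>1 \<kappa>2 where k: "\<kappa> \<in> A" "\<kappa>1 \<in> B" "\<kappa>2 \<in> C" and p: "p \<in> fst \<kappa>" "f p \<in> fst \<kappa>1" "g p \<in> fst \<kappa>2"
    using smooth_mapD(1)[OF f] smooth_mapD(1)[OF g] by (metis points_iff)
  let ?U = "rep_dom \<kappa> \<kappa>1 f \<inter> rep_dom \<kappa> \<kappa>2 g"
  note sm = smooth_mapD(2,3)[OF f k(1,2)] smooth_mapD(2,3)[OF g k(1,3)]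
  have U: "open ?U" using sm by auto
  have "smooth_on ?U (\<lambda>x. (local_rep \<kappa> \<kappa>1 f x, local_rep \<kappa> \<kappa>2 g x))"
    by (rule smooth_on_Pair[OF U smooth_on_subset[OF sm(2)] smooth_on_subset[OF sm(4)]]) auto
  then have "smooth_on ?U (local_rep \<kappa> (prod_chart \<kappa>1 \<kappa>2) (\<lambda>x. (f x, g x)))"
    by (rule smooth_on_eq[OF U]) (simp add: local_rep_apply)
  then show "smooth_near A (product_atlas B C) (\<lambda>x. (f x, g x)) p"
    using k p by (intro smooth_nearI[OF k(1) prod_chart_in[OF k(2,3)] p(1) U])
      (auto simp: compatible_chartsD(3-5)[OF A k(1)])
qed

lemma smooth_map_const:
  assumes A: "compatible_charts A" and B: "compatible_charts B" and q: "q \<in> points B"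
  shows "smooth_map A B (\<lambda>x. q)"
proof (rule smooth_map_local[OF A B])
  fix p assume "p \<in> points A"
  then obtain \<kappa> \<kappa>' where k: "\<kappa> \<in> A" "p \<in> fst \<kappa>" "\<kappa>' \<in> B" "q \<in> fst \<kappa>'" using q by (metis points_iff)
  have "smooth_on (snd \<kappa> ` fst \<kappa>) (local_rep \<kappa> \<kappa>' (\<lambda>x. q))"
    by (simp add: local_rep_def o_def smooth_on_const)
  from smooth_nearI[OF k(1,3,2) compatible_chartsD(2)[OF A k(1)] _ _ _ this]
  show "smooth_near A B (\<lambda>x. q) p" using k by simp
qed

section \<open>The slit tangent bundle\<close>

lemma slit_chart_simps:
  "\<xi> \<in> fst (slit_chart A \<kappa>) \<longleftrightarrow> fst \<xi> \<in> fst \<kappa> \<and> snd \<xi> \<in> tangent_space A (fst \<xi>) \<and> snd \<xi> \<noteq> 0"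
  "snd (slit_chart A \<kappa>) \<xi> = (snd \<kappa> (fst \<xi>), snd \<xi> \<kappa>)"
  by (auto simp: slit_chart_def tangent_chart_def)

lemma slit_chart_in: "\<kappa> \<in> A \<Longrightarrow> slit_chart A \<kappa> \<in> slit_bundle A"
  by (simp add: slit_bundle_def)

lemma points_slit_bundle:
  "\<xi> \<in> points (slit_bundle A) \<longleftrightarrow> snd \<xi> \<in> tangent_space A (fst \<xi>) \<and> snd \<xi> \<noteq> 0"
  using tangent_space_points[of "snd \<xi>" A "fst \<xi>"]
  by (auto simp: points_iff slit_bundle_def slit_chart_simps)

lemma slit_chart_image:
  assumes A: "compatible_charts A" and k: "\<kappa> \<in> A"
  shows "snd (slit_chart A \<kappa>) ` fst (slit_chart A \<kappa>) = snd \<kappa> ` fst \<kappa> \<times> - {0}"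
proof (rule equalityI; rule subsetI)
  fix z assume "z \<in> snd (slit_chart A \<kappa>) ` fst (slit_chart A \<kappa>)"
  then show "z \<in> snd \<kappa> ` fst \<kappa> \<times> - {0}"
    using tvec_eq_0_iff[OF A _ k] by (auto simp: slit_chart_simps)
next
  fix z :: "'b \<times> 'b" assume "z \<in> snd \<kappa> ` fst \<kappa> \<times> - {0}"
  then obtain p a where p: "z = (snd \<kappa> p, a)" "p \<in> fst \<kappa>" "a \<noteq> 0" by auto
  obtain v where v: "v \<in> tangent_space A p" "v \<kappa> = a"
    using tangent_vector_exists[OF A k p(2)] by blast
  then have "(p, v) \<in> fst (slit_chart A \<kappa>)" using p by (auto simp: slit_chart_simps)
  then show "z \<in> snd (slit_chart A \<kappa>) ` fst (slit_chart A \<kappa>)"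
    using p v by (intro image_eqI[of _ _ "(p, v)"]) (auto simp: slit_chart_simps)
qed

lemma inj_on_slit_chart:
  assumes A: "compatible_charts A" and k: "\<kappa> \<in> A"
  shows "inj_on (snd (slit_chart A \<kappa>)) (fst (slit_chart A \<kappa>))"
proof (rule inj_onI)
  fix \<xi> \<zeta> assume "\<xi> \<in> fst (slit_chart A \<kappa>)" "\<zeta> \<in> fst (slit_chart A \<kappa>)"
    "snd (slit_chart A \<kappa>) \<xi> = snd (slit_chart A \<kappa>) \<zeta>"
  then show "\<xi> = \<zeta>"
    using inj_onD[OF compatible_chartsD(1)[OF A k], of "fst \<xi>" "fst \<zeta>"] tvec_eqI[OF _ _ k, of "snd \<xi>" "fst \<xi>" "snd \<zeta>"]
    by (auto simp: slit_chart_simps prod_eq_iff)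
qed

lemma chart_inv_slit_chart:
  assumes A: "compatible_charts A" and k: "\<kappa> \<in> A" and x: "x \<in> snd \<kappa> ` fst \<kappa>" "a \<noteq> 0"
  shows "fst (chart_inv (slit_chart A \<kappa>) (x, a)) = chart_inv \<kappa> x"
    and "snd (chart_inv (slit_chart A \<kappa>) (x, a)) \<in> tangent_space A (chart_inv \<kappa> x)"
    and "snd (chart_inv (slit_chart A \<kappa>) (x, a)) \<kappa> = a"
proof -
  let ?\<xi> = "chart_inv (slit_chart A \<kappa>) (x, a)"
  have im: "(x, a) \<in> snd (slit_chart A \<kappa>) ` fst (slit_chart A \<kappa>)"
    unfolding slit_chart_image[OF A k] using x by auto
  have 1: "snd \<kappa> (fst ?\<xi>) = x" "snd ?\<xi> \<kappa> = a"
    using chart_chart_inv[OF im] by (auto simp: slit_chart_simps)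
  have 2: "fst ?\<xi> \<in> fst \<kappa>" "snd ?\<xi> \<in> tangent_space A (fst ?\<xi>)"
    using chart_inv_in[OF im] by (auto simp: slit_chart_simps)
  show "fst ?\<xi> = chart_inv \<kappa> x" using compatible_chartsD(3)[OF A k 2(1)] 1 by simp
  with 1 2 show "snd ?\<xi> \<in> tangent_space A (chart_inv \<kappa> x)" "snd ?\<xi> \<kappa> = a" by auto
qed

lemma slit_tangent_map_rep:
  assumes A: "compatible_charts A" and f: "smooth_map A B f" and k: "\<kappa> \<in> A" "\<kappa>' \<in> B"
    and x: "x \<in> rep_dom \<kappa> \<kappa>' f" "a \<noteq> 0"
  shows "local_rep (slit_chart A \<kappa>) (slit_chart B \<kappa>') (tangent_map A B f) (x, a)
    = (local_rep \<kappa> \<kappa>' f x, dif (local_rep \<kappa> \<kappa>' f) x a)"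
proof -
  have x': "x \<in> snd \<kappa> ` fst \<kappa>" "f (chart_inv \<kappa> x) \<in> fst \<kappa>'"
    using x by (auto simp: compatible_chartsD(5)[OF A k(1)])
  note ci = chart_inv_slit_chart[OF A k(1) x'(1) x(2)]
  show ?thesis
    using pushforward_eq[OF A f ci(2) k(1) chart_inv_in[OF x'(1)] k(2) x'(2)]
    by (simp add: local_rep_apply[of "slit_chart A \<kappa>"] local_rep_apply[of \<kappa> \<kappa>' f x] tangent_map_def slit_chart_simps ci chart_chart_inv[OF x'(1)])
qed

text \<open>
  The tangent map preserves nonzero vectors exactly when all differentials are injective; only then does it
  restrict to the slit bundles.
\<close>

lemma smooth_map_slit_tangent_map:
  assumes A: "compatible_charts A" and B: "compatible_charts B" and f: "smooth_map A B f"
    and nz: "\<And>p v. p \<in> points A \<Longrightarrow> v \<in> tangent_space A p \<Longrightarrow> v \<noteq> 0 \<Longrightarrow> pushforward A B f p v \<noteq> 0"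
  shows "smooth_map (slit_bundle A) (slit_bundle B) (tangent_map A B f)"
  unfolding smooth_map_iff
proof (intro conjI ballI)
  show "tangent_map A B f \<in> points (slit_bundle A) \<rightarrow> points (slit_bundle B)"
  proof
    fix \<xi> assume "\<xi> \<in> points (slit_bundle A)"
    then have \<xi>: "snd \<xi> \<in> tangent_space A (fst \<xi>)" "snd \<xi> \<noteq> 0" by (auto simp: points_slit_bundle)
    then have "fst \<xi> \<in> points A" by (rule tangent_space_points)
    with \<xi> show "tangent_map A B f \<xi> \<in> points (slit_bundle B)"
      using nz pushforward_in_tangent_space[OF A B f] by (simp add: points_slit_bundle tangent_map_def)
  qed
  fix K L assume "K \<in> slit_bundle A" "L \<in> slit_bundle B"
  then obtain \<kappa> \<kappa>' where k: "\<kappa> \<in> A" "\<kappa>' \<in> B" and K: "K = slit_chart A \<kappa>" and L: "L = slit_chart B \<kappa>'"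
    unfolding slit_bundle_def by blast
  let ?R = "rep_dom \<kappa> \<kappa>' f"
  note sm = smooth_mapD(2,3)[OF f k]
  have dom: "rep_dom K L (tangent_map A B f) = ?R \<times> - {0}"
  proof -
    have "fst K \<inter> tangent_map A B f -` fst L = {\<xi> \<in> fst K. f (fst \<xi>) \<in> fst \<kappa>'}"
    proof -
      have "tangent_map A B f \<xi> \<in> fst L \<longleftrightarrow> f (fst \<xi>) \<in> fst \<kappa>'" if "\<xi> \<in> fst K" for \<xi>
        using that nz[of "fst \<xi>" "snd \<xi>"] pushforward_in_tangent_space[OF A B f, of "fst \<xi>" "snd \<xi>"] k
          tangent_space_points[of "snd \<xi>" A "fst \<xi>"]
        by (auto simp: K L slit_chart_simps tangent_map_def)
      then show ?thesis by blast
    qed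
    then have "rep_dom K L (tangent_map A B f) = snd K ` {\<xi> \<in> fst K. f (fst \<xi>) \<in> fst \<kappa>'}"
      by (simp add: rep_dom_def)
    also have "\<dots> = {z \<in> snd K ` fst K. f (chart_inv \<kappa> (fst z)) \<in> fst \<kappa>'}"
      by (force simp: K slit_chart_simps compatible_chartsD(3)[OF A k(1)])
    also have "\<dots> = ?R \<times> - {0}"
      unfolding K slit_chart_image[OF A k(1)] by (auto simp: compatible_chartsD(5)[OF A k(1)])
    finally show ?thesis .
  qed
  have op': "open (?R \<times> - {0::'b})" using sm by (intro open_Times) auto
  then show op: "open (rep_dom K L (tangent_map A B f))" unfolding dom .
  show "smooth_on (rep_dom K L (tangent_map A B f)) (local_rep K L (tangent_map A B f))"
  proof (rule smooth_on_eq[OF op])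
    note fst_sm = smooth_on_linear[OF bounded_linear_fst, of "?R \<times> - {0::'b}"]
    have 1: "smooth_on (?R \<times> - {0::'b}) (\<lambda>z. local_rep \<kappa> \<kappa>' f (fst z))"
      by (rule smooth_on_compose[OF op' sm(1) _ sm(2) fst_sm]) auto
    have 2: "smooth_on (?R \<times> - {0}) (\<lambda>z. dif (local_rep \<kappa> \<kappa>' f) (fst z) (snd z))"
      by (rule smooth_on_dif_apply[OF op' sm(1) _ sm(2) fst_sm smooth_on_linear[OF bounded_linear_snd]]) auto
    show "smooth_on (rep_dom K L (tangent_map A B f))
        (\<lambda>z. (local_rep \<kappa> \<kappa>' f (fst z), dif (local_rep \<kappa> \<kappa>' f) (fst z) (snd z)))"
      unfolding dom by (rule smooth_on_Pair[OF op' 1 2])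
    show "local_rep K L (tangent_map A B f) z = (local_rep \<kappa> \<kappa>' f (fst z), dif (local_rep \<kappa> \<kappa>' f) (fst z) (snd z))"
      if "z \<in> rep_dom K L (tangent_map A B f)" for z
    proof -
      have "fst z \<in> ?R" "snd z \<noteq> 0" using that[unfolded dom] by auto
      from slit_tangent_map_rep[OF A f k this] show ?thesis by (simp add: K L)
    qed
  qed
qed

lemma compatible_charts_slit_bundle:
  assumes A: "compatible_charts A"
  shows "compatible_charts (slit_bundle A)"
proof -
  have inj: "inj_on (snd K) (fst K)" and op: "open (snd K ` fst K)" if K_in: "K \<in> slit_bundle A" for K
  proof -
    obtain \<kappa> where k: "\<kappa> \<in> A" and K: "K = slit_chart A \<kappa>" using K_in unfolding slit_bundle_def by blast
    show "inj_on (snd K) (fst K)" unfolding K by (rule inj_on_slit_chart[OF A k])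
    show "open (snd K ` fst K)" unfolding K slit_chart_image[OF A k]
      using compatible_chartsD(2)[OF A k] by (intro open_Times) auto
  qed
  \<comment> \<open>The coordinate changes of the slit bundle represent the tangent map of the identity.\<close>
  have "smooth_map (slit_bundle A) (slit_bundle A) (tangent_map A A (\<lambda>p. p))"
    by (rule smooth_map_slit_tangent_map[OF A A compatible_charts_id[OF A]]) (simp add: pushforward_id[OF A])
  then have "smooth_map (slit_bundle A) (slit_bundle A) (\<lambda>\<xi>. \<xi>)"
  proof (rule smooth_map_cong[rotated 2])
    show "tangent_map A A (\<lambda>p. p) \<xi> = \<xi>" if "\<xi> \<in> points (slit_bundle A)" for \<xi>
      using that tangent_space_points[of "snd \<xi>" A "fst \<xi>"] pushforward_id[OF A, of "fst \<xi>" "snd \<xi>"]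
      by (auto simp: points_slit_bundle tangent_map_def)
  qed (rule inj)
  with inj op show ?thesis by (auto simp: compatible_charts_def)
qed

section \<open>Submersions\<close>

text \<open>
  With a right inverse \<open>J\<close> of \<open>T = Df(x0)\<close>, the map \<open>x \<mapsto> x + J(f x - f x0 - T (x - x0))\<close> has the identity as
  derivative at \<open>x0\<close>, and \<open>T\<close> of it is \<open>f\<close> up to a constant.  Hence its local inverse \<open>\<psi>\<close> straightens \<open>f\<close> to
  an affine map.  The one map \<open>\<psi>\<close> provides both local sections of \<open>f\<close> and curves in its fibres.
\<close>

lemma local_submersion:
  fixes f :: "'a::euclidean_space \<Rightarrow> 'b::euclidean_space"
  assumes U: "open U" "x0 \<in> U" and f: "smooth_on U f" and surj: "surj (dif f x0)"
  obtains V \<psi> where "open V" "x0 \<in> V" "smooth_on V \<psi>" "\<psi> ` V \<subseteq> U" "\<psi> x0 = x0" "\<And>v. dif \<psi> x0 v = v"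
    "\<And>y. y \<in> V \<Longrightarrow> f (\<psi> y) = f x0 + dif f x0 (y - x0)"
proof -
  let ?T = "dif f x0"
  have T: "linear ?T" by (rule linear_dif[OF smooth_on_differentiable[OF f U(2)]])
  obtain J where J: "linear J" "?T \<circ> J = id" using linear_surjective_right_inverse[OF T surj] by blast
  have TJ: "?T (J z) = z" for z using J(2) by (simp add: fun_eq_iff)
  have bT: "bounded_linear ?T" and bJ: "bounded_linear J" using T J(1) by (simp_all add: linear_linear)
  define F where "F x = x + J (f x - f x0 - ?T (x - x0))" for x
  have F: "smooth_on U F"
    unfolding F_def[abs_def]
    by (intro smooth_on_add[OF U(1)] smooth_on_linear_compose[OF bJ U(1)] smooth_on_linear_compose[OF bT U(1)]
        smooth_on_diff[OF U(1)] smooth_on_ident smooth_on_const f)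
  have F0: "F x0 = x0" by (simp add: F_def linear_0[OF T] linear_0[OF J(1)])
  have "(F has_derivative (\<lambda>v. v + J (?T v - 0 - ?T (v - 0)))) (at x0)"
    unfolding F_def[abs_def]
    by (intro has_derivative_add has_derivative_ident bounded_linear.has_derivative[OF bJ]
        bounded_linear.has_derivative[OF bT] has_derivative_diff has_derivative_const
        smooth_on_has_derivative[OF f U(2)])
  then have dF: "dif F x0 = (\<lambda>v. v)" by (simp add: dif_eqI linear_0[OF J(1)])
  have TF: "?T (F x) = f x - f x0 + ?T x0" for x
    by (simp add: F_def linear_add[OF T] TJ linear_diff[OF T])
  obtain U' V g where g: "open U'" "U' \<subseteq> U" "x0 \<in> U'" "open V" "F x0 \<in> V" "homeomorphism U' V F g" "smooth_on V g"
    using smooth_inverse_function_theorem[OF U(1) F U(2)] dF by (auto simp: inj_on_def)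
  have gV: "g y \<in> U" "F (g y) = y" if "y \<in> V" for y
    using g(2,6) that by (auto simp: homeomorphism_def)
  have g0: "g x0 = x0" using g(3,6) F0 by (metis homeomorphism_apply1)
  show ?thesis
  proof (rule that[of V g])
    show "g ` V \<subseteq> U" using gV by auto
    show "dif g x0 v = v" for v
    proof -
      have "dif (\<lambda>y. F (g y)) x0 = dif (\<lambda>y. y) x0"
        using g(4,5) F0 gV by (intro dif_cong(1)[of V]) auto
      moreover have "dif (\<lambda>y. F (g y)) x0 = (\<lambda>v. dif F (g x0) (dif g x0 v))"
        by (rule dif_compose(1)[OF smooth_on_differentiable[OF F] smooth_on_differentiable[OF g(7)]])
          (use g(5) F0 gV(1)[of x0] in simp_all)
      ultimately show ?thesis by (simp add: g0 dF fun_eq_iff)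
    qed
    show "f (g y) = f x0 + ?T (y - x0)" if "y \<in> V" for y
      using TF[of "g y"] gV[OF that] by (simp add: linear_diff[OF T])
  qed (use g F0 g0 in auto)
qed

definition submersion_at ::
  "('m, 'e::euclidean_space) chart set \<Rightarrow> ('n, 'f::euclidean_space) chart set \<Rightarrow> ('m \<Rightarrow> 'n) \<Rightarrow> 'm \<Rightarrow> bool"
  where "submersion_at A B f p \<longleftrightarrow> tangent_space B (f p) \<subseteq> pushforward A B f p ` tangent_space A p"

lemma submersion_at_surj:
  assumes A: "compatible_charts A" and B: "compatible_charts B" and f: "smooth_map A B f"
    and k: "\<kappa> \<in> A" "p \<in> fst \<kappa>" "\<kappa>' \<in> B" "f p \<in> fst \<kappa>'" and sub: "submersion_at A B f p"
  shows "surj (dif (local_rep \<kappa> \<kappa>' f) (snd \<kappa> p))"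
proof (unfold surj_def, rule allI)
  fix a
  obtain w where w: "w \<in> tangent_space B (f p)" "w \<kappa>' = a" using tangent_vector_exists[OF B k(3,4)] by blast
  then obtain v where v: "v \<in> tangent_space A p" "w = pushforward A B f p v"
    using sub by (auto simp: submersion_at_def)
  show "\<exists>x. a = dif (local_rep \<kappa> \<kappa>' f) (snd \<kappa> p) x"
    using pushforward_eq[OF A f v(1) k] v(2) w(2) by (intro exI[of _ "v \<kappa>"]) simp
qed

text \<open>
  Submersions have smooth local sections \<open>s\<close>, and locally \<open>g = h \<circ> s\<close>.
\<close>

theorem smooth_map_factor_submersion:
  assumes A: "compatible_charts A" and B: "compatible_charts B" and C: "compatible_charts C"
    and f: "smooth_map A B f" and onto: "points B \<subseteq> f ` points A"
    and sub: "\<And>p. p \<in> points A \<Longrightarrow> submersion_at A B f p"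
    and h: "smooth_map A C h" and gf: "\<And>p. p \<in> points A \<Longrightarrow> g (f p) = h p"
  shows "smooth_map B C g"
proof (rule smooth_map_local[OF B C])
  fix q assume "q \<in> points B"
  then obtain p where p: "p \<in> points A" "q = f p" using onto by auto
  then obtain \<kappa> \<kappa>' \<kappa>'' where k: "\<kappa> \<in> A" "p \<in> fst \<kappa>" "\<kappa>' \<in> B" "f p \<in> fst \<kappa>'" "\<kappa>'' \<in> C" "h p \<in> fst \<kappa>''"
    using smooth_mapD(1)[OF f p(1)] smooth_mapD(1)[OF h p(1)] by (metis points_iff)
  let ?f = "local_rep \<kappa> \<kappa>' f" and ?U = "rep_dom \<kappa> \<kappa>' f \<inter> rep_dom \<kappa> \<kappa>'' h" and ?x = "snd \<kappa> p"
  note sm = smooth_mapD(2,3)[OF f k(1,3)] smooth_mapD(2,3)[OF h k(1,5)]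
  note kd = compatible_chartsD(3-5)[OF A k(1)]
  have U: "open ?U" "?x \<in> ?U" using sm k by (auto simp: kd)
  have fU: "smooth_on ?U ?f" using smooth_on_subset[OF sm(2)] by auto
  have surj: "surj (dif ?f ?x)" by (rule submersion_at_surj[OF A B f k(1-4) sub[OF p(1)]])
  obtain V \<psi> where V: "open V" "?x \<in> V" "smooth_on V \<psi>" "\<psi> ` V \<subseteq> ?U" "\<psi> ?x = ?x"
    "\<And>y. y \<in> V \<Longrightarrow> ?f (\<psi> y) = ?f ?x + dif ?f ?x (y - ?x)"
    by (rule local_submersion[OF U fU surj]) (rule that)
  have lin: "linear (dif ?f ?x)" by (rule linear_dif[OF smooth_on_differentiable[OF fU U(2)]])
  obtain J where J: "linear J" "dif ?f ?x \<circ> J = id" using linear_surjective_right_inverse[OF lin surj] by blast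
  have bJ: "bounded_linear J" using J(1) by (simp add: linear_linear)
  \<comment> \<open>The local section is \<open>\<psi> \<circ> s\<close>.\<close>
  define s where "s z = ?x + J (z - ?f ?x)" for z
  have s_smooth: "smooth_on UNIV s" unfolding s_def[abs_def]
    by (intro smooth_on_add[OF open_UNIV] smooth_on_linear_compose[OF bJ open_UNIV]
        smooth_on_diff[OF open_UNIV] smooth_on_ident smooth_on_const)
  define W where "W = UNIV \<inter> s -` V"
  have W: "open W" unfolding W_def using V(1) smooth_on_continuous_on[OF s_smooth] by (intro open_inter_vimage) auto
  have sW: "s ` W \<subseteq> V" by (auto simp: W_def)
  have sec: "?f (\<psi> (s z)) = z" if "z \<in> W" for z
    using V(6)[of "s z"] sW that J(2) by (auto simp: s_def fun_eq_iff)
  have fx: "?f ?x = snd \<kappa>' q" using k p by (simp add: local_rep_apply kd)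
  have \<psi>s: "smooth_on W (\<lambda>z. \<psi> (s z))"
    using W V s_smooth sW smooth_on_subset by (metis smooth_on_compose subset_UNIV)
  have pt: "z \<in> snd \<kappa>' ` fst \<kappa>' \<and> g (chart_inv \<kappa>' z) \<in> fst \<kappa>'' \<and>
      local_rep \<kappa>' \<kappa>'' g z = local_rep \<kappa> \<kappa>'' h (\<psi> (s z))" if "z \<in> W" for z
  proof -
    define r where "r = chart_inv \<kappa> (\<psi> (s z))"
    have "\<psi> (s z) \<in> ?U" using V(4) sW that by blast
    then have r: "r \<in> fst \<kappa>" "f r \<in> fst \<kappa>'" "h r \<in> fst \<kappa>''"
      by (auto simp: kd r_def chart_inv_in)
    have z: "z = snd \<kappa>' (f r)" using sec[OF that] by (simp add: local_rep_apply r_def)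
    have rp: "r \<in> points A" using r(1) k(1) points_iff by metis
    show ?thesis using r gf[OF rp] by (auto simp: z compatible_chartsD(3)[OF B k(3)] local_rep_apply r_def[symmetric])
      (metis compatible_chartsD(3)[OF B k(3)] r_def z)
  qed
  have "smooth_on W (\<lambda>z. local_rep \<kappa> \<kappa>'' h (\<psi> (s z)))"
    by (rule smooth_on_compose[OF W sm(3) _ sm(4) \<psi>s]) (use V(4) sW in blast)
  then have "smooth_on W (local_rep \<kappa>' \<kappa>'' g)" by (rule smooth_on_eq[OF W]) (use pt in blast)
  moreover have "snd \<kappa>' q \<in> W" using V(2) by (simp add: W_def s_def fx linear_0[OF J(1)])
  ultimately show "smooth_near B C g q"
    using pt k(4) p(2) by (intro smooth_nearI[OF k(3,5) _ W]) auto
qed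

text \<open>
  In the straightened coordinates, the line in the direction of \<open>v\<close> lies in a fibre, because the differential
  annihilates \<open>v\<close>.
\<close>

theorem submersion_fibre_curve:
  assumes A: "compatible_charts A" and B: "compatible_charts B" and f: "smooth_map A B f"
    and p: "p \<in> points A" and sub: "submersion_at A B f p"
    and v: "v \<in> tangent_space A p" "pushforward A B f p v = 0"
  obtains I \<gamma> where "open_interval I" "0 \<in> I" "smooth_curve A I \<gamma>" "\<gamma> 0 = p" "velocity A \<gamma> 0 = v"
    "\<And>t. t \<in> I \<Longrightarrow> f (\<gamma> t) = f p"
proof -
  obtain \<kappa> \<kappa>' where k: "\<kappa> \<in> A" "p \<in> fst \<kappa>" "\<kappa>' \<in> B" "f p \<in> fst \<kappa>'"
    using p smooth_mapD(1)[OF f p] by (metis points_iff)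
  let ?f = "local_rep \<kappa> \<kappa>' f" and ?U = "rep_dom \<kappa> \<kappa>' f" and ?x = "snd \<kappa> p"
  note sm = smooth_mapD(2,3)[OF f k(1,3)]
  note kd = compatible_chartsD(3-5)[OF A k(1)]
  have U: "open ?U" "?x \<in> ?U" using sm k by (auto simp: kd)
  have surj: "surj (dif ?f ?x)" by (rule submersion_at_surj[OF A B f k sub])
  obtain V \<psi> where V: "open V" "?x \<in> V" "smooth_on V \<psi>" "\<psi> ` V \<subseteq> ?U" "\<psi> ?x = ?x"
    "\<And>v. dif \<psi> ?x v = v" "\<And>y. y \<in> V \<Longrightarrow> ?f (\<psi> y) = ?f ?x + dif ?f ?x (y - ?x)"
    by (rule local_submersion[OF U sm(2) surj]) (rule that)
  have lin: "linear (dif ?f ?x)" by (rule linear_dif[OF smooth_on_differentiable[OF sm(2) U(2)]])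
  have ker: "dif ?f ?x (v \<kappa>) = 0" using pushforward_eq[OF A f v(1) k] v(2) by simp
  define l where "l t = ?x + t *\<^sub>R v \<kappa>" for t
  have l: "smooth_on S l" if "open S" for S unfolding l_def[abs_def]
    by (intro smooth_on_add[OF that] smooth_on_const smooth_on_linear bounded_linear_scaleR_left)
  have "open (UNIV \<inter> l -` V)" using V(1) smooth_on_continuous_on[OF l] by (intro open_inter_vimage) auto
  moreover have "0 \<in> UNIV \<inter> l -` V" using V(2) by (simp add: l_def)
  ultimately obtain e where e: "e > 0" "ball 0 e \<subseteq> UNIV \<inter> l -` V" by (metis open_contains_ball)
  let ?I = "ball (0::real) e"
  define \<gamma> where "\<gamma> t = chart_inv \<kappa> (\<psi> (l t))" for t
  have lI: "l t \<in> V" if "t \<in> ?I" for t using e that by auto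
  then have \<psi>U: "\<psi> (l t) \<in> ?U" if "t \<in> ?I" for t using V(4) that by auto
  have \<gamma>: "\<gamma> t \<in> fst \<kappa>" "snd \<kappa> (\<gamma> t) = \<psi> (l t)" "f (\<gamma> t) \<in> fst \<kappa>'" if "t \<in> ?I" for t
    using \<psi>U[OF that] by (auto simp: \<gamma>_def kd chart_inv_in chart_chart_inv)
  have sm\<gamma>: "smooth_on ?I (\<lambda>t. snd \<kappa> (\<gamma> t))"
  proof (rule smooth_on_eq)
    show "smooth_on ?I (\<lambda>t. \<psi> (l t))"
      by (rule smooth_on_compose[OF _ V(1) _ V(3) l]) (use lI in auto)
  qed (use \<gamma> in auto)
  have \<gamma>0: "\<gamma> 0 = p" using k by (simp add: \<gamma>_def l_def V(5) kd)
  have curve: "smooth_curve A ?I \<gamma>"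
    by (rule smooth_curve_in_chart[OF A open_ball k(1) \<gamma>(1) sm\<gamma>])
  show ?thesis
  proof (rule that[of ?I \<gamma>])
    show "open_interval ?I" by (simp add: open_interval_def is_interval_ball_real)
    show "velocity A \<gamma> 0 = v"
    proof (rule tvec_eqI[OF velocity_in_tangent_space[OF A open_ball curve, of 0, unfolded \<gamma>0] v(1) k(1,2)])
      have "(l has_derivative (\<lambda>t. t *\<^sub>R v \<kappa>)) (at 0)" unfolding l_def[abs_def]
        by (auto intro!: derivative_eq_intros)
      moreover have "(\<psi> has_derivative dif \<psi> ?x) (at (l 0))"
        using smooth_on_has_derivative[OF V(3,2)] by (simp add: l_def)
      ultimately have "((\<psi> \<circ> l) has_derivative dif \<psi> ?x \<circ> (\<lambda>t. t *\<^sub>R v \<kappa>)) (at 0)"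
        by (rule diff_chain_at)
      then have "((\<lambda>t. \<psi> (l t)) has_vector_derivative v \<kappa>) (at 0)"
        by (simp add: has_vector_derivative_def o_def V(6))
      then have "((\<lambda>t. snd \<kappa> (\<gamma> t)) has_vector_derivative v \<kappa>) (at 0)"
        by (rule has_vector_derivative_transform_within_open[OF _ open_ball, of _ _ _ 0 e]) (use e \<gamma> in auto)
      from vector_derivative_unique_at[OF velocity_has_vector_derivative[OF open_ball curve _ k(1)] this]
      show "velocity A \<gamma> 0 \<kappa> = v \<kappa>" using e k(2) \<gamma>0 by simp
    qed (use e in auto)
    show "f (\<gamma> t) = f p" if "t \<in> ?I" for t
    proof -
      have "?f (\<psi> (l t)) = ?f ?x"
        using V(7)[OF lI[OF that]] by (simp add: l_def linear_scale[OF lin] ker)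
      then have "snd \<kappa>' (f (\<gamma> t)) = snd \<kappa>' (f p)"
        using k by (simp add: local_rep_apply \<gamma>_def kd)
      then show ?thesis using inj_onD[OF compatible_chartsD(1)[OF B k(3)]] \<gamma>(3)[OF that] k(4) by blast
    qed
  qed (use e curve \<gamma>0 in auto)
qed

section \<open>Homogeneous spaces and their translations\<close>

locale homogeneous_decomposition =
  fixes G :: "('g, 'z) monoid_scheme"
    and A :: "('g, 'e::euclidean_space) chart set"
    and H :: "'g set"
    and B :: "('g set, 'f::euclidean_space) chart set"
    and m :: "('g, 'e) tvec set"
  assumes homogeneous: "homogeneous_space G A H B"
    and decomposition: "linear_decomposition G A H m"
begin

abbreviation "mul \<equiv> mult G"
abbreviation "unit \<equiv> one G"
abbreviation "minv \<equiv> m_inv G"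
abbreviation act :: "'g \<Rightarrow> 'g set \<Rightarrow> 'g set" where "act g C \<equiv> g <#\<^bsub>G\<^esub> C"
abbreviation proj :: "'g \<Rightarrow> 'g set" where "proj g \<equiv> g <#\<^bsub>G\<^esub> H"

lemma A: "compatible_charts A" and B: "compatible_charts B" and G: "group G" and H: "subgroup H G"
  and points_A: "points A = carrier G" and points_B: "points B = proj ` carrier G"
  and proj_smooth: "smooth_map A B proj"
  and mul_smooth: "smooth_map (product_atlas A A) A (\<lambda>(g, h). mul g h)"
  using homogeneous by (auto simp: homogeneous_space_def lie_group_def LCOSETS_def
      intro: smooth_atlas_imp_compatible_charts)

lemma H_sub: "H \<subseteq> carrier G" using H by (rule subgroup.subset)

lemma unit_in [simp]: "unit \<in> carrier G" using G by (simp add: group.is_monoid monoid.one_closed)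

lemma proj_unit [simp]: "proj unit = H" 
  using group.lcos_mult_one[OF G H_sub] .

lemma act_proj: "g \<in> carrier G \<Longrightarrow> h \<in> carrier G \<Longrightarrow> act g (proj h) = proj (mul g h)"
  using group.lcos_m_assoc[OF G H_sub] .

lemma mul_closed [simp]: "g \<in> carrier G \<Longrightarrow> h \<in> carrier G \<Longrightarrow> mul g h \<in> carrier G"
  using G by (simp add: group.is_monoid monoid.m_closed)

lemma minv_closed [simp]: "g \<in> carrier G \<Longrightarrow> minv g \<in> carrier G"
  using G by (simp add: group.inv_closed)

lemma proj_submersion: "g \<in> carrier G \<Longrightarrow> submersion_at A B proj g"
  using homogeneous by (simp add: homogeneous_space_def submersion_at_def)

lemma smooth_left_translation:
  assumes g: "g \<in> carrier G"
  shows "smooth_map A A (\<lambda>h. mul g h)"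
  using smooth_map_compose[OF A compatible_charts_product[OF A A] A
      smooth_map_Pair[OF A A A smooth_map_const[OF A A] compatible_charts_id[OF A]] mul_smooth, of g] g
  by (simp add: points_A)

text \<open>
  The translation of \<open>G/H\<close> by \<open>g\<close> is covered by the left translation of \<open>G\<close> and therefore smooth.
\<close>

lemma smooth_act:
  assumes g: "g \<in> carrier G"
  shows "smooth_map B B (act g)"
proof (rule smooth_map_factor_submersion[OF A B B proj_smooth])
  show "smooth_map A B (\<lambda>h. proj (mul g h))"
    by (rule smooth_map_compose[OF A A B smooth_left_translation[OF g] proj_smooth])
qed (use g in \<open>auto simp: points_A points_B act_proj proj_submersion\<close>)

lemma act_act:
  assumes "g \<in> carrier G" "h \<in> carrier G" "C \<in> points B"
  shows "act g (act h C) = act (mul g h) C"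
  using assms monoid.m_assoc[OF group.is_monoid[OF G]] by (auto simp: points_B act_proj)

lemma act_unit: "C \<in> points B \<Longrightarrow> act unit C = C"
  using monoid.l_one[OF group.is_monoid[OF G]] by (auto simp: points_B act_proj)

lemma H_point: "H \<in> points B" unfolding points_B using unit_in proj_unit by (metis imageI)

lemma unit_point: "unit \<in> points A" by (simp add: points_A)

lemma pushforward_act_act:
  assumes "g \<in> carrier G" "h \<in> carrier G" "C \<in> points B" "v \<in> tangent_space B C"
  shows "pushforward B B (act g) (act h C) (pushforward B B (act h) C v) = pushforward B B (act (mul g h)) C v"
  using pushforward_compose[OF B B B smooth_act[OF assms(2)] smooth_act[OF assms(1)] assms(3,4)]
    pushforward_cong[OF B act_act[OF assms(1,2)] assms(3)]
  by simp

lemma pushforward_act_eq_0: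
  assumes g: "g \<in> carrier G" and C: "C \<in> points B" and v: "v \<in> tangent_space B C"
    and 0: "pushforward B B (act g) C v = 0"
  shows "v = 0"
proof -
  have "pushforward B B (act (minv g)) (act g C) (pushforward B B (act g) C v) = pushforward B B (act unit) C v"
    using pushforward_act_act[of "minv g" g] g C v group.l_inv[OF G g] by simp
  also have "\<dots> = pushforward B B (\<lambda>C. C) C v"
    by (rule pushforward_cong[OF B act_unit C])
  also have "\<dots> = v" by (rule pushforward_id[OF B C v])
  finally have "v = pushforward B B (act (minv g)) (act g C) 0" using 0 by simp
  also have "\<dots> = 0"
  proof -
    have gC: "act g C \<in> points B" by (rule smooth_mapD(1)[OF smooth_act[OF g] C])
    have "0 \<in> tangent_space B (act g C)" by (rule subspace_0[OF subspace_tangent_space[OF B]])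
    from pushforward_linear_combination[OF B smooth_act[OF minv_closed[OF g]] gC this this, of 1]
    show ?thesis by simp
  qed
  finally show ?thesis .
qed

section \<open>The complement as tangent space of the homogeneous space\<close>

abbreviation "P \<equiv> m_to_tangent G A H B"

lemma P_eq: "P = pushforward A B proj unit" by (simp add: m_to_tangent_def)

lemma P_linear:
  "v \<in> tangent_space A unit \<Longrightarrow> w \<in> tangent_space A unit \<Longrightarrow> P (v + r *\<^sub>R w) = P v + r *\<^sub>R P w"
  unfolding P_eq by (rule pushforward_linear_combination[OF A proj_smooth unit_point])

lemma P_in: "v \<in> tangent_space A unit \<Longrightarrow> P v \<in> tangent_space B H"
  using pushforward_in_tangent_space[OF A B proj_smooth unit_point] by (simp add: P_eq)

text \<open>
  The subgroup \<open>H\<close> is the fibre of the projection over the base point, so a vector in the kernel of \<open>P\<close> is the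
  velocity of a curve in \<open>H\<close>.
\<close>

lemma lie_subalgebra_iff: "v \<in> lie_subalgebra G A H \<longleftrightarrow> v \<in> tangent_space A unit \<and> P v = 0"
proof
  assume "v \<in> lie_subalgebra G A H"
  then obtain \<gamma> I where \<gamma>: "v = velocity A \<gamma> 0" "open_interval I" "0 \<in> I" "smooth_curve A I \<gamma>" "\<gamma> ` I \<subseteq> H" "\<gamma> 0 = unit"
    by (auto simp: lie_subalgebra_def)
  have I: "open I" using \<gamma> by (simp add: open_interval_def)
  have const: "proj (\<gamma> t) = H" if "t \<in> I" for t
    using \<gamma>(5) that group.coset_join3[OF G _ H] H_sub by blast
  have "P v = velocity B (\<lambda>t. proj (\<gamma> t)) 0"
    using velocity_compose[OF A B I \<gamma>(4) proj_smooth \<gamma>(3)] \<gamma>(1,6) by (simp add: P_eq)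
  also have "\<dots> = velocity B (\<lambda>t. H) 0" by (rule velocity_cong[OF I \<gamma>(3) const])
  also have "\<dots> = 0" by (auto simp: velocity_def fun_eq_iff o_def)
  finally show "v \<in> tangent_space A unit \<and> P v = 0"
    using velocity_in_tangent_space[OF A I \<gamma>(4,3)] \<gamma> by simp
next
  assume v: "v \<in> tangent_space A unit \<and> P v = 0"
  obtain I \<gamma> where \<gamma>: "open_interval I" "0 \<in> I" "smooth_curve A I \<gamma>" "\<gamma> 0 = unit" "velocity A \<gamma> 0 = v"
    "\<And>t. t \<in> I \<Longrightarrow> proj (\<gamma> t) = proj unit"
    by (rule submersion_fibre_curve[OF A B proj_smooth unit_point proj_submersion[OF unit_in], of v])
      (use v in \<open>auto simp: P_eq\<close>)
  have "\<gamma> t \<in> H" if "t \<in> I" for t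
  proof -
    have "open I" using \<gamma> by (simp add: open_interval_def)
    then have "\<gamma> t \<in> carrier G" using smooth_curve_points[OF _ \<gamma>(3) that] by (simp add: points_A)
    then have "\<gamma> t \<in> proj (\<gamma> t)" by (rule group.lcos_self[OF G _ H])
    then show ?thesis using \<gamma>(6)[OF that] by simp
  qed
  then show "v \<in> lie_subalgebra G A H"
    using \<gamma> by (auto simp: lie_subalgebra_def intro!: exI[of _ \<gamma>] exI[of _ I])
qed

lemma m_subspace: "subspace m" using decomposition by (simp add: linear_decomposition_def)

lemma m_tangent: "v \<in> m \<Longrightarrow> v \<in> tangent_space A unit"
proof -
  assume v: "v \<in> m"
  have "0 \<in> lie_subalgebra G A H" using decomposition by (auto simp: linear_decomposition_def)
  with v have "0 + v \<in> lie_algebra G A" using decomposition unfolding linear_decomposition_def by blast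
  then show ?thesis by (simp add: lie_algebra_def)
qed

text \<open>
  The kernel of \<open>P\<close> is \<open>Lie(H)\<close>, which meets \<open>m\<close> only in \<open>0\<close>.
\<close>

lemma P_inj_on_m: "v \<in> m \<Longrightarrow> w \<in> m \<Longrightarrow> P v = P w \<Longrightarrow> v = w"
proof -
  assume v: "v \<in> m" and w: "w \<in> m" and eq: "P v = P w"
  have "P (v + (-1) *\<^sub>R w) = P v + (-1) *\<^sub>R P w" by (intro P_linear m_tangent v w)
  then have "P (v - w) = 0" using eq by simp
  moreover have "v - w \<in> m" using v w m_subspace by (simp add: subspace_diff)
  ultimately have "v - w \<in> lie_subalgebra G A H \<inter> m" using m_tangent by (auto simp: lie_subalgebra_iff)
  moreover have "lie_subalgebra G A H \<inter> m = {0}" using decomposition by (simp add: linear_decomposition_def)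
  ultimately have "v - w \<in> {0}" by blast
  then show ?thesis by simp
qed

lemma decompose:
  assumes x: "x \<in> tangent_space A unit"
  obtains a b where "x = a + b" "a \<in> lie_subalgebra G A H" "b \<in> m" "P x = P b"
proof -
  obtain a b where ab: "x = a + b" "a \<in> lie_subalgebra G A H" "b \<in> m"
    using decomposition x unfolding linear_decomposition_def lie_algebra_def by blast
  have "P (a + 1 *\<^sub>R b) = P a + 1 *\<^sub>R P b" using ab m_tangent by (intro P_linear) (auto simp: lie_subalgebra_iff)
  then have "P x = P b" using ab by (simp add: lie_subalgebra_iff)
  with ab show ?thesis by (rule that)
qed

lemma P_m_onto:
  assumes "w \<in> tangent_space B H"
  obtains v where "v \<in> m" "P v = w"
proof -
  obtain x where "x \<in> tangent_space A unit" "w = P x"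
    using proj_submersion[OF unit_in] assms by (auto simp: submersion_at_def P_eq)
  then show ?thesis using decompose that by metis
qed

lemma proj_m_eqI:
  assumes x: "x \<in> tangent_space A unit" and z: "z \<in> m" "P z = P x"
  shows "proj_m G A H m x = z"
  unfolding proj_m_def
proof (rule the_equality)
  have lin: "P (x - z') = P x - P z'" "x - z' \<in> tangent_space A unit" if "z' \<in> m" for z'
    using P_linear[OF x m_tangent[OF that], of "-1"] subspace_diff[OF subspace_tangent_space[OF A] x m_tangent[OF that]]
    by simp_all
  show "z \<in> m \<and> x - z \<in> lie_subalgebra G A H" using z lin[OF z(1)] by (simp add: lie_subalgebra_iff)
  show "z' = z" if "z' \<in> m \<and> x - z' \<in> lie_subalgebra G A H" for z'
    using that lin[of z'] z by (intro P_inj_on_m) (auto simp: lie_subalgebra_iff)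
qed

end

section \<open>Computations in charts at the base points\<close>

locale homogeneous_charts = homogeneous_decomposition G A H B m
  for G :: "('g, 'z) monoid_scheme" and A :: "('g, 'e::euclidean_space) chart set"
    and H :: "'g set" and B :: "('g set, 'f::euclidean_space) chart set" and m :: "('g, 'e) tvec set" +
  fixes \<epsilon> :: "('g, 'e) chart" and \<beta> :: "('g set, 'f) chart"
  assumes \<epsilon>: "\<epsilon> \<in> A" "unit \<in> fst \<epsilon>" and \<beta>: "\<beta> \<in> B" "H \<in> fst \<beta>"
begin

definition "e0 = snd \<epsilon> unit"
definition "x0 = snd \<beta> H"
definition "T = dif (local_rep \<epsilon> \<beta> proj) e0"

text \<open>
  The representative of \<open>(g, h) \<mapsto> f (g h)\<close> around the pair of unit elements, its domain, and its mixed second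
  derivative.  Two choices of \<open>f\<close> matter: the identity of \<open>G\<close>, for the Lie bracket, and the projection, which
  defines \<open>Q\<close>.
\<close>

definition mulrep :: "('g \<Rightarrow> 'n) \<Rightarrow> ('n, 'd::euclidean_space) chart \<Rightarrow> 'e \<times> 'e \<Rightarrow> 'd"
  where "mulrep f \<kappa> = local_rep (prod_chart \<epsilon> \<epsilon>) \<kappa> (\<lambda>(g, h). f (mul g h))"

definition muldom :: "('g \<Rightarrow> 'n) \<Rightarrow> ('n, 'd::euclidean_space) chart \<Rightarrow> ('e \<times> 'e) set"
  where "muldom f \<kappa> = rep_dom (prod_chart \<epsilon> \<epsilon>) \<kappa> (\<lambda>(g, h). f (mul g h))"

definition mixed :: "('g \<Rightarrow> 'n) \<Rightarrow> ('n, 'd::euclidean_space) chart \<Rightarrow> 'e \<Rightarrow> 'e \<Rightarrow> 'd"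
  where "mixed f \<kappa> w u = dif2 (mulrep f \<kappa>) (e0, e0) (w, 0) (0, u)"

abbreviation "Q \<equiv> mixed proj \<beta>"

lemmas \<epsilon>D = compatible_chartsD[OF A \<epsilon>(1)]
lemmas AA = compatible_charts_product[OF A A]

lemma chart_inv_\<epsilon>_e0 [simp]: "chart_inv \<epsilon> e0 = unit"
  by (simp add: e0_def \<epsilon>D(3) \<epsilon>(2))

lemma e0_in: "e0 \<in> snd \<epsilon> ` fst \<epsilon>" using \<epsilon>(2) by (simp add: e0_def)

lemma chart_inv_\<epsilon>_carrier: "a \<in> snd \<epsilon> ` fst \<epsilon> \<Longrightarrow> chart_inv \<epsilon> a \<in> carrier G"
  using pointsI[OF \<epsilon>(1) chart_inv_in] by (simp add: points_A)

lemma mul_unit [simp]: "g \<in> carrier G \<Longrightarrow> mul g unit = g" "g \<in> carrier G \<Longrightarrow> mul unit g = g"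
  using G by (simp_all add: group.is_monoid monoid.r_one monoid.l_one)

lemma smooth_after_mul:
  assumes C: "compatible_charts C" and f: "smooth_map A C f"
  shows "smooth_map (product_atlas A A) C (\<lambda>(g, h). f (mul g h))"
  using smooth_map_compose[OF AA A C mul_smooth f] by (simp add: case_prod_unfold)

lemma muldom_iff:
  "(a, b) \<in> muldom f \<kappa> \<longleftrightarrow> a \<in> snd \<epsilon> ` fst \<epsilon> \<and> b \<in> snd \<epsilon> ` fst \<epsilon> \<and> f (mul (chart_inv \<epsilon> a) (chart_inv \<epsilon> b)) \<in> fst \<kappa>"
  using chart_inv_prod_chart[OF \<epsilon>D(1) \<epsilon>D(1), of a b]
  unfolding muldom_def compatible_chartsD(5)[OF AA prod_chart_in[OF \<epsilon>(1) \<epsilon>(1)]] prod_chart_image by auto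

lemma mulrep_apply:
  "a \<in> snd \<epsilon> ` fst \<epsilon> \<Longrightarrow> b \<in> snd \<epsilon> ` fst \<epsilon> \<Longrightarrow>
    mulrep f \<kappa> (a, b) = snd \<kappa> (f (mul (chart_inv \<epsilon> a) (chart_inv \<epsilon> b)))"
  using chart_inv_prod_chart[OF \<epsilon>D(1) \<epsilon>D(1), of a b] by (simp add: mulrep_def local_rep_apply)

lemma mulrep_smooth:
  assumes C: "compatible_charts C" and f: "smooth_map A C f" and k: "\<kappa> \<in> C"
  shows "open (muldom f \<kappa>)" "smooth_on (muldom f \<kappa>) (mulrep f \<kappa>)"
  unfolding muldom_def mulrep_def
  by (rule smooth_mapD(2)[OF smooth_after_mul[OF C f] prod_chart_in[OF \<epsilon>(1) \<epsilon>(1)] k],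
      rule smooth_mapD(3)[OF smooth_after_mul[OF C f] prod_chart_in[OF \<epsilon>(1) \<epsilon>(1)] k])

lemma e0_e0_in_muldom: "f unit \<in> fst \<kappa> \<Longrightarrow> (e0, e0) \<in> muldom f \<kappa>"
  by (simp add: muldom_iff e0_in)

text \<open>
  This links \<open>mulrep\<close> with left-invariant fields, whose values are differentials of left translations at the
  unit element.
\<close>

lemma mulrep_second_derivative:
  assumes C: "compatible_charts C" and f: "smooth_map A C f" and k: "\<kappa> \<in> C"
    and a: "(a, e0) \<in> muldom f \<kappa>"
  shows "dif (mulrep f \<kappa>) (a, e0) (0, u) = dif (local_rep \<epsilon> \<kappa> (\<lambda>h. f (mul (chart_inv \<epsilon> a) h))) e0 u"
proof -
  have a': "a \<in> snd \<epsilon> ` fst \<epsilon>" using a by (simp add: muldom_iff)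
  have "dif (mulrep f \<kappa>) (a, e0) (0, u) = dif (\<lambda>b. mulrep f \<kappa> (a, b)) e0 u"
    by (rule dif_fst_snd(2)[symmetric, OF smooth_on_differentiable[OF mulrep_smooth(2)[OF C f k] a]])
  also have "dif (\<lambda>b. mulrep f \<kappa> (a, b)) e0 = dif (local_rep \<epsilon> \<kappa> (\<lambda>h. f (mul (chart_inv \<epsilon> a) h))) e0"
    by (rule dif_cong(1)[OF \<epsilon>D(2) e0_in]) (simp add: mulrep_apply a' local_rep_apply)
  finally show ?thesis .
qed

lemma mulrep_first_order:
  assumes C: "compatible_charts C" and f: "smooth_map A C f" and k: "\<kappa> \<in> C" "f unit \<in> fst \<kappa>"
  shows "dif (mulrep f \<kappa>) (e0, e0) (w, 0) = dif (local_rep \<epsilon> \<kappa> f) e0 w"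
    and "dif (mulrep f \<kappa>) (e0, e0) (0, u) = dif (local_rep \<epsilon> \<kappa> f) e0 u"
proof -
  note d = smooth_on_differentiable[OF mulrep_smooth(2)[OF C f k(1)] e0_e0_in_muldom[of f \<kappa>, OF k(2)]]
  have "dif (mulrep f \<kappa>) (e0, e0) (w, 0) = dif (\<lambda>a. mulrep f \<kappa> (a, e0)) e0 w"
    by (rule dif_fst_snd(1)[OF d, symmetric])
  also have "dif (\<lambda>a. mulrep f \<kappa> (a, e0)) e0 = dif (local_rep \<epsilon> \<kappa> f) e0"
    by (rule dif_cong(1)[OF \<epsilon>D(2) e0_in])
      (simp add: mulrep_apply e0_in local_rep_apply mul_unit chart_inv_\<epsilon>_carrier)
  finally show "dif (mulrep f \<kappa>) (e0, e0) (w, 0) = dif (local_rep \<epsilon> \<kappa> f) e0 w" .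
  have "dif (mulrep f \<kappa>) (e0, e0) (0, u) = dif (\<lambda>b. mulrep f \<kappa> (e0, b)) e0 u"
    by (rule dif_fst_snd(2)[OF d, symmetric])
  also have "dif (\<lambda>b. mulrep f \<kappa> (e0, b)) e0 = dif (local_rep \<epsilon> \<kappa> f) e0"
    by (rule dif_cong(1)[OF \<epsilon>D(2) e0_in])
      (simp add: mulrep_apply e0_in local_rep_apply mul_unit chart_inv_\<epsilon>_carrier)
  finally show "dif (mulrep f \<kappa>) (e0, e0) (0, u) = dif (local_rep \<epsilon> \<kappa> f) e0 u" .
qed

lemma T_eq: "T = dif (local_rep \<epsilon> \<beta> proj) (snd \<epsilon> unit)" by (simp add: T_def e0_def)

lemma proj_unit_\<beta>: "proj unit \<in> fst \<beta>" using \<beta>(2) by simp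

lemma linear_T: "linear T"
  unfolding T_eq by (rule linear_dif[OF local_rep_differentiable[OF A proj_smooth \<epsilon>(1) \<beta>(1) \<epsilon>(2) proj_unit_\<beta>]])

lemma P_\<beta>: "v \<in> tangent_space A unit \<Longrightarrow> P v \<beta> = T (v \<epsilon>)"
  unfolding P_eq T_eq using pushforward_eq[OF A proj_smooth _ \<epsilon> \<beta>(1)] \<beta>(2) by simp

lemma P_eq_iff_T:
  assumes "v \<in> tangent_space A unit" "w \<in> tangent_space A unit"
  shows "P v = P w \<longleftrightarrow> T (v \<epsilon>) = T (w \<epsilon>)"
  using tvec_eqI[OF P_in[OF assms(1)] P_in[OF assms(2)] \<beta>] P_\<beta>[OF assms(1)] P_\<beta>[OF assms(2)] by auto

text \<open>
  The inverse of the identification of \<open>m\<close> with \<open>T\<^sub>o(G/H)\<close>, the latter in coordinates.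
\<close>

definition J :: "'f \<Rightarrow> ('g, 'e) tvec" where "J z = (THE v. v \<in> m \<and> T (v \<epsilon>) = z)"

lemma J_unique: "v \<in> m \<Longrightarrow> w \<in> m \<Longrightarrow> T (v \<epsilon>) = T (w \<epsilon>) \<Longrightarrow> v = w"
  using P_inj_on_m P_eq_iff_T m_tangent by blast

lemma J: "J z \<in> m" "T (J z \<epsilon>) = z"
proof -
  obtain w where w: "w \<in> tangent_space B H" "w \<beta> = z" using tangent_vector_exists[OF B \<beta>] by blast
  obtain v where v: "v \<in> m" "P v = w" using P_m_onto[OF w(1)] by blast
  have *: "v \<in> m \<and> T (v \<epsilon>) = z" using v w P_\<beta>[OF m_tangent[OF v(1)]] by auto
  then have "J z \<in> m \<and> T (J z \<epsilon>) = z"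
    unfolding J_def by (rule theI[of "\<lambda>v. v \<in> m \<and> T (v \<epsilon>) = z"]) (use * J_unique[OF _ v(1)] in auto)
  then show "J z \<in> m" "T (J z \<epsilon>) = z" by auto
qed

lemma J_T: "v \<in> m \<Longrightarrow> J (T (v \<epsilon>)) = v"
  by (rule J_unique) (simp_all add: J)

lemma linear_J: "linear J"
proof (rule linearI)
  show "J (a + b) = J a + J b" for a b
    using subspace_add[OF m_subspace J(1) J(1)] by (intro J_unique) (simp_all add: J linear_add[OF linear_T])
  show "J (r *\<^sub>R a) = r *\<^sub>R J a" for r a
    using subspace_scale[OF m_subspace J(1)] by (intro J_unique) (simp_all add: J linear_scale[OF linear_T])
qed

lemma bounded_linear_J: "bounded_linear (\<lambda>z. J z \<kappa>)"
  using linear_add[OF linear_J] linear_scale[OF linear_J]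
  by (intro linear_conv_bounded_linear[THEN iffD1] linearI) simp_all

lemma J_eq_0_iff: "J z = 0 \<longleftrightarrow> z = 0"
proof
  assume "J z = 0"
  then have "T (0::'e) = z" using J(2)[of z] by simp
  then show "z = 0" by (simp add: linear_0[OF linear_T])
qed (simp add: linear_0[OF linear_J])

lemma T_eq_0_iff: "v \<in> m \<Longrightarrow> T (v \<epsilon>) = 0 \<longleftrightarrow> v = 0"
  using J_T[of v] J_eq_0_iff[of "T (v \<epsilon>)"] by auto

lemma proj_m_eq_J: "x \<in> tangent_space A unit \<Longrightarrow> proj_m G A H m x = J (T (x \<epsilon>))"
  using J m_tangent P_eq_iff_T by (intro proj_m_eqI) auto

section \<open>The bracket as antisymmetrized mixed derivative\<close>

lemma mixed_linear:
  assumes C: "compatible_charts C" and f: "smooth_map A C f" and k: "\<kappa> \<in> C" "f unit \<in> fst \<kappa>"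
  shows "linear (\<lambda>w. mixed f \<kappa> w u)" "linear (mixed f \<kappa> w)"
proof -
  note s = mulrep_smooth[OF C f k(1)] e0_e0_in_muldom[of f \<kappa>, OF k(2)]
  have 1: "linear (\<lambda>w::'e. (w, 0::'e))" "linear (\<lambda>w::'e. (0::'e, w))" by (auto intro!: linearI)
  show "linear (\<lambda>w. mixed f \<kappa> w u)"
    using linear_compose[OF 1(1) linear_dif2_left[OF s(2,3)]] by (simp add: mixed_def[abs_def] o_def)
  show "linear (mixed f \<kappa> w)"
    using linear_compose[OF 1(2) linear_dif2_right[OF s(1,3,2)]] by (simp add: mixed_def[abs_def] o_def)
qed

text \<open>
  Near the unit, \<open>mulrep f \<kappa>\<close> is \<open>mulrep\<close> of the identity followed by the representative of \<open>f\<close>, so this is the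
  second-order chain rule.  The first term is symmetric.
\<close>

lemma mixed_change:
  assumes C: "compatible_charts C" and f: "smooth_map A C f" and k: "\<kappa> \<in> C" "f unit \<in> fst \<kappa>"
  shows "mixed f \<kappa> w u = dif2 (local_rep \<epsilon> \<kappa> f) e0 w u + dif (local_rep \<epsilon> \<kappa> f) e0 (mixed (\<lambda>g. g) \<epsilon> w u)"
proof -
  let ?M = "mulrep (\<lambda>g. g) \<epsilon>" and ?\<phi> = "local_rep \<epsilon> \<kappa> f"
  have ff: "(\<lambda>x. f (case x of (g, h) \<Rightarrow> mul g h)) = (\<lambda>(g, h). f (mul g h))" by auto
  have uu: "(unit, unit) \<in> fst (prod_chart \<epsilon> \<epsilon>)" using \<epsilon> by simp
  obtain U where U: "open U" "snd (prod_chart \<epsilon> \<epsilon>) (unit, unit) \<in> U"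
    "U \<subseteq> rep_dom (prod_chart \<epsilon> \<epsilon>) \<epsilon> (\<lambda>(g, h). mul g h)"
    "U \<subseteq> rep_dom (prod_chart \<epsilon> \<epsilon>) \<kappa> (\<lambda>x. f (case x of (g, h) \<Rightarrow> mul g h))"
    "local_rep (prod_chart \<epsilon> \<epsilon>) \<epsilon> (\<lambda>(g, h). mul g h) ` U \<subseteq> rep_dom \<epsilon> \<kappa> f"
    and eq: "\<And>x. x \<in> U \<Longrightarrow> local_rep (prod_chart \<epsilon> \<epsilon>) \<kappa> (\<lambda>x. f (case x of (g, h) \<Rightarrow> mul g h)) x
      = local_rep \<epsilon> \<kappa> f (local_rep (prod_chart \<epsilon> \<epsilon>) \<epsilon> (\<lambda>(g, h). mul g h) x)"
    by (rule local_rep_compose_near[OF AA A mul_smooth f prod_chart_in[OF \<epsilon>(1) \<epsilon>(1)] \<epsilon>(1) k(1) uu])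
      (use \<epsilon> k in auto)
  have U': "(e0, e0) \<in> U" "U \<subseteq> muldom (\<lambda>g. g) \<epsilon>" "?M ` U \<subseteq> rep_dom \<epsilon> \<kappa> f"
    "\<And>x. x \<in> U \<Longrightarrow> mulrep f \<kappa> x = ?\<phi> (?M x)"
    using U eq by (simp_all add: e0_def muldom_def mulrep_def ff)
  note M_sm = smooth_on_subset[OF mulrep_smooth(2)[OF A compatible_charts_id[OF A] \<epsilon>(1)] U'(2)]
  note \<phi>_sm = smooth_mapD(2,3)[OF f \<epsilon>(1) k(1)]
  have d: "dif (mulrep f \<kappa>) z (0, u) = dif ?\<phi> (?M z) (dif ?M z (0, u))" if z: "z \<in> U" for z
  proof -
    have "dif (mulrep f \<kappa>) z = dif (\<lambda>z. ?\<phi> (?M z)) z" by (rule dif_cong(1)[OF U(1) z U'(4)])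
    also have "\<dots> = (\<lambda>v. dif ?\<phi> (?M z) (dif ?M z v))"
      by (rule dif_compose(1)[OF smooth_on_differentiable[OF \<phi>_sm(2)] smooth_on_differentiable[OF M_sm z]])
        (use U'(3) z in blast)
    finally show ?thesis by simp
  qed
  have M0: "?M (e0, e0) = e0" using e0_in \<epsilon> by (simp add: mulrep_apply e0_def[symmetric])
  have "dif (\<lambda>z. dif (mulrep f \<kappa>) z (0, u)) (e0, e0) = dif (\<lambda>z. dif ?\<phi> (?M z) (dif ?M z (0, u))) (e0, e0)"
    by (rule dif_cong(1)[OF U(1) U'(1) d])
  also have "\<dots> = (\<lambda>h. dif2 ?\<phi> (?M (e0, e0)) (dif ?M (e0, e0) h) (dif ?M (e0, e0) (0, u))
      + dif ?\<phi> (?M (e0, e0)) (dif (\<lambda>z. dif ?M z (0, u)) (e0, e0) h))"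
    by (rule dif_eqI[OF has_derivative_dif_apply[OF \<phi>_sm(1) _ \<phi>_sm(2) smooth_on_has_derivative[OF M_sm U'(1)]
          smooth_on_has_derivative[OF smooth_on_dif_direction[OF M_sm] U'(1)]]]) (use U'(1,3) in blast)
  finally have "mixed f \<kappa> w u = dif2 ?\<phi> e0 (dif ?M (e0, e0) (w, 0)) (dif ?M (e0, e0) (0, u))
      + dif ?\<phi> e0 (mixed (\<lambda>g. g) \<epsilon> w u)"
    by (simp add: mixed_def dif2_def[of "mulrep f \<kappa>"] dif2_def[of ?M] M0)
  then show ?thesis
    by (simp add: mulrep_first_order[OF A compatible_charts_id[OF A] \<epsilon>]
        dif_local_rep_id[OF A \<epsilon>, folded e0_def])
qed

text \<open>
  Antisymmetrization removes the second derivative of \<open>f\<close>: the antisymmetric part of the mixed derivative is a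
  tangent vector.  For \<open>f\<close> the identity this shows that the bracket transforms like one, and for \<open>f\<close> the projection
  it computes the image of the bracket.
\<close>

lemma mixed_antisymmetric_change:
  assumes C: "compatible_charts C" and f: "smooth_map A C f" and k: "\<kappa> \<in> C" "f unit \<in> fst \<kappa>"
  shows "mixed f \<kappa> u v - mixed f \<kappa> v u =
    dif (local_rep \<epsilon> \<kappa> f) e0 (mixed (\<lambda>g. g) \<epsilon> u v - mixed (\<lambda>g. g) \<epsilon> v u)"
proof -
  note s = smooth_mapD(2,3)[OF f \<epsilon>(1) k(1)]
  have e: "e0 \<in> rep_dom \<epsilon> \<kappa> f" using \<epsilon> k by (simp add: e0_def \<epsilon>D(4))
  show ?thesis
    unfolding mixed_change[OF C f k] dif2_symmetric[OF s(1) e s(2), of v u]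
    by (simp add: linear_diff[OF linear_dif[OF smooth_on_differentiable[OF s(2) e]]])
qed

lemma left_translation_deriv_unit:
  assumes u: "u \<in> tangent_space A unit"
  shows "left_translation_deriv G A unit unit u = u"
proof -
  have "left_translation_deriv G A unit unit u = pushforward A A (\<lambda>h. h) unit u"
    unfolding left_translation_deriv_def
    by (rule pushforward_cong[OF A _ unit_point]) (simp add: points_A mul_unit)
  then show ?thesis by (simp add: pushforward_id[OF A unit_point u])
qed

text \<open>
  Near the unit, the left-invariant field with value \<open>u\<close> has the components \<open>D\<^sub>2M(a, e0) u\<close>, where \<open>M\<close> represents the
  multiplication; its derivative is the mixed second derivative of \<open>M\<close>.  The target chart \<open>\<kappa>\<close> is arbitrary, while the
  factors are always read in \<open>\<epsilon>\<close>.
\<close>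

lemma lie_bracket_component:
  assumes u: "u \<in> tangent_space A unit" and v: "v \<in> tangent_space A unit"
    and k: "\<kappa> \<in> A" "unit \<in> fst \<kappa>"
  shows "lie_bracket G A u v \<kappa> = mixed (\<lambda>g. g) \<kappa> (u \<epsilon>) (v \<epsilon>) - mixed (\<lambda>g. g) \<kappa> (v \<epsilon>) (u \<epsilon>)"
proof -
  let ?\<tau> = "local_rep \<kappa> \<epsilon> (\<lambda>p. p)" and ?M = "mulrep (\<lambda>g. g) \<kappa>" and ?x = "snd \<kappa> unit"
  note id = compatible_charts_id[OF A]
  note M = mulrep_smooth[OF A id k(1)] e0_e0_in_muldom[of "\<lambda>g. g" \<kappa>, OF k(2)]
  note \<tau> = smooth_mapD(2,3)[OF id k(1) \<epsilon>(1)]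
  note kD = compatible_chartsD[OF A k(1)]
  let ?D = "rep_dom \<kappa> \<epsilon> (\<lambda>p. p)"
  have x: "?x \<in> ?D" using k \<epsilon> by (simp add: kD(4))
  have \<tau>x: "?\<tau> ?x = e0" using k by (simp add: local_rep_apply kD(3) e0_def)
  have d: "dif (\<lambda>x. left_translation_deriv G A (chart_inv \<kappa> x) unit u \<kappa>) ?x (v \<kappa>) = mixed (\<lambda>g. g) \<kappa> (v \<epsilon>) (u \<epsilon>)"
    if u: "u \<in> tangent_space A unit" and v: "v \<in> tangent_space A unit" for u v
  proof -
    have pt: "left_translation_deriv G A (chart_inv \<kappa> x) unit u \<kappa> = dif ?M (?\<tau> x, e0) (0, u \<epsilon>)" if "x \<in> ?D" for x
    proof -
      define g where "g = chart_inv \<kappa> x"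
      have g: "g \<in> fst \<kappa>" "g \<in> fst \<epsilon>" "?\<tau> x = snd \<epsilon> g" using that
        by (auto simp: kD(5) g_def chart_inv_in local_rep_apply)
      have gG: "g \<in> carrier G" using pointsI[OF k(1) g(1)] by (simp add: points_A)
      have dom: "(snd \<epsilon> g, e0) \<in> muldom (\<lambda>g. g) \<kappa>"
        using g gG by (simp add: muldom_iff e0_in \<epsilon>D(3) mul_unit)
      have "left_translation_deriv G A g unit u \<kappa> = dif (local_rep \<epsilon> \<kappa> (\<lambda>h. mul g h)) e0 (u \<epsilon>)"
        unfolding left_translation_deriv_def e0_def
        using g gG by (intro pushforward_eq[OF A smooth_left_translation[OF gG] u \<epsilon> k(1)]) (simp add: mul_unit)
      also have "\<dots> = dif ?M (?\<tau> x, e0) (0, u \<epsilon>)"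
        using mulrep_second_derivative[OF A id k(1) dom, of "u \<epsilon>"] g by (simp add: \<epsilon>D(3))
      finally show ?thesis by (simp add: g_def)
    qed
    have "dif (\<lambda>x. left_translation_deriv G A (chart_inv \<kappa> x) unit u \<kappa>) ?x = dif (\<lambda>x. dif ?M (?\<tau> x, e0) (0, u \<epsilon>)) ?x"
      by (rule dif_cong(1)[OF \<tau>(1) x pt])
    also have "\<dots> = (\<lambda>h. dif2 ?M (?\<tau> ?x, e0) (dif ?\<tau> ?x h, 0) (0, u \<epsilon>) + dif ?M (?\<tau> ?x, e0) 0)"
      by (rule dif_eqI[OF has_derivative_dif_apply[OF M(1) _ M(2) has_derivative_Pair[OF smooth_on_has_derivative[OF \<tau>(2) x]
          has_derivative_const] has_derivative_const]]) (simp add: \<tau>x M(3))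
    finally show ?thesis
      using tangent_space_change[OF v k(1) \<epsilon>(1) k(2) \<epsilon>(2)] linear_0[OF linear_dif[OF smooth_on_differentiable[OF M(2,3)]]]
      by (simp add: \<tau>x mixed_def)
  qed
  show ?thesis
    using k d[OF v u] d[OF u v]
    by (simp add: lie_bracket_def vf_bracket_def left_translation_deriv_unit u v)
qed

lemma lie_bracket_tangent:
  assumes u: "u \<in> tangent_space A unit" and v: "v \<in> tangent_space A unit"
  shows "lie_bracket G A u v \<in> tangent_space A unit"
proof (rule tangent_spaceI)
  show "lie_bracket G A u v \<kappa> = 0" if "\<not> (\<kappa> \<in> A \<and> unit \<in> fst \<kappa>)" for \<kappa>
    using that unfolding lie_bracket_def vf_bracket_def by (rule if_not_P)
  note id = compatible_charts_id[OF A]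
  have eq: "lie_bracket G A u v \<kappa> = dif (local_rep \<epsilon> \<kappa> (\<lambda>g. g)) (snd \<epsilon> unit) (lie_bracket G A u v \<epsilon>)"
    if k: "\<kappa> \<in> A" "unit \<in> fst \<kappa>" for \<kappa>
    unfolding lie_bracket_component[OF u v k] lie_bracket_component[OF u v \<epsilon>]
    using mixed_antisymmetric_change[OF A id k] by (simp add: e0_def)
  show "lie_bracket G A u v \<kappa>' = dif (local_rep \<kappa> \<kappa>' (\<lambda>q. q)) (snd \<kappa> unit) (lie_bracket G A u v \<kappa>)"
    if k: "\<kappa> \<in> A" "\<kappa>' \<in> A" "unit \<in> fst \<kappa>" "unit \<in> fst \<kappa>'" for \<kappa> \<kappa>'
    unfolding eq[OF k(1,3)] eq[OF k(2,4)]
    by (rule dif_local_rep_compose[OF A A id id \<epsilon>(1) k(1,2) \<epsilon>(2) k(3,4)])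
qed

theorem T_lie_bracket:
  assumes u: "u \<in> tangent_space A unit" and v: "v \<in> tangent_space A unit"
  shows "T (lie_bracket G A u v \<epsilon>) = Q (u \<epsilon>) (v \<epsilon>) - Q (v \<epsilon>) (u \<epsilon>)"
  unfolding lie_bracket_component[OF u v \<epsilon>] T_def
  by (rule mixed_antisymmetric_change[OF B proj_smooth \<beta>(1) proj_unit_\<beta>, symmetric])

end

context homogeneous_charts
begin

section \<open>Fields along a curve in terms of a lift\<close>

abbreviation actrep :: "'g \<Rightarrow> ('g set, 'f) chart \<Rightarrow> 'f \<Rightarrow> 'f" where "actrep g \<kappa> \<equiv> local_rep \<beta> \<kappa> (act g)"
abbreviation actdom :: "'g \<Rightarrow> ('g set, 'f) chart \<Rightarrow> 'f set" where "actdom g \<kappa> \<equiv> rep_dom \<beta> \<kappa> (act g)"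

text \<open>
  Writing the acting element as \<open>g k\<close> with \<open>k\<close> near the unit moves all dependence on \<open>k\<close> into the fixed map \<open>mulrep\<close>,
  so that smoothness of the translation by the single element \<open>g\<close> suffices.
\<close>

lemma pushforward_act_component:
  assumes g: "g \<in> carrier G" and k: "k \<in> fst \<epsilon>" "(snd \<epsilon> k, e0) \<in> muldom proj \<beta>"
    and \<kappa>: "\<kappa> \<in> B" "act g (proj k) \<in> fst \<kappa>" and u: "u \<in> tangent_space A unit"
  shows "pushforward B B (act (mul g k)) H (P u) \<kappa>
    = dif (actrep g \<kappa>) (mulrep proj \<beta> (snd \<epsilon> k, e0))
        (dif (mulrep proj \<beta>) (snd \<epsilon> k, e0) (0, u \<epsilon>))"
proof -
  have kG: "k \<in> carrier G" using pointsI[OF \<epsilon>(1) k(1)] by (simp add: points_A)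
  have gk: "mul g k \<in> carrier G" using g kG by simp
  have pk: "proj k \<in> fst \<beta>" using k kG by (simp add: muldom_iff \<epsilon>D(3) mul_unit)
  note pk_smooth = smooth_map_compose[OF A A B smooth_left_translation[OF kG] proj_smooth]
  have "pushforward B B (act (mul g k)) H (P u) = pushforward A B (\<lambda>h. act (mul g k) (proj h)) unit u"
    unfolding P_eq using pushforward_compose[OF A B B proj_smooth smooth_act[OF gk] unit_point u] by simp
  also have "\<dots> = pushforward A B (\<lambda>h. act g (proj (mul k h))) unit u"
    using g kG gk monoid.m_assoc[OF group.is_monoid[OF G]]
    by (intro pushforward_cong[OF A _ unit_point]) (simp add: points_A act_proj)
  also have "\<dots> = pushforward B B (act g) (proj k) (pushforward A B (\<lambda>h. proj (mul k h)) unit u)"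
    using pushforward_compose[OF A B B pk_smooth smooth_act[OF g] unit_point u] kG by (simp add: mul_unit)
  finally have eq: "pushforward B B (act (mul g k)) H (P u)
      = pushforward B B (act g) (proj k) (pushforward A B (\<lambda>h. proj (mul k h)) unit u)" .
  have ts: "pushforward A B (\<lambda>h. proj (mul k h)) unit u \<in> tangent_space B (proj k)"
    using pushforward_in_tangent_space[OF A B pk_smooth unit_point u] kG by (simp add: mul_unit)
  have "pushforward A B (\<lambda>h. proj (mul k h)) unit u \<beta> = dif (local_rep \<epsilon> \<beta> (\<lambda>h. proj (mul k h))) e0 (u \<epsilon>)"
    using pushforward_eq[OF A pk_smooth u \<epsilon> \<beta>(1)] pk kG by (simp add: mul_unit e0_def)
  also have "\<dots> = dif (mulrep proj \<beta>) (snd \<epsilon> k, e0) (0, u \<epsilon>)"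
    using mulrep_second_derivative[OF B proj_smooth \<beta>(1) k(2), of "u \<epsilon>"] k(1) by (simp add: \<epsilon>D(3))
  finally have comp: "pushforward A B (\<lambda>h. proj (mul k h)) unit u \<beta> = dif (mulrep proj \<beta>) (snd \<epsilon> k, e0) (0, u \<epsilon>)" .
  have "mulrep proj \<beta> (snd \<epsilon> k, e0) = snd \<beta> (proj k)"
    using k kG by (simp add: mulrep_apply e0_in \<epsilon>D(3) mul_unit)
  then show ?thesis
    unfolding eq using pushforward_eq[OF B smooth_act[OF g] ts \<beta>(1) pk \<kappa>] by (simp add: comp)
qed

lemma mul_minv:
  assumes "g \<in> carrier G"
  shows "mul (minv g) g = unit" "mul g (minv g) = unit" "h \<in> carrier G \<Longrightarrow> mul g (mul (minv g) h) = h"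
    "h \<in> carrier G \<Longrightarrow> mul (minv g) (mul g h) = h"
  using assms group.l_inv[OF G assms] group.r_inv[OF G assms] 
    monoid.m_assoc[OF group.is_monoid[OF G], of g "minv g" h] monoid.m_assoc[OF group.is_monoid[OF G], of "minv g" g h]
  by (auto simp: mul_unit)

lemma left_velocity_tangent:
  assumes I: "open I" and cb: "smooth_curve A I cb" and t: "t \<in> I"
  shows "left_velocity G A cb t \<in> tangent_space A unit"
proof -
  have g: "cb t \<in> carrier G" using smooth_curve_points[OF I cb t] by (simp add: points_A)
  show ?thesis
    using pushforward_in_tangent_space[OF A A smooth_left_translation[OF minv_closed[OF g]] _ velocity_in_tangent_space[OF A I cb t]] g
    by (simp add: left_velocity_def left_translation_deriv_def points_A mul_minv)
qed

lemma velocity_eq_translated_left_velocity: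
  assumes I: "open I" and cb: "smooth_curve A I cb" and t: "t \<in> I"
  shows "velocity A cb t = pushforward A A (\<lambda>h. mul (cb t) h) unit (left_velocity G A cb t)"
proof -
  have g: "cb t \<in> carrier G" using smooth_curve_points[OF I cb t] by (simp add: points_A)
  note v = velocity_in_tangent_space[OF A I cb t]
  have gp: "cb t \<in> points A" using g by (simp add: points_A)
  have "pushforward A A (\<lambda>h. mul (cb t) h) unit (left_velocity G A cb t)
      = pushforward A A (\<lambda>h. mul (cb t) (mul (minv (cb t)) h)) (cb t) (velocity A cb t)"
    using pushforward_compose[OF A A A smooth_left_translation[OF minv_closed[OF g]] smooth_left_translation[OF g] gp v] g
    by (simp add: left_velocity_def left_translation_deriv_def mul_minv)
  also have "\<dots> = pushforward A A (\<lambda>h. h) (cb t) (velocity A cb t)"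
    using g by (intro pushforward_cong[OF A _ gp]) (simp add: points_A mul_minv)
  also have "\<dots> = velocity A cb t" by (rule pushforward_id[OF A gp v])
  finally show ?thesis by simp
qed

lemma velocity_proj_curve:
  assumes I: "open I" and cb: "smooth_curve A I cb" and t: "t \<in> I"
  shows "velocity B (\<lambda>s. proj (cb s)) t = pushforward B B (act (cb t)) H (P (left_velocity G A cb t))"
proof -
  have g: "cb t \<in> carrier G" using smooth_curve_points[OF I cb t] by (simp add: points_A)
  note w = left_velocity_tangent[OF I cb t]
  have "velocity B (\<lambda>s. proj (cb s)) t = pushforward A B proj (cb t) (velocity A cb t)"
    by (rule velocity_compose[OF A B I cb proj_smooth t])
  also have "\<dots> = pushforward A B (\<lambda>h. proj (mul (cb t) h)) unit (left_velocity G A cb t)"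
    unfolding velocity_eq_translated_left_velocity[OF I cb t]
    using pushforward_compose[OF A A B smooth_left_translation[OF g] proj_smooth unit_point w] g by (simp add: mul_unit)
  also have "\<dots> = pushforward A B (\<lambda>h. act (cb t) (proj h)) unit (left_velocity G A cb t)"
    using g by (intro pushforward_cong[OF A _ unit_point]) (simp add: points_A act_proj)
  also have "\<dots> = pushforward B B (act (cb t)) H (P (left_velocity G A cb t))"
    unfolding P_eq using pushforward_compose[OF A B B proj_smooth smooth_act[OF g] unit_point w] by simp
  finally show ?thesis .
qed

text \<open>
  The differential of a translation is injective because the translation by the inverse element undoes it.
\<close>

lemma act_rep:
  assumes g: "g \<in> carrier G" and \<kappa>: "\<kappa> \<in> B" "act g H \<in> fst \<kappa>"
  shows "open (actdom g \<kappa>)" "smooth_on (actdom g \<kappa>) (actrep g \<kappa>)"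
    "x0 \<in> actdom g \<kappa>" "actrep g \<kappa> x0 = snd \<kappa> (act g H)"
    "linear (dif (actrep g \<kappa>) x0)" "dif (actrep g \<kappa>) x0 z = 0 \<Longrightarrow> z = 0"
    "v \<in> tangent_space A unit \<Longrightarrow>
      pushforward B B (act g) H (P v) \<kappa> = dif (actrep g \<kappa>) x0 (T (v \<epsilon>))"
proof -
  note s = smooth_mapD(2,3)[OF smooth_act[OF g] \<beta>(1) \<kappa>(1)]
  show "open (actdom g \<kappa>)" "smooth_on (actdom g \<kappa>) (actrep g \<kappa>)" by (fact s)+
  show x: "x0 \<in> actdom g \<kappa>" using \<kappa> \<beta>(2) by (simp add: x0_def compatible_chartsD(4)[OF B \<beta>(1)])
  show "actrep g \<kappa> x0 = snd \<kappa> (act g H)"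
    by (simp add: local_rep_apply x0_def compatible_chartsD(3)[OF B \<beta>])
  show "linear (dif (actrep g \<kappa>) x0)" by (rule linear_dif[OF smooth_on_differentiable[OF s(2) x]])
  have comp: "pushforward B B (act g) H w \<kappa> = dif (actrep g \<kappa>) x0 (w \<beta>)" if "w \<in> tangent_space B H" for w
    unfolding x0_def by (rule pushforward_eq[OF B smooth_act[OF g] that \<beta> \<kappa>])
  show "pushforward B B (act g) H (P v) \<kappa> = dif (actrep g \<kappa>) x0 (T (v \<epsilon>))" if "v \<in> tangent_space A unit"
    by (simp add: comp P_in that P_\<beta>)
  assume 0: "dif (actrep g \<kappa>) x0 z = 0"
  obtain w where w: "w \<in> tangent_space B H" "w \<beta> = z" using tangent_vector_exists[OF B \<beta>] by blast
  have "pushforward B B (act g) H w = 0"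
    using tvec_eq_0_iff[OF B pushforward_in_tangent_space[OF B B smooth_act[OF g] H_point w(1)] \<kappa>] comp[OF w(1)] 0 w(2)
    by simp
  then have "w = 0" by (rule pushforward_act_eq_0[OF g H_point w(1)])
  then show "z = 0" using w(2) by simp
qed

text \<open>
  The curve \<open>cb(t)\<^sup>-\<^sup>1 cb\<close>, here \<open>\<gamma>\<close> in coordinates, passes through the unit element at time \<open>t\<close>, and its velocity
  there is the left velocity of \<open>cb\<close>.
\<close>

lemma translated_curve:
  assumes I: "open I" and cb: "smooth_curve A I cb" and t: "t \<in> I" and \<kappa>: "\<kappa> \<in> B" "act (cb t) H \<in> fst \<kappa>"
  obtains N \<gamma> where "open N" "t \<in> N" "N \<subseteq> I" "\<gamma> t = e0"
    "(\<gamma> has_derivative (\<lambda>h. h *\<^sub>R left_velocity G A cb t \<epsilon>)) (at t)"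
    "\<And>s. s \<in> N \<Longrightarrow> (\<gamma> s, e0) \<in> muldom proj \<beta>"
    "\<And>s. s \<in> N \<Longrightarrow> mulrep proj \<beta> (\<gamma> s, e0) \<in> actdom (cb t) \<kappa>"
    "\<And>s u. s \<in> N \<Longrightarrow> u \<in> tangent_space A unit \<Longrightarrow> pushforward B B (act (cb s)) H (P u) \<kappa>
      = dif (actrep (cb t) \<kappa>) (mulrep proj \<beta> (\<gamma> s, e0)) (dif (mulrep proj \<beta>) (\<gamma> s, e0) (0, u \<epsilon>))"
proof -
  have cG: "cb s \<in> carrier G" if "s \<in> I" for s using smooth_curve_points[OF I cb that] by (simp add: points_A)
  note g = cG[OF t]
  define k where "k s = mul (minv (cb t)) (cb s)" for s
  define \<gamma> where "\<gamma> s = snd \<epsilon> (k s)" for s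
  have k_curve: "smooth_curve A I k"
    unfolding k_def[abs_def] by (rule smooth_curve_compose[OF A A I cb smooth_left_translation[OF minv_closed[OF g]]])
  have kt: "k t = unit" using g by (simp add: k_def mul_minv)
  have vel: "velocity A k t = left_velocity G A cb t"
    unfolding k_def[abs_def] left_velocity_def left_translation_deriv_def
    by (rule velocity_compose[OF A A I cb smooth_left_translation[OF minv_closed[OF g]] t])
  have \<gamma>': "(\<gamma> has_derivative (\<lambda>h. h *\<^sub>R left_velocity G A cb t \<epsilon>)) (at t)"
    using velocity_has_vector_derivative[OF I k_curve t \<epsilon>(1)] \<epsilon>(2)
    by (simp add: kt vel has_vector_derivative_def \<gamma>_def[abs_def])
  note M = mulrep_smooth[OF B proj_smooth \<beta>(1)]
  note F = act_rep[OF g \<kappa>]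
  define D where "D = I \<inter> k -` fst \<epsilon>"
  have D: "open D" "smooth_on D \<gamma>"
    using smooth_curve_open_dom[OF I k_curve \<epsilon>(1)] smooth_curve_smooth_on[OF I k_curve \<epsilon>(1)]
    by (simp_all add: D_def \<gamma>_def[abs_def])
  define W where "W = muldom proj \<beta> \<inter> mulrep proj \<beta> -` actdom (cb t) \<kappa>"
  have W: "open W" unfolding W_def using M F(1) by (intro open_inter_vimage smooth_on_continuous_on)
  define N where "N = D \<inter> (\<lambda>s. (\<gamma> s, e0)) -` W"
  have N: "open N" unfolding N_def
    by (intro open_inter_vimage continuous_on_Pair continuous_on_const smooth_on_continuous_on D W)
  have \<gamma>t: "\<gamma> t = e0" by (simp add: \<gamma>_def kt e0_def)
  have M0: "mulrep proj \<beta> (e0, e0) = x0" by (simp add: mulrep_apply e0_in mul_unit x0_def)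
  show ?thesis
  proof (rule that[OF N _ _ \<gamma>t \<gamma>'])
    show "t \<in> N" using t \<epsilon>(2) e0_e0_in_muldom[of proj \<beta>] proj_unit_\<beta> F(3)
      by (simp add: N_def D_def W_def kt \<gamma>t M0)
    show "N \<subseteq> I" by (auto simp: N_def D_def)
    show dom: "(\<gamma> s, e0) \<in> muldom proj \<beta>" if "s \<in> N" for s using that by (simp add: N_def W_def)
    show dom': "mulrep proj \<beta> (\<gamma> s, e0) \<in> actdom (cb t) \<kappa>" if "s \<in> N" for s using that by (simp add: N_def W_def)
    fix s u assume s: "s \<in> N" and u: "u \<in> tangent_space A unit"
    have sI: "s \<in> I" and ks: "k s \<in> fst \<epsilon>" using s by (auto simp: N_def D_def)
    have kG: "k s \<in> carrier G" using g cG[OF sI] by (simp add: k_def)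
    have "mulrep proj \<beta> (\<gamma> s, e0) = snd \<beta> (proj (k s))" and pk: "proj (k s) \<in> fst \<beta>"
      using dom[OF s] ks kG by (simp_all add: mulrep_apply muldom_iff e0_in \<epsilon>D(3) mul_unit \<gamma>_def)
    then have "act (cb t) (proj (k s)) \<in> fst \<kappa>" using dom'[OF s] by (simp add: compatible_chartsD(4)[OF B \<beta>(1)])
    from pushforward_act_component[OF g ks dom[OF s, unfolded \<gamma>_def] \<kappa>(1) this u]
    show "pushforward B B (act (cb s)) H (P u) \<kappa>
      = dif (actrep (cb t) \<kappa>) (mulrep proj \<beta> (\<gamma> s, e0)) (dif (mulrep proj \<beta>) (\<gamma> s, e0) (0, u \<epsilon>))"
      using g cG[OF sI] by (simp add: k_def \<gamma>_def mul_minv)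
  qed
qed

lemma Q_linear: "linear (\<lambda>w. Q w u)" "linear (Q w)"
  by (rule mixed_linear[OF B proj_smooth \<beta>(1) proj_unit_\<beta>])+

lemma mulrep_proj_base:
  "(e0, e0) \<in> muldom proj \<beta>" "mulrep proj \<beta> (e0, e0) = x0"
  "dif (mulrep proj \<beta>) (e0, e0) (w, 0) = T w" "dif (mulrep proj \<beta>) (e0, e0) (0, w) = T w"
  using e0_e0_in_muldom[of proj \<beta>] proj_unit_\<beta> mulrep_first_order[OF B proj_smooth \<beta>(1) proj_unit_\<beta>]
  by (simp_all add: mulrep_apply e0_in mul_unit x0_def T_def)

text \<open>
  The product rule is applied twice: to the differential of \<open>mulrep proj \<beta>\<close> along \<open>\<gamma>\<close>, which produces \<open>Q\<close>, and to the
  differential of the translation by \<open>cb t\<close>, which produces the second-derivative term that the spray compensates.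
\<close>

lemma translated_field_derivative:
  assumes I: "open I" and cb: "smooth_curve A I cb" and t: "t \<in> I" and \<kappa>: "\<kappa> \<in> B" "act (cb t) H \<in> fst \<kappa>"
    and y: "\<And>s. s \<in> I \<Longrightarrow> y s \<in> tangent_space A unit"
    and y': "((\<lambda>s. y s \<epsilon>) has_vector_derivative y') (at t)"
  shows "((\<lambda>s. pushforward B B (act (cb s)) H (P (y s)) \<kappa>) has_vector_derivative
     dif2 (actrep (cb t) \<kappa>) x0 (T (left_velocity G A cb t \<epsilon>)) (T (y t \<epsilon>)) +
     dif (actrep (cb t) \<kappa>) x0 (Q (left_velocity G A cb t \<epsilon>) (y t \<epsilon>) + T y')) (at t)"
proof -
  obtain N \<gamma> where N: "open N" "t \<in> N" "N \<subseteq> I" and \<gamma>: "\<gamma> t = e0"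
    "(\<gamma> has_derivative (\<lambda>h. h *\<^sub>R left_velocity G A cb t \<epsilon>)) (at t)"
    "\<And>s. s \<in> N \<Longrightarrow> (\<gamma> s, e0) \<in> muldom proj \<beta>"
    "\<And>s. s \<in> N \<Longrightarrow> mulrep proj \<beta> (\<gamma> s, e0) \<in> actdom (cb t) \<kappa>"
    "\<And>s u. s \<in> N \<Longrightarrow> u \<in> tangent_space A unit \<Longrightarrow> pushforward B B (act (cb s)) H (P u) \<kappa>
      = dif (actrep (cb t) \<kappa>) (mulrep proj \<beta> (\<gamma> s, e0)) (dif (mulrep proj \<beta>) (\<gamma> s, e0) (0, u \<epsilon>))"
    by (rule translated_curve[OF I cb t \<kappa>]) (rule that)
  let ?F = "actrep (cb t) \<kappa>" and ?M = "mulrep proj \<beta>" and ?w = "left_velocity G A cb t \<epsilon>"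
  have g: "cb t \<in> carrier G" using smooth_curve_points[OF I cb t] by (simp add: points_A)
  note M = mulrep_smooth[OF B proj_smooth \<beta>(1)]
  note F = act_rep[OF g \<kappa>]
  have \<gamma>e: "((\<lambda>s. (\<gamma> s, e0)) has_derivative (\<lambda>h. (h *\<^sub>R ?w, 0))) (at t)"
    by (intro has_derivative_Pair \<gamma> has_derivative_const)
  have ye: "((\<lambda>s. (0::'e, y s \<epsilon>)) has_derivative (\<lambda>h. (0, h *\<^sub>R y'))) (at t)"
    using y' by (intro has_derivative_Pair has_derivative_const) (simp add: has_vector_derivative_def)
  have p: "((\<lambda>s. ?M (\<gamma> s, e0)) has_derivative (\<lambda>h. dif ?M (e0, e0) (h *\<^sub>R ?w, 0))) (at t)"
    using diff_chain_at[OF \<gamma>e smooth_on_has_derivative[OF M(2) \<gamma>(3)[OF N(2)]]] by (simp add: o_def \<gamma>(1))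
  have v: "((\<lambda>s. dif ?M (\<gamma> s, e0) (0, y s \<epsilon>)) has_derivative
      (\<lambda>h. dif2 ?M (\<gamma> t, e0) (h *\<^sub>R ?w, 0) (0, y t \<epsilon>) + dif ?M (\<gamma> t, e0) (0, h *\<^sub>R y'))) (at t)"
    by (rule has_derivative_dif_apply[OF M(1) \<gamma>(3)[OF N(2)] M(2) \<gamma>e ye])
  have "((\<lambda>s. dif ?F (?M (\<gamma> s, e0)) (dif ?M (\<gamma> s, e0) (0, y s \<epsilon>))) has_derivative
      (\<lambda>h. dif2 ?F x0 (T (h *\<^sub>R ?w)) (T (y t \<epsilon>)) + dif ?F x0 (Q (h *\<^sub>R ?w) (y t \<epsilon>) + T (h *\<^sub>R y')))) (at t)"
    using has_derivative_dif_apply[OF F(1) \<gamma>(4)[OF N(2)] F(2) p v]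
    by (simp add: \<gamma>(1) mulrep_proj_base mixed_def)
  moreover have "dif2 ?F x0 (T (h *\<^sub>R ?w)) (T (y t \<epsilon>)) + dif ?F x0 (Q (h *\<^sub>R ?w) (y t \<epsilon>) + T (h *\<^sub>R y'))
      = h *\<^sub>R (dif2 ?F x0 (T ?w) (T (y t \<epsilon>)) + dif ?F x0 (Q ?w (y t \<epsilon>) + T y'))" for h
    by (simp add: linear_scale[OF linear_T] linear_scale[OF Q_linear(1)] linear_scale[OF F(5)] 
        linear_scale[OF linear_dif2_left[OF F(2,3)]] linear_add[OF F(5)] scaleR_add_right)
  ultimately have "((\<lambda>s. dif ?F (?M (\<gamma> s, e0)) (dif ?M (\<gamma> s, e0) (0, y s \<epsilon>))) has_derivative
      (\<lambda>h. h *\<^sub>R (dif2 ?F x0 (T ?w) (T (y t \<epsilon>)) + dif ?F x0 (Q ?w (y t \<epsilon>) + T y')))) (at t)"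
    by simp
  then show ?thesis unfolding has_vector_derivative_def
    by (rule has_derivative_transform_within_open[OF _ N(1,2)]) (use \<gamma>(5) y N(3) in auto)
qed

text \<open>
  The coordinates \<open>z s\<close> of \<open>y s\<close> solve a linear system whose right-hand side is the field and whose coefficients are
  the fields belonging to constant vectors; these are differentiable by the preceding lemma.
\<close>

lemma translated_field_differentiable:
  assumes I: "open I" and cb: "smooth_curve A I cb" and t: "t \<in> I" and \<kappa>: "\<kappa> \<in> B" "act (cb t) H \<in> fst \<kappa>"
    and y: "\<And>s. s \<in> I \<Longrightarrow> y s \<in> m"
    and Y: "(\<lambda>s. pushforward B B (act (cb s)) H (P (y s)) \<kappa>) differentiable (at t)"
  obtains z' where "\<And>\<kappa>'. ((\<lambda>s. y s \<kappa>') has_vector_derivative J z' \<kappa>') (at t)" "tvec_deriv y t = J z'"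
proof -
  obtain N \<gamma> where N: "open N" "t \<in> N" "N \<subseteq> I" and \<gamma>: "\<gamma> t = e0"
    "(\<gamma> has_derivative (\<lambda>h. h *\<^sub>R left_velocity G A cb t \<epsilon>)) (at t)"
    "\<And>s. s \<in> N \<Longrightarrow> (\<gamma> s, e0) \<in> muldom proj \<beta>"
    "\<And>s. s \<in> N \<Longrightarrow> mulrep proj \<beta> (\<gamma> s, e0) \<in> actdom (cb t) \<kappa>"
    "\<And>s u. s \<in> N \<Longrightarrow> u \<in> tangent_space A unit \<Longrightarrow> pushforward B B (act (cb s)) H (P u) \<kappa>
      = dif (actrep (cb t) \<kappa>) (mulrep proj \<beta> (\<gamma> s, e0)) (dif (mulrep proj \<beta>) (\<gamma> s, e0) (0, u \<epsilon>))"
    by (rule translated_curve[OF I cb t \<kappa>]) (rule that)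
  have g: "cb t \<in> carrier G" using smooth_curve_points[OF I cb t] by (simp add: points_A)
  note F = act_rep[OF g \<kappa>]
  note M = mulrep_smooth[OF B proj_smooth \<beta>(1)]
  define L where "L s z = pushforward B B (act (cb s)) H (P (J z)) \<kappa>" for s z
  define z where "z s = T (y s \<epsilon>)" for s
  have Jm: "J a \<in> tangent_space A unit" for a by (rule m_tangent[OF J(1)])
  interpret linear_system L z "\<lambda>s. pushforward B B (act (cb s)) H (P (y s)) \<kappa>" N t
  proof (intro linear_system.intro)
    fix s assume s: "s \<in> N"
    have lin1: "linear (\<lambda>a. (0::'e, J a \<epsilon>))"
      using linear_add[OF linear_J] linear_scale[OF linear_J] by (intro linearI) simp_all
    have "linear (\<lambda>a. dif (actrep (cb t) \<kappa>) (mulrep proj \<beta> (\<gamma> s, e0)) (dif (mulrep proj \<beta>) (\<gamma> s, e0) (0, J a \<epsilon>)))"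
      using linear_compose[OF linear_compose[OF lin1 linear_dif[OF smooth_on_differentiable[OF M(2) \<gamma>(3)[OF s]]]]
          linear_dif[OF smooth_on_differentiable[OF F(2) \<gamma>(4)[OF s]]]] by (simp add: o_def)
    then show "linear (L s)" unfolding L_def[abs_def] \<gamma>(5)[OF s Jm] .
    show "L s (z s) = pushforward B B (act (cb s)) H (P (y s)) \<kappa>"
      using J_T[OF y] s N(3) by (auto simp: L_def z_def)
  next
    show "inj (L t)"
    proof (rule injI)
      fix a b assume "L t a = L t b"
      then have "dif (actrep (cb t) \<kappa>) x0 (a - b) = 0"
        by (simp add: L_def F(7)[OF Jm] J linear_diff[OF F(5)])
      then show "a = b" using F(6)[of "a - b"] by simp
    qed
  qed (use N in auto)
  have "z differentiable (at t)"
  proof (rule differentiable_solution[OF _ Y])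
    fix b
    have "((\<lambda>s. J b \<epsilon>) has_vector_derivative 0) (at t)" by (rule has_vector_derivative_const)
    from translated_field_derivative[OF I cb t \<kappa> Jm this]
    show "(\<lambda>s. L s b) differentiable (at t)"
      by (auto simp: L_def differentiable_def has_vector_derivative_def)
  qed
  then obtain z' where z': "(z has_vector_derivative z') (at t)" using vector_derivative_works by blast
  have *: "((\<lambda>s. y s \<kappa>') has_vector_derivative J z' \<kappa>') (at t)" for \<kappa>'
  proof (rule has_vector_derivative_transform_within_open)
    show "((\<lambda>s. J (z s) \<kappa>') has_vector_derivative J z' \<kappa>') (at t)"
      by (rule bounded_linear.has_vector_derivative[OF bounded_linear_J z'])
  qed (use I t J_T[OF y] in \<open>auto simp: z_def\<close>)
  then have "tvec_deriv y t = J z'" by (auto simp: tvec_deriv_def vector_derivative_at)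
  with * show ?thesis by (rule that)
qed

end

section \<open>The spray in charts\<close>

locale homogeneous_spray = homogeneous_charts G A H B m \<epsilon> \<beta>
  for G :: "('g, 'z) monoid_scheme" and A :: "('g, 'e::euclidean_space) chart set"
    and H :: "'g set" and B :: "('g set, 'f::euclidean_space) chart set" and m :: "('g, 'e) tvec set"
    and \<epsilon> :: "('g, 'e) chart" and \<beta> :: "('g set, 'f) chart" +
  fixes S :: "('g set, 'f) slit_field"
  assumes homogeneous_spray: "homogeneous_spray_manifold G A H B S"
begin

abbreviation "scoeff \<equiv> spray_coeff B S"

lemma S_spray: "spray B S" using homogeneous_spray by (simp add: homogeneous_spray_manifold_def)

lemma S_smooth: "smooth_map (slit_bundle B) (tangent_bundle (slit_bundle B)) (\<lambda>\<xi>. (\<xi>, S \<xi>))"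
  using S_spray by (simp add: spray_def smooth_vector_field_def)

lemmas SB = compatible_charts_slit_bundle[OF B]

lemma S_tangent:
  assumes "\<xi> \<in> points (slit_bundle B)"
  shows "S \<xi> \<in> tangent_space (slit_bundle B) \<xi>"
proof -
  obtain K where "K \<in> tangent_bundle (slit_bundle B)" "(\<xi>, S \<xi>) \<in> fst K"
    using smooth_mapD(1)[OF S_smooth assms] unfolding points_iff by blast
  then show ?thesis by (auto simp: tangent_bundle_def tangent_chart_def)
qed

lemma slit_point: "v \<in> tangent_space B p \<Longrightarrow> v \<noteq> 0 \<Longrightarrow> (p, v) \<in> points (slit_bundle B)"
  by (simp add: points_slit_bundle)

lemma S_component:
  assumes \<kappa>: "\<kappa> \<in> B" "p \<in> fst \<kappa>" and v: "v \<in> tangent_space B p" "v \<noteq> 0"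
  shows "S (p, v) (slit_chart B \<kappa>) = (v \<kappa>, - 2 *\<^sub>R scoeff \<kappa> (snd \<kappa> p) (v \<kappa>))"
proof -
  have "chart_inv (slit_chart B \<kappa>) (snd (slit_chart B \<kappa>) (p, v)) = (p, v)"
    using v \<kappa> by (intro chart_inv_chart[OF inj_on_slit_chart[OF B \<kappa>(1)]]) (simp add: slit_chart_simps)
  then have "S (p, v) (slit_chart B \<kappa>) = slit_components B S \<kappa> (snd \<kappa> p) (v \<kappa>)"
    by (simp add: slit_components_def slit_chart_simps)
  then show ?thesis
    using S_spray \<kappa> tvec_eq_0_iff[OF B v(1) \<kappa>] v(2) unfolding spray_def by simp
qed

lemma coeff_smooth:
  assumes \<kappa>: "\<kappa> \<in> B"
  shows "smooth_on (snd \<kappa> ` fst \<kappa> \<times> - {0}) (\<lambda>z. scoeff \<kappa> (fst z) (snd z))"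
proof -
  let ?K = "slit_chart B \<kappa>" and ?f = "\<lambda>\<xi>. (\<xi>, S \<xi>)"
  let ?L = "tangent_chart (slit_bundle B) ?K"
  have K: "?K \<in> slit_bundle B" by (rule slit_chart_in[OF \<kappa>])
  have L: "?L \<in> tangent_bundle (slit_bundle B)" using K by (simp add: tangent_bundle_def)
  have "fst ?K \<inter> ?f -` fst ?L = fst ?K"
    using S_tangent pointsI[OF K] by (auto simp: tangent_chart_def)
  then have dom: "rep_dom ?K ?L ?f = snd \<kappa> ` fst \<kappa> \<times> - {0}"
    by (simp add: rep_dom_def slit_chart_image[OF B \<kappa>])
  note s = smooth_mapD(2,3)[OF S_smooth K L, unfolded dom]
  have "smooth_on (snd \<kappa> ` fst \<kappa> \<times> - {0}) (\<lambda>z. (- (1/2)) *\<^sub>R snd (snd (local_rep ?K ?L ?f z)))"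
    by (rule smooth_on_linear_compose[OF bounded_linear_scaleR_right s(1)
          smooth_on_linear_compose[OF bounded_linear_snd s(1) smooth_on_linear_compose[OF bounded_linear_snd s(1,2)]]])
  moreover have "snd (local_rep ?K ?L ?f z) = slit_components B S \<kappa> (fst z) (snd z)" for z
    by (simp add: local_rep_apply tangent_chart_def slit_components_def)
  ultimately show ?thesis by (simp add: spray_coeff_def)
qed

lemma coeff_differentiable:
  assumes \<kappa>: "\<kappa> \<in> B" and x: "x \<in> snd \<kappa> ` fst \<kappa>" "v \<noteq> 0"
  shows "scoeff \<kappa> x differentiable (at v)"
proof -
  have "((\<lambda>v. (x, v)) has_derivative (\<lambda>h. (0, h))) (at v)" by (auto intro!: derivative_eq_intros)
  from diff_chain_at[OF this smooth_on_has_derivative[OF coeff_smooth[OF \<kappa>], of "(x, v)"]] x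
  show ?thesis by (auto simp: o_def differentiable_def)
qed

definition "G0 = scoeff \<beta> x0"
definition "N0 v = dif G0 v"

lemma x0_in: "x0 \<in> snd \<beta> ` fst \<beta>" using \<beta>(2) by (simp add: x0_def)

lemma G0_differentiable: "v \<noteq> 0 \<Longrightarrow> G0 differentiable (at v)"
  unfolding G0_def by (rule coeff_differentiable[OF \<beta>(1) x0_in])

text \<open>
  The tangent map of the translation carries the vertical component \<open>-2 G\<^sub>0\<close> of the spray to
  \<open>D\<^sup>2F(v, v) - 2 DF(G\<^sub>0)\<close>, and by invariance this is the vertical component at the image.
\<close>

lemma coeff_invariance:
  assumes g: "g \<in> carrier G" and \<kappa>: "\<kappa> \<in> B" "act g H \<in> fst \<kappa>" and v: "v \<noteq> 0"
  shows "scoeff \<kappa> (snd \<kappa> (act g H)) (dif (actrep g \<kappa>) x0 v)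
    = dif (actrep g \<kappa>) x0 (G0 v) - (1/2) *\<^sub>R dif2 (actrep g \<kappa>) x0 v v"
proof -
  let ?F = "actrep g \<kappa>" and ?TF = "tangent_map B B (act g)"
  note F = act_rep[OF g \<kappa>]
  let ?R = "actdom g \<kappa>"
  obtain V where V: "V \<in> tangent_space B H" "V \<beta> = v" using tangent_vector_exists[OF B \<beta>] by blast
  have V0: "V \<noteq> 0" using V v by auto
  note gV = pushforward_in_tangent_space[OF B B smooth_act[OF g] H_point V(1)]
  have gV\<kappa>: "pushforward B B (act g) H V \<kappa> = dif ?F x0 v"
    using pushforward_eq[OF B smooth_act[OF g] V(1) \<beta> \<kappa>] V(2) by (simp add: x0_def)
  have nz: "pushforward B B (act g) p w \<noteq> 0" if "p \<in> points B" "w \<in> tangent_space B p" "w \<noteq> 0" for p w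
    using pushforward_act_eq_0[OF g that(1,2)] that(3) by blast
  have TF: "smooth_map (slit_bundle B) (slit_bundle B) ?TF"
    by (rule smooth_map_slit_tangent_map[OF B B smooth_act[OF g] nz])
  have gV0: "pushforward B B (act g) H V \<noteq> 0" by (rule nz[OF H_point V(1) V0])
  have TFV: "?TF (H, V) = (act g H, pushforward B B (act g) H V)" by (simp add: tangent_map_def)
  have "S (?TF (H, V)) (slit_chart B \<kappa>) = pushforward (slit_bundle B) (slit_bundle B) ?TF (H, V) (S (H, V)) (slit_chart B \<kappa>)"
    using homogeneous_spray g slit_point[OF V(1) V0] unfolding homogeneous_spray_manifold_def by simp
  also have "\<dots> = dif (local_rep (slit_chart B \<beta>) (slit_chart B \<kappa>) ?TF) (x0, v) (S (H, V) (slit_chart B \<beta>))"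
    using pushforward_eq[OF SB TF S_tangent[OF slit_point[OF V(1) V0]] slit_chart_in[OF \<beta>(1)] _ slit_chart_in[OF \<kappa>(1)]]
      V V0 \<beta>(2) \<kappa>(2) gV gV0
    by (simp add: slit_chart_simps TFV x0_def)
  also have "dif (local_rep (slit_chart B \<beta>) (slit_chart B \<kappa>) ?TF) (x0, v)
      = dif (\<lambda>z. (?F (fst z), dif ?F (fst z) (snd z))) (x0, v)"
  proof (rule dif_cong(1))
    show "open (?R \<times> - {0::'f})" using F(1) by (intro open_Times) auto
    show "(x0, v) \<in> ?R \<times> - {0}" using F(3) v by simp
    show "local_rep (slit_chart B \<beta>) (slit_chart B \<kappa>) ?TF z = (?F (fst z), dif ?F (fst z) (snd z))"
      if "z \<in> ?R \<times> - {0}" for z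
    proof -
      have "fst z \<in> ?R" "snd z \<noteq> 0" using that by auto
      from slit_tangent_map_rep[OF B smooth_act[OF g] \<beta>(1) \<kappa>(1) this] show ?thesis by simp
    qed
  qed
  also have "\<dots> = (\<lambda>h. (dif ?F x0 (fst h), dif2 ?F x0 (fst h) v + dif ?F x0 (snd h)))"
  proof (rule dif_eqI[OF has_derivative_Pair])
    have fst': "(fst has_derivative fst) (at (x0, v))" and snd': "(snd has_derivative snd) (at (x0, v))"
      by (auto intro: bounded_linear_imp_has_derivative bounded_linear_fst bounded_linear_snd)
    show "((\<lambda>z. ?F (fst z)) has_derivative (\<lambda>h. dif ?F x0 (fst h))) (at (x0, v))"
      using diff_chain_at[OF fst', of ?F "dif ?F x0"] smooth_on_has_derivative[OF F(2,3)] by (simp add: o_def)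
    show "((\<lambda>z. dif ?F (fst z) (snd z)) has_derivative (\<lambda>h. dif2 ?F x0 (fst h) v + dif ?F x0 (snd h))) (at (x0, v))"
      using has_derivative_dif_apply[OF F(1) _ F(2) fst' snd'] F(3) by simp
  qed
  finally have "snd (S (?TF (H, V)) (slit_chart B \<kappa>)) = dif2 ?F x0 v v + dif ?F x0 (- 2 *\<^sub>R G0 v)"
    using S_component[OF \<beta> V(1) V0] V(2) by (simp add: G0_def x0_def)
  moreover have "snd (S (?TF (H, V)) (slit_chart B \<kappa>)) = - 2 *\<^sub>R scoeff \<kappa> (snd \<kappa> (act g H)) (dif ?F x0 v)"
    using S_component[OF \<kappa> gV gV0] by (simp add: TFV gV\<kappa>)
  ultimately have "- 2 *\<^sub>R scoeff \<kappa> (snd \<kappa> (act g H)) (dif ?F x0 v) = dif2 ?F x0 v v - 2 *\<^sub>R dif ?F x0 (G0 v)"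
    by (simp add: linear_scale[OF F(5)] linear_neg[OF F(5)])
  then have "(- 1/2) *\<^sub>R (- 2 *\<^sub>R scoeff \<kappa> (snd \<kappa> (act g H)) (dif ?F x0 v))
      = (- 1/2) *\<^sub>R (dif2 ?F x0 v v - 2 *\<^sub>R dif ?F x0 (G0 v))" by (rule arg_cong)
  then show ?thesis by (simp add: scaleR_diff_right)
qed

text \<open>
  Both sides of \<open>coeff_invariance\<close> are differentiated in \<open>v\<close>; the quadratic term \<open>D\<^sup>2F(v, v) / 2\<close> polarises to
  \<open>D\<^sup>2F(v, u)\<close> by symmetry.
\<close>

lemma spray_N_invariance:
  assumes g: "g \<in> carrier G" and \<kappa>: "\<kappa> \<in> B" "act g H \<in> fst \<kappa>" and v: "v \<noteq> 0"
  shows "spray_N B S \<kappa> (snd \<kappa> (act g H)) (dif (actrep g \<kappa>) x0 v) (dif (actrep g \<kappa>) x0 u)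
    = dif (actrep g \<kappa>) x0 (N0 v u) - dif2 (actrep g \<kappa>) x0 v u"
proof -
  let ?F = "actrep g \<kappa>"
  note F = act_rep[OF g \<kappa>]
  let ?L = "dif ?F x0" and ?x = "snd \<kappa> (act g H)"
  have bL: "bounded_linear ?L" using F(5) by (simp add: linear_conv_bounded_linear)
  have bb: "bounded_bilinear (dif2 ?F x0)"
    unfolding bilinear_conv_bounded_bilinear[symmetric] bilinear_def
    using linear_dif2_left[OF F(2,3)] linear_dif2_right[OF F(1,3,2)] by auto
  have "?L v \<noteq> 0" using F(6) v by blast
  then have 1: "(scoeff \<kappa> ?x has_derivative dif (scoeff \<kappa> ?x) (?L v)) (at (?L v))"
    using \<kappa> by (intro has_derivative_dif coeff_differentiable) auto
  have "((\<lambda>a. scoeff \<kappa> ?x (?L a)) has_derivative (\<lambda>u. dif (scoeff \<kappa> ?x) (?L v) (?L u))) (at v)"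
    using diff_chain_at[OF bounded_linear_imp_has_derivative[OF bL] 1] by (simp add: o_def)
  moreover have "((\<lambda>a. ?L (G0 a) - (1/2) *\<^sub>R dif2 ?F x0 a a) has_derivative
      (\<lambda>u. ?L (N0 v u) - (1/2) *\<^sub>R (dif2 ?F x0 v u + dif2 ?F x0 u v))) (at v)"
    unfolding N0_def using v
    by (intro has_derivative_diff bounded_linear.has_derivative[OF bL] has_derivative_dif G0_differentiable
        bounded_linear.has_derivative[OF bounded_linear_scaleR_right] bounded_bilinear.FDERIV[OF bb] has_derivative_ident)
  then have "((\<lambda>a. scoeff \<kappa> ?x (?L a)) has_derivative
      (\<lambda>u. ?L (N0 v u) - (1/2) *\<^sub>R (dif2 ?F x0 v u + dif2 ?F x0 u v))) (at v)"
    by (rule has_derivative_transform_within_open[of _ _ _ _ "- {0}"])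
      (use v coeff_invariance[OF g \<kappa>] in auto)
  ultimately have "(\<lambda>u. dif (scoeff \<kappa> ?x) (?L v) (?L u)) = (\<lambda>u. ?L (N0 v u) - (1/2) *\<^sub>R (dif2 ?F x0 v u + dif2 ?F x0 u v))"
    by (rule has_derivative_unique)
  then have "dif (scoeff \<kappa> ?x) (?L v) (?L u) = ?L (N0 v u) - (1/2) *\<^sub>R (dif2 ?F x0 v u + dif2 ?F x0 u v)"
    by (rule fun_cong)
  then show ?thesis
    using dif2_symmetric[OF F(1,3,2), of u v] by (simp add: spray_N_def scaleR_2[symmetric])
qed

section \<open>Covariant derivative and acceleration\<close>

lemma velocity_of_lifted_curve:
  assumes I: "open I" and cb: "smooth_curve A I cb" and t: "t \<in> I"
    and c: "\<And>s. s \<in> I \<Longrightarrow> c s = proj (cb s)"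
  shows "velocity B c t = pushforward B B (act (cb t)) H (P (left_velocity G A cb t))"
proof -
  have "velocity B c t = velocity B (\<lambda>s. proj (cb s)) t" by (rule velocity_cong[OF I t]) (rule c)
  then show ?thesis using velocity_proj_curve[OF I cb t] by simp
qed

text \<open>
  The second derivative of the translation enters \<open>translated_field_derivative\<close> and \<open>spray_N_invariance\<close> with opposite
  signs.
\<close>

lemma cov_deriv_component:
  assumes I: "open I" and cb: "smooth_curve A I cb" and t: "t \<in> I" and \<kappa>: "\<kappa> \<in> B" "proj (cb t) \<in> fst \<kappa>"
    and c: "\<And>s. s \<in> I \<Longrightarrow> c s = proj (cb s)"
    and y: "\<And>s. s \<in> I \<Longrightarrow> y s \<in> tangent_space A unit" and yt: "T (y t \<epsilon>) \<noteq> 0"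
    and y': "((\<lambda>s. y s \<epsilon>) has_vector_derivative y') (at t)"
    and Y: "\<And>s. s \<in> I \<Longrightarrow> Y s = pushforward B B (act (cb s)) H (P (y s))"
  shows "cov_deriv B S c Y t \<kappa> = dif (actrep (cb t) \<kappa>) x0
      (T y' + (N0 (T (y t \<epsilon>)) (T (left_velocity G A cb t \<epsilon>)) + Q (left_velocity G A cb t \<epsilon>) (y t \<epsilon>)))"
proof -
  have g: "cb t \<in> carrier G" using smooth_curve_points[OF I cb t] by (simp add: points_A)
  let ?F = "actrep (cb t) \<kappa>" and ?w = "left_velocity G A cb t"
  have \<kappa>': "act (cb t) H \<in> fst \<kappa>" using \<kappa> by simp
  note F = act_rep[OF g \<kappa>(1) \<kappa>']
  have "((\<lambda>s. Y s \<kappa>) has_vector_derivative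
     dif2 ?F x0 (T (?w \<epsilon>)) (T (y t \<epsilon>)) + dif ?F x0 (Q (?w \<epsilon>) (y t \<epsilon>) + T y')) (at t)"
    by (rule has_vector_derivative_transform_within_open[OF translated_field_derivative[OF I cb t \<kappa>(1) \<kappa>' y y'] I t])
      (use Y in auto)
  then have "vector_derivative (\<lambda>s. Y s \<kappa>) (at t)
      = dif2 ?F x0 (T (?w \<epsilon>)) (T (y t \<epsilon>)) + dif ?F x0 (Q (?w \<epsilon>) (y t \<epsilon>) + T y')"
    by (rule vector_derivative_at)
  moreover have "velocity B c t \<kappa> = dif ?F x0 (T (?w \<epsilon>))"
    using velocity_of_lifted_curve[OF I cb t, of c] c F(7)[OF left_velocity_tangent[OF I cb t]] by simp
  moreover have "Y t \<kappa> = dif ?F x0 (T (y t \<epsilon>))" by (simp add: Y t F(7) y)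
  ultimately show ?thesis
    using \<kappa> c[OF t] spray_N_invariance[OF g \<kappa>(1) \<kappa>' yt, of "T (?w \<epsilon>)"]
      dif2_symmetric[OF F(1,3,2), of "T (?w \<epsilon>)" "T (y t \<epsilon>)"]
    by (simp add: cov_deriv_def linear_add[OF F(5)])
qed

text \<open>
  The same cancellation for the velocity field.  The last summand is the deviation from the geodesic equation.
\<close>

lemma acceleration_component:
  assumes I: "open I" and cb: "smooth_curve A I cb" and t: "t \<in> I" and \<kappa>: "\<kappa> \<in> B" "proj (cb t) \<in> fst \<kappa>"
    and c: "\<And>s. s \<in> I \<Longrightarrow> c s = proj (cb s)"
    and wt: "T (left_velocity G A cb t \<epsilon>) \<noteq> 0"
    and w': "((\<lambda>s. left_velocity G A cb s \<epsilon>) has_vector_derivative w') (at t)"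
  shows "((\<lambda>s. velocity B c s \<kappa>) has_vector_derivative
    (- 2) *\<^sub>R scoeff \<kappa> (snd \<kappa> (c t)) (velocity B c t \<kappa>)
    + dif (actrep (cb t) \<kappa>) x0 (T w' + (2 *\<^sub>R G0 (T (left_velocity G A cb t \<epsilon>)) +
        Q (left_velocity G A cb t \<epsilon>) (left_velocity G A cb t \<epsilon>)))) (at t)"
proof -
  have g: "cb t \<in> carrier G" using smooth_curve_points[OF I cb t] by (simp add: points_A)
  let ?F = "actrep (cb t) \<kappa>" and ?w = "left_velocity G A cb t"
  have \<kappa>': "act (cb t) H \<in> fst \<kappa>" using \<kappa> by simp
  note F = act_rep[OF g \<kappa>(1) \<kappa>']
  have Y: "velocity B c s = pushforward B B (act (cb s)) H (P (left_velocity G A cb s))" if "s \<in> I" for s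
    by (rule velocity_of_lifted_curve[OF I cb that]) (rule c)
  have "((\<lambda>s. velocity B c s \<kappa>) has_vector_derivative
     dif2 ?F x0 (T (?w \<epsilon>)) (T (?w \<epsilon>)) + dif ?F x0 (Q (?w \<epsilon>) (?w \<epsilon>) + T w')) (at t)"
    by (rule has_vector_derivative_transform_within_open[OF
          translated_field_derivative[OF I cb t \<kappa>(1) \<kappa>' left_velocity_tangent[OF I cb] w'] I t])
      (use Y in auto)
  moreover have "velocity B c t \<kappa> = dif ?F x0 (T (?w \<epsilon>))"
    by (simp add: Y t F(7) left_velocity_tangent[OF I cb t])
  moreover have "dif2 ?F x0 (T (?w \<epsilon>)) (T (?w \<epsilon>)) = 2 *\<^sub>R dif ?F x0 (G0 (T (?w \<epsilon>)))
      - 2 *\<^sub>R scoeff \<kappa> (snd \<kappa> (act (cb t) H)) (dif ?F x0 (T (?w \<epsilon>)))"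
    unfolding coeff_invariance[OF g \<kappa>(1) \<kappa>' wt] by (simp add: scaleR_diff_right)
  ultimately show ?thesis
    by (simp add: c[OF t] linear_add[OF F(5)] linear_scale[OF F(5)] algebra_simps)
qed

section \<open>The spray vector field\<close>

text \<open>
  The left velocity \<open>w\<close> of the lift of a geodesic satisfies \<open>w' = - eta w\<close>, by \<open>acceleration_component\<close>.
\<close>

definition "eta y = J (2 *\<^sub>R G0 (T (y \<epsilon>)) + Q (y \<epsilon>) (y \<epsilon>))"

lemma lift_velocity:
  assumes "horizontal_lift G A H m I c cb" "t \<in> I"
  shows "left_velocity G A cb t \<in> m" "left_velocity G A cb t \<noteq> 0" "c t = proj (cb t)" "smooth_curve A I cb"
    "T (left_velocity G A cb t \<epsilon>) \<noteq> 0"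
  using assms T_eq_0_iff by (auto simp: horizontal_lift_def)

text \<open>
  The vertical components of the velocity of \<open>(c, c')\<close> in the slit bundle are the second derivatives of \<open>c\<close>.
\<close>

lemma geodesic_second_derivative:
  assumes I: "open I" and c: "geodesic B S I c" and t: "t \<in> I" and \<kappa>: "\<kappa> \<in> B" "c t \<in> fst \<kappa>"
  shows "vector_derivative (\<lambda>s. velocity B c s \<kappa>) (at t) = (- 2) *\<^sub>R scoeff \<kappa> (snd \<kappa> (c t)) (velocity B c t \<kappa>)"
    and "(\<lambda>s. velocity B c s \<kappa>) differentiable (at t)"
proof -
  have curve: "smooth_curve B I c" and nz: "velocity B c t \<noteq> 0"
    and eq: "velocity (slit_bundle B) (\<lambda>s. (c s, velocity B c s)) t = S (c t, velocity B c t)"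
    using c t by (auto simp: geodesic_def)
  note v = velocity_in_tangent_space[OF B I curve t]
  let ?U = "I \<inter> c -` fst \<kappa>"
  have U: "open ?U" "t \<in> ?U" using smooth_curve_open_dom[OF I curve \<kappa>(1)] \<kappa> t by auto
  note sm = smooth_curve_smooth_on[OF I curve \<kappa>(1)]
  have vel: "velocity B c s \<kappa> = dif (\<lambda>t. snd \<kappa> (c t)) s 1" if "s \<in> ?U" for s
    using that \<kappa>(1) vector_derivative_eq_dif[OF smooth_on_differentiable[OF sm that]]
    by (simp add: velocity_def o_def)
  have "(\<lambda>s. dif (\<lambda>t. snd \<kappa> (c t)) s 1) differentiable (at t)"
    by (rule smooth_on_differentiable[OF smooth_on_dif_direction[OF sm] U(2)])
  then show d: "(\<lambda>s. velocity B c s \<kappa>) differentiable (at t)"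
    by (subst dif_cong(2)[OF U vel])
  have pt: "(c t, velocity B c t) \<in> fst (slit_chart B \<kappa>)" using \<kappa> v nz by (simp add: slit_chart_simps)
  have dc: "(\<lambda>s. snd \<kappa> (c s)) differentiable (at t)" by (rule smooth_on_differentiable[OF sm U(2)])
  have "velocity (slit_bundle B) (\<lambda>s. (c s, velocity B c s)) t (slit_chart B \<kappa>)
      = vector_derivative (\<lambda>s. (snd \<kappa> (c s), velocity B c s \<kappa>)) (at t)"
    using pt slit_chart_in[OF \<kappa>(1)] by (simp add: velocity_def[of "slit_bundle B"] o_def slit_chart_simps)
  also have "\<dots> = (vector_derivative (\<lambda>s. snd \<kappa> (c s)) (at t), vector_derivative (\<lambda>s. velocity B c s \<kappa>) (at t))"
    using d dc by (intro vector_derivative_at has_vector_derivative_Pair) (simp_all add: vector_derivative_works)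
  finally have "vector_derivative (\<lambda>s. velocity B c s \<kappa>) (at t)
      = snd (velocity (slit_bundle B) (\<lambda>s. (c s, velocity B c s)) t (slit_chart B \<kappa>))" by simp
  then show "vector_derivative (\<lambda>s. velocity B c s \<kappa>) (at t) = (- 2) *\<^sub>R scoeff \<kappa> (snd \<kappa> (c t)) (velocity B c t \<kappa>)"
    by (simp only: eq S_component[OF \<kappa> v nz] snd_conv)
qed

text \<open>
  Along a geodesic the deviation term of \<open>acceleration_component\<close> vanishes, and this determines the derivative of the
  left velocity at time \<open>0\<close> from its value there.
\<close>

lemma eta_unique:
  assumes I: "open I" "0 \<in> I" and c: "geodesic B S I c" "c 0 = H" "velocity B c 0 = P y" and y: "y \<in> m"
    and lift: "horizontal_lift G A H m I c cb"
  shows "- tvec_deriv (left_velocity G A cb) 0 = eta y"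
proof -
  note l = lift_velocity[OF lift]
  have cb: "smooth_curve A I cb" and cb0: "cb 0 = unit" using lift by (auto simp: horizontal_lift_def)
  let ?w = "left_velocity G A cb"
  have \<beta>0: "act (cb 0) H \<in> fst \<beta>" "proj (cb 0) \<in> fst \<beta>" "c 0 \<in> fst \<beta>" using \<beta>(2) by (simp_all add: cb0 c(2))
  note F = act_rep[OF _ \<beta>(1) \<beta>0(1)]
  have Y: "velocity B c s = pushforward B B (act (cb s)) H (P (?w s))" if "s \<in> I" for s
    by (rule velocity_of_lifted_curve[OF I(1) cb that]) (rule l(3))
  have d: "(\<lambda>s. velocity B c s \<beta>) differentiable (at 0)"
    by (rule geodesic_second_derivative(2)[OF I(1) c(1) I(2) \<beta>(1) \<beta>0(3)])
  then have d': "(\<lambda>s. pushforward B B (act (cb s)) H (P (?w s)) \<beta>) differentiable (at 0)"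
    by (subst (asm) dif_cong(2)[OF I, where g="\<lambda>s. pushforward B B (act (cb s)) H (P (?w s)) \<beta>"]) (simp_all add: Y)
  obtain z' where z': "\<And>\<kappa>'. ((\<lambda>s. ?w s \<kappa>') has_vector_derivative J z' \<kappa>') (at 0)" "tvec_deriv ?w 0 = J z'"
    using translated_field_differentiable[OF I(1) cb I(2) \<beta>(1) \<beta>0(1) l(1) d'] by blast
  have w0: "?w 0 = y"
  proof (rule P_inj_on_m[OF l(1)[OF I(2)] y])
    have "P y = pushforward B B (act unit) H (P (?w 0))" using Y[OF I(2)] c(3) by (simp add: cb0)
    also have "\<dots> = pushforward B B (\<lambda>C. C) H (P (?w 0))" by (rule pushforward_cong[OF B act_unit H_point])
    also have "\<dots> = P (?w 0)" by (rule pushforward_id[OF B H_point P_in[OF m_tangent[OF l(1)[OF I(2)]]]])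
    finally show "P (?w 0) = P y" ..
  qed
  let ?z = "T (J z' \<epsilon>) + (2 *\<^sub>R G0 (T (?w 0 \<epsilon>)) + Q (?w 0 \<epsilon>) (?w 0 \<epsilon>))"
  have "dif (actrep (cb 0) \<beta>) x0 ?z = 0"
    using vector_derivative_at[OF acceleration_component[OF I(1) cb I(2) \<beta>(1) \<beta>0(2) l(3) l(5)[OF I(2)] z'(1)]]
      geodesic_second_derivative(1)[OF I(1) c(1) I(2) \<beta>(1) \<beta>0(3)] by simp
  then have "?z = 0" by (rule F(6)[rotated]) (simp add: cb0)
  then have "z' = - (2 *\<^sub>R G0 (T (y \<epsilon>)) + Q (y \<epsilon>) (y \<epsilon>))"
    unfolding J w0 by (rule eq_neg_iff_add_eq_0[THEN iffD2])
  then have "J z' = - eta y" by (simp only: eta_def linear_neg[OF linear_J])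
  then show ?thesis by (simp add: z'(2))
qed

text \<open>
  Instead of solving the geodesic equation on \<open>G/H\<close> and then lifting, the lift \<open>cb\<close> and its left velocity \<open>w\<close> are obtained
  at once from the autonomous system \<open>cb' = cb\<^sub>* w\<close>, \<open>w' = - eta w\<close>; the projection of \<open>cb\<close> is then a geodesic by
  \<open>acceleration_component\<close>.
\<close>

lemma eta_exists:
  assumes y: "y \<in> m" "y \<noteq> 0"
  obtains I c cb where "open_interval I" "0 \<in> I" "geodesic B S I c" "c 0 = H" "velocity B c 0 = P y"
    "horizontal_lift G A H m I c cb"
proof -
  note id = compatible_charts_id[OF A]
  let ?M = "mulrep (\<lambda>g. g) \<epsilon>"
  note M = mulrep_smooth[OF A id \<epsilon>(1)]
  define D where "D = UNIV \<inter> (\<lambda>a. (a, e0)) -` muldom (\<lambda>g. g) \<epsilon>"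
  have D: "open D" unfolding D_def using M(1) by (intro open_inter_vimage continuous_intros) auto
  define W where "W = UNIV \<inter> T -` (- {0})"
  have bT: "bounded_linear T" using linear_T by (simp add: linear_conv_bounded_linear)
  have W: "open W" unfolding W_def by (intro open_inter_vimage linear_continuous_on bT) auto
  define X where "X z = (dif ?M (fst z, e0) (0, snd z), - J (2 *\<^sub>R G0 (T (snd z)) + Q (snd z) (snd z)) \<epsilon>)" for z
  let ?U = "D \<times> W"
  have U: "open ?U" using D W by (rule open_Times)
  have fst_sm: "smooth_on ?U fst" and snd_sm: "smooth_on ?U snd"
    by (simp_all add: smooth_on_linear bounded_linear_fst bounded_linear_snd)
  have "smooth_on ?U X"
  proof -
    have "smooth_on ?U (\<lambda>z. dif ?M (fst z, e0) (0, snd z))"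
      by (rule smooth_on_dif_apply[OF U M(1) _ M(2) smooth_on_Pair[OF U fst_sm smooth_on_const]
            smooth_on_Pair[OF U smooth_on_const snd_sm]]) (auto simp: D_def)
    moreover have Ts: "smooth_on ?U (\<lambda>z. T (snd z))" by (rule smooth_on_linear_compose[OF bT U snd_sm])
    have "smooth_on ?U (\<lambda>z. G0 (T (snd z)))"
    proof -
      have "open (snd \<beta> ` fst \<beta> \<times> - {0::'f})" using compatible_chartsD(2)[OF B \<beta>(1)] by (intro open_Times) auto
      from smooth_on_compose[OF U this _ coeff_smooth[OF \<beta>(1)] smooth_on_Pair[OF U smooth_on_const Ts], of x0]
      show ?thesis using x0_in by (simp add: G0_def W_def image_subset_iff)
    qed
    moreover have "smooth_on ?U (\<lambda>z. Q (snd z) (snd z))"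
    proof -
      have "bounded_bilinear Q"
        unfolding bilinear_conv_bounded_bilinear[symmetric] bilinear_def using Q_linear by auto
      then show ?thesis using snd_sm U unfolding smooth_on_def by (auto intro: Ck_on_bilinear)
    qed
    ultimately show ?thesis unfolding X_def[abs_def]
      by (intro smooth_on_Pair[OF U] smooth_on_minus[OF U] smooth_on_linear_compose[OF bounded_linear_J U]
          smooth_on_add[OF U] smooth_on_scaleR_const[OF U])
  qed
  moreover have "(e0, y \<epsilon>) \<in> ?U"
    using T_eq_0_iff[OF y(1)] y(2) e0_e0_in_muldom[of "\<lambda>g. g" \<epsilon>] \<epsilon>(2) by (simp add: D_def W_def)
  ultimately obtain e x where e: "e > 0" and x: "x 0 = (e0, y \<epsilon>)" "smooth_on {- e<..<e} x"
    "\<And>t. t \<in> {- e<..<e} \<Longrightarrow> x t \<in> ?U"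
    "\<And>t. t \<in> {- e<..<e} \<Longrightarrow> (x has_vector_derivative X (x t)) (at t)"
    using smooth_ode_local_solution[OF U] by blast
  define I where "I = {- e<..<e}"
  have I: "open I" "0 \<in> I" "convex I" "open_interval I"
    using e by (auto simp: I_def open_interval_def is_interval_convex_1)
  note x = x[folded I_def]
  define a where "a t = fst (x t)" for t
  define b where "b t = snd (x t)" for t
  have a': "(a has_vector_derivative dif ?M (a t, e0) (0, b t)) (at t)"
    and b': "(b has_vector_derivative - J (2 *\<^sub>R G0 (T (b t)) + Q (b t) (b t)) \<epsilon>) (at t)" if "t \<in> I" for t
    using bounded_linear.has_vector_derivative[OF bounded_linear_fst x(4)[OF that]]
      bounded_linear.has_vector_derivative[OF bounded_linear_snd x(4)[OF that]]
    by (simp_all add: a_def[abs_def] b_def[abs_def] X_def)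
  have aD: "(a t, e0) \<in> muldom (\<lambda>g. g) \<epsilon>" and bW: "T (b t) \<noteq> 0" if "t \<in> I" for t
    using x(3)[OF that] by (auto simp: a_def b_def D_def W_def)
  \<comment> \<open>The system lives on all of \<open>T\<^sub>eG\<close>, but \<open>m\<close> is invariant: \<open>b - J (T b)\<close> is constant, and it vanishes at \<open>0\<close>.\<close>
  define w where "w t = J (T (b t))" for t
  have wm: "w t \<in> m" for t by (simp add: w_def J)
  have w\<epsilon>: "w t \<epsilon> = b t" if "t \<in> I" for t
  proof -
    have "\<exists>c. \<forall>t\<in>I. b t - J (T (b t)) \<epsilon> = c"
    proof (rule has_vector_derivative_zero_constant[OF I(3)])
      fix t assume t: "t \<in> I"
      have "J (T (- J z \<epsilon>)) \<epsilon> = - J z \<epsilon>" for z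
        by (simp only: linear_neg[OF linear_T] J(2) linear_neg[OF linear_J] uminus_apply)
      then have "((\<lambda>t. b t - J (T (b t)) \<epsilon>) has_vector_derivative 0) (at t)"
        using has_vector_derivative_diff[OF b'[OF t] bounded_linear.has_vector_derivative[OF bounded_linear_J[of \<epsilon>]
              bounded_linear.has_vector_derivative[OF bT b'[OF t]]]]
        by (simp only: diff_self)
      then show "((\<lambda>t. b t - J (T (b t)) \<epsilon>) has_vector_derivative 0) (at t within I)"
        by (rule has_vector_derivative_at_within)
    qed auto
    then have "b t - J (T (b t)) \<epsilon> = b 0 - J (T (b 0)) \<epsilon>" using that I(2) by metis
    also have "\<dots> = 0" using J_T[OF y(1)] by (simp add: b_def x(1))
    finally show ?thesis by (simp add: w_def)
  qed
  define cb where "cb t = chart_inv \<epsilon> (a t)" for t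
  have a_in: "a t \<in> snd \<epsilon> ` fst \<epsilon>" if "t \<in> I" for t using aD[OF that] by (simp add: muldom_iff)
  have cb\<epsilon>: "cb t \<in> fst \<epsilon>" "snd \<epsilon> (cb t) = a t" if "t \<in> I" for t
    using a_in[OF that] by (simp_all add: cb_def chart_inv_in chart_chart_inv)
  have cbG: "cb t \<in> carrier G" if "t \<in> I" for t using chart_inv_\<epsilon>_carrier[OF a_in[OF that]] by (simp add: cb_def)
  have curve: "smooth_curve A I cb"
  proof (rule smooth_curve_in_chart[OF A I(1) \<epsilon>(1) cb\<epsilon>(1)])
    have "smooth_on I a"
      unfolding a_def[abs_def] by (rule smooth_on_linear_compose[OF bounded_linear_fst I(1) x(2)])
    then show "smooth_on I (\<lambda>t. snd \<epsilon> (cb t))" by (rule smooth_on_eq[OF I(1)]) (rule cb\<epsilon>(2))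
  qed
  have lv: "left_velocity G A cb t = w t" if t: "t \<in> I" for t
  proof -
    note g = cbG[OF t]
    have gp: "cb t \<in> points A" using g by (simp add: points_A)
    have wt: "w t \<in> tangent_space A unit" by (rule m_tangent[OF wm])
    have "velocity A cb t = pushforward A A (\<lambda>h. mul (cb t) h) unit (w t)"
    proof (rule tvec_eqI[OF velocity_in_tangent_space[OF A I(1) curve t] _ \<epsilon>(1) cb\<epsilon>(1)[OF t]])
      show "pushforward A A (\<lambda>h. mul (cb t) h) unit (w t) \<in> tangent_space A (cb t)"
        using pushforward_in_tangent_space[OF A A smooth_left_translation[OF g] unit_point wt] g by (simp add: mul_unit)
      have "((\<lambda>s. snd \<epsilon> (cb s)) has_vector_derivative dif ?M (a t, e0) (0, b t)) (at t)"
        by (rule has_vector_derivative_transform_within_open[OF a'[OF t] I(1) t]) (simp add: cb\<epsilon>)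
      then have "velocity A cb t \<epsilon> = dif ?M (a t, e0) (0, b t)"
        by (rule vector_derivative_unique_at[OF velocity_has_vector_derivative[OF I(1) curve t \<epsilon>(1) cb\<epsilon>(1)[OF t]]])
      also have "\<dots> = dif (local_rep \<epsilon> \<epsilon> (\<lambda>h. mul (cb t) h)) e0 (w t \<epsilon>)"
        using mulrep_second_derivative[OF A id \<epsilon>(1) aD[OF t], of "b t"] by (simp add: cb_def w\<epsilon>[OF t])
      also have "\<dots> = pushforward A A (\<lambda>h. mul (cb t) h) unit (w t) \<epsilon>"
        using pushforward_eq[OF A smooth_left_translation[OF g] wt \<epsilon> \<epsilon>(1)] cb\<epsilon>(1)[OF t] g by (simp add: mul_unit e0_def)
      finally show "velocity A cb t \<epsilon> = pushforward A A (\<lambda>h. mul (cb t) h) unit (w t) \<epsilon>" .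
    qed
    then have "left_velocity G A cb t = pushforward A A (\<lambda>h. mul (minv (cb t)) (mul (cb t) h)) unit (w t)"
      using pushforward_compose[OF A A A smooth_left_translation[OF g] smooth_left_translation[OF minv_closed[OF g]] unit_point wt] g
      by (simp add: left_velocity_def left_translation_deriv_def mul_unit)
    also have "\<dots> = pushforward A A (\<lambda>h. h) unit (w t)"
      using g by (intro pushforward_cong[OF A _ unit_point]) (simp add: points_A mul_minv)
    also have "\<dots> = w t" by (rule pushforward_id[OF A unit_point wt])
    finally show ?thesis .
  qed
  have w0: "w t \<noteq> 0" if "t \<in> I" for t using bW[OF that] J_eq_0_iff by (simp add: w_def)
  have cb0: "cb 0 = unit" by (simp add: cb_def a_def x(1))
  define c where "c t = proj (cb t)" for t
  have lift: "horizontal_lift G A H m I c cb"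
    using curve cb0 lv wm w0 by (simp add: horizontal_lift_def c_def)
  have c_curve: "smooth_curve B I c"
    unfolding c_def[abs_def] by (rule smooth_curve_compose[OF A B I(1) curve proj_smooth])
  have vel: "velocity B c t = pushforward B B (act (cb t)) H (P (w t))" if "t \<in> I" for t
    unfolding c_def[abs_def] using velocity_proj_curve[OF I(1) curve that] lv[OF that] by simp
  have vel0: "velocity B c t \<noteq> 0" if t: "t \<in> I" for t
  proof
    assume "velocity B c t = 0"
    then have "P (w t) = 0"
      using vel[OF t] pushforward_act_eq_0[OF cbG[OF t] H_point P_in[OF m_tangent[OF wm]]] by simp
    then have "T (w t \<epsilon>) = 0" using P_\<beta>[OF m_tangent[OF wm], of t] by simp
    then show False using w0[OF t] T_eq_0_iff[OF wm] by simp
  qed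
  have "geodesic B S I c" unfolding geodesic_def
  proof (intro conjI ballI)
    fix t assume t: "t \<in> I"
    note v = velocity_in_tangent_space[OF B I(1) c_curve t]
    have Sv: "S (c t, velocity B c t) \<in> tangent_space (slit_bundle B) (c t, velocity B c t)"
      by (rule S_tangent[OF slit_point[OF v vel0[OF t]]])
    show "velocity (slit_bundle B) (\<lambda>s. (c s, velocity B c s)) t = S (c t, velocity B c t)"
    proof
      fix K
      show "velocity (slit_bundle B) (\<lambda>s. (c s, velocity B c s)) t K = S (c t, velocity B c t) K"
      proof (cases "K \<in> slit_bundle B \<and> (c t, velocity B c t) \<in> fst K")
        case True
        then obtain \<kappa> where \<kappa>: "\<kappa> \<in> B" and K: "K = slit_chart B \<kappa>" unfolding slit_bundle_def by blast
        have ct: "c t \<in> fst \<kappa>" using True by (simp add: K slit_chart_simps)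
        have w': "((\<lambda>s. left_velocity G A cb s \<epsilon>) has_vector_derivative
            - J (2 *\<^sub>R G0 (T (b t)) + Q (b t) (b t)) \<epsilon>) (at t)"
          by (rule has_vector_derivative_transform_within_open[OF b'[OF t] I(1) t]) (simp add: lv w\<epsilon>)
        have "((\<lambda>s. velocity B c s \<kappa>) has_vector_derivative (- 2) *\<^sub>R scoeff \<kappa> (snd \<kappa> (c t)) (velocity B c t \<kappa>)) (at t)"
          using acceleration_component[where c=c, OF I(1) curve t \<kappa> _ c_def _ w'] ct[unfolded c_def] bW[OF t] w\<epsilon>[OF t]
            linear_0[OF act_rep(5)[OF cbG[OF t] \<kappa>]]
          by (simp add: lv[OF t] linear_neg[OF linear_T] J)
        then have "((\<lambda>s. (snd \<kappa> (c s), velocity B c s \<kappa>)) has_vector_derivative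
            (velocity B c t \<kappa>, (- 2) *\<^sub>R scoeff \<kappa> (snd \<kappa> (c t)) (velocity B c t \<kappa>))) (at t)"
          by (intro has_vector_derivative_Pair velocity_has_vector_derivative[OF I(1) c_curve t \<kappa> ct])
        from vector_derivative_at[OF this] show ?thesis
          using True S_component[OF \<kappa> ct v vel0[OF t]]
          by (simp add: velocity_def[of "slit_bundle B"] K o_def slit_chart_simps)
      next
        case False
        then show ?thesis
          using tangent_space_off[OF Sv False] by (auto simp: velocity_def[of "slit_bundle B"])
      qed
    qed
  qed (use c_curve vel0 in auto)
  moreover have "velocity B c 0 = P y"
  proof -
    have "w 0 = y" using J_T[OF y(1)] by (simp add: w_def b_def x(1))
    then have "velocity B c 0 = pushforward B B (act unit) H (P y)" using vel[OF I(2)] cb0 by simp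
    also have "\<dots> = pushforward B B (\<lambda>C. C) H (P y)" by (rule pushforward_cong[OF B act_unit H_point])
    also have "\<dots> = P y" by (rule pushforward_id[OF B H_point P_in[OF m_tangent[OF y(1)]]])
    finally show ?thesis .
  qed
  ultimately show ?thesis using that[OF I(4,2) _ _ _ lift] by (simp add: c_def cb0)
qed

theorem spray_vector_field_eq:
  assumes y: "y \<in> m" "y \<noteq> 0"
  shows "spray_vector_field G A H B S m y = eta y"
  unfolding spray_vector_field_def
proof (rule the_equality)
  obtain I c cb where *: "open_interval I" "0 \<in> I" "geodesic B S I c" "c 0 = H" "velocity B c 0 = P y"
    "horizontal_lift G A H m I c cb"
    using eta_exists[OF y] by blast
  have "open I" using *(1) by (simp add: open_interval_def)
  from eta_unique[OF this *(2-5) y(1) *(6)] * 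
  show "\<exists>I c cb. open_interval I \<and> 0 \<in> I \<and> geodesic B S I c \<and> c 0 = H \<and> velocity B c 0 = P y \<and>
      horizontal_lift G A H m I c cb \<and> eta y = - tvec_deriv (left_velocity G A cb) 0"
    by metis
next
  fix z assume "\<exists>I c cb. open_interval I \<and> 0 \<in> I \<and> geodesic B S I c \<and> c 0 = H \<and> velocity B c 0 = P y \<and>
      horizontal_lift G A H m I c cb \<and> z = - tvec_deriv (left_velocity G A cb) 0"
  then show "z = eta y" using eta_unique[OF _ _ _ _ _ y(1)] by (auto simp: open_interval_def)
qed

text \<open>
  The derivative of \<open>eta\<close> contributes \<open>N\<^sub>0\<close> and half of \<open>Q(y, u) + Q(u, y)\<close>; the bracket subtracts half of
  \<open>Q(y, u) - Q(u, y)\<close>.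
\<close>

theorem connection_operator_eq:
  assumes y: "y \<in> m" "y \<noteq> 0" and u: "u \<in> m"
  shows "connection_operator G A H B S m y u = J (N0 (T (y \<epsilon>)) (T (u \<epsilon>)) + Q (u \<epsilon>) (y \<epsilon>))"
proof -
  let ?y = "y \<epsilon>" and ?u = "u \<epsilon>"
  let ?d = "2 *\<^sub>R N0 (T ?y) (T ?u) + (Q ?y ?u + Q ?u ?y)"
  have Ty: "T ?y \<noteq> 0" using T_eq_0_iff[OF y(1)] y(2) by simp
  have bb: "bounded_bilinear Q"
    unfolding bilinear_conv_bounded_bilinear[symmetric] bilinear_def using Q_linear by auto
  define l where "l t = ?y + t *\<^sub>R ?u" for t :: real
  have l: "(l has_derivative (\<lambda>h. h *\<^sub>R ?u)) (at 0)" unfolding l_def[abs_def] by (auto intro!: derivative_eq_intros)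
  have Tl: "((\<lambda>t. T (l t)) has_derivative (\<lambda>h. T (h *\<^sub>R ?u))) (at 0)"
    using linear_T by (intro bounded_linear.has_derivative[OF _ l]) (simp add: linear_conv_bounded_linear)
  have G: "((\<lambda>t. G0 (T (l t))) has_derivative (\<lambda>h. N0 (T ?y) (T (h *\<^sub>R ?u)))) (at 0)"
    using diff_chain_at[OF Tl, of G0 "N0 (T ?y)"] has_derivative_dif[OF G0_differentiable[OF Ty]]
    by (simp add: o_def N0_def l_def)
  have "((\<lambda>t. 2 *\<^sub>R G0 (T (l t)) + Q (l t) (l t)) has_derivative
      (\<lambda>h. 2 *\<^sub>R N0 (T ?y) (T (h *\<^sub>R ?u)) + (Q (l 0) (h *\<^sub>R ?u) + Q (h *\<^sub>R ?u) (l 0)))) (at 0)"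
    by (intro has_derivative_add bounded_linear.has_derivative[OF bounded_linear_scaleR_right G] bounded_bilinear.FDERIV[OF bb] l)
  then have d: "((\<lambda>t. 2 *\<^sub>R G0 (T (l t)) + Q (l t) (l t)) has_vector_derivative ?d) (at 0)"
    using linear_scale[OF linear_dif[OF G0_differentiable[OF Ty]]] linear_scale[OF linear_T]
      linear_scale[OF Q_linear(1)] linear_scale[OF Q_linear(2)]
    by (simp add: has_vector_derivative_def N0_def l_def scaleR_add_right mult.commute)
  have "isCont (\<lambda>t. T (l t)) 0" using Tl by (rule has_derivative_continuous)
  moreover have "open (- {0::'f})" "T (l 0) \<in> - {0}" using Ty by (auto simp: l_def)
  ultimately have "\<exists>N. open N \<and> 0 \<in> N \<and> (\<forall>t\<in>N. T (l t) \<in> - {0})" unfolding continuous_at_open by blast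
  then obtain N where N: "open N" "0 \<in> N" "\<And>t. t \<in> N \<Longrightarrow> T (l t) \<noteq> 0" by blast
  have "tvec_deriv (\<lambda>t. spray_vector_field G A H B S m (y + t *\<^sub>R u)) 0 = J ?d"
  proof
    fix \<kappa>
    have "((\<lambda>t. J (2 *\<^sub>R G0 (T (l t)) + Q (l t) (l t)) \<kappa>) has_vector_derivative J ?d \<kappa>) (at 0)"
      by (rule bounded_linear.has_vector_derivative[OF bounded_linear_J d])
    then have "((\<lambda>t. spray_vector_field G A H B S m (y + t *\<^sub>R u) \<kappa>) has_vector_derivative J ?d \<kappa>) (at 0)"
    proof (rule has_vector_derivative_transform_within_open[OF _ N(1,2)])
      fix t assume t: "t \<in> N"
      have yu: "y + t *\<^sub>R u \<in> m" using y u m_subspace by (simp add: subspace_add subspace_scale)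
      have "y + t *\<^sub>R u \<noteq> 0" using N(3)[OF t] T_eq_0_iff[OF yu] by (simp add: l_def)
      from spray_vector_field_eq[OF yu this]
      show "J (2 *\<^sub>R G0 (T (l t)) + Q (l t) (l t)) \<kappa> = spray_vector_field G A H B S m (y + t *\<^sub>R u) \<kappa>"
        by (simp add: eta_def l_def)
    qed
    then show "tvec_deriv (\<lambda>t. spray_vector_field G A H B S m (y + t *\<^sub>R u)) 0 \<kappa> = J ?d \<kappa>"
      by (simp add: tvec_deriv_def vector_derivative_at)
  qed
  moreover have "proj_m G A H m (lie_bracket G A y u) = J (Q ?y ?u - Q ?u ?y)"
    using y u by (simp add: proj_m_eq_J lie_bracket_tangent m_tangent T_lie_bracket)
  ultimately have "connection_operator G A H B S m y u = (1/2) *\<^sub>R J ?d - (1/2) *\<^sub>R J (Q ?y ?u - Q ?u ?y)"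
    by (simp add: connection_operator_def)
  also have "\<dots> = J ((1/2) *\<^sub>R ?d - (1/2) *\<^sub>R (Q ?y ?u - Q ?u ?y))"
    by (simp only: linear_scale[OF linear_J] linear_diff[OF linear_J])
  also have "(1/2) *\<^sub>R ?d - (1/2) *\<^sub>R (Q ?y ?u - Q ?u ?y) = N0 (T ?y) (T ?u) + Q ?u ?y"
    by (simp add: scaleR_add_right scaleR_diff_right scaleR_half_double[symmetric] flip: scaleR_add_left)
  finally show ?thesis .
qed

text \<open>
  Both sides vanish together with the vector \<open>z' + N\<^sub>0(T y)(T w) + Q(w, y)\<close>, where \<open>z' = T y'\<close>: the left-hand side is
  its image under the injective differentials of a translation, the right-hand side its image under \<open>J\<close>.
\<close>

theorem cov_deriv_eq_0_iff:
  assumes I: "open I" and t: "t \<in> I" and c: "smooth_curve B I c" and lift: "horizontal_lift G A H m I c cb"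
    and Y: "smooth_field_along B I c Y" and y: "\<And>s. s \<in> I \<Longrightarrow> y s \<in> m - {0}"
    and Yy: "\<And>s. s \<in> I \<Longrightarrow> Y s = pushforward B B (act (cb s)) H (P (y s))"
  shows "cov_deriv B S c Y t = 0 \<longleftrightarrow>
    tvec_deriv y t + connection_operator G A H B S m (y t) (left_velocity G A cb t) = 0"
proof -
  note l = lift_velocity[OF lift]
  have cb: "smooth_curve A I cb" using l(4)[OF t] .
  have g: "cb t \<in> carrier G" using smooth_curve_points[OF I cb t] by (simp add: points_A)
  let ?w = "left_velocity G A cb t"
  have Y_diff: "(\<lambda>s. Y s \<kappa>) differentiable (at t)" if \<kappa>: "\<kappa> \<in> B" "c t \<in> fst \<kappa>" for \<kappa>
  proof -
    let ?K = "tangent_chart B \<kappa>"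
    have K: "?K \<in> tangent_bundle B" using \<kappa> by (simp add: tangent_bundle_def)
    have curve: "smooth_curve (tangent_bundle B) I (\<lambda>t. (c t, Y t))" using Y by (simp add: smooth_field_along_def)
    have "(c t, Y t) \<in> points (tangent_bundle B)" using smooth_curve_points[OF I curve t] .
    then have "Y t \<in> tangent_space B (c t)" by (auto simp: points_iff tangent_bundle_def tangent_chart_def)
    then have "t \<in> I \<inter> (\<lambda>t. (c t, Y t)) -` fst ?K" using t \<kappa> by (simp add: tangent_chart_def)
    from smooth_on_differentiable[OF smooth_curve_smooth_on[OF I curve K] this]
    have "(\<lambda>s. (snd \<kappa> (c s), Y s \<kappa>)) differentiable (at t)" by (simp add: tangent_chart_def)
    from dif_compose(2)[OF bounded_linear_imp_differentiable[OF bounded_linear_snd] this]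
    show ?thesis by simp
  qed
  have yt: "T (y t \<epsilon>) \<noteq> 0" using y[OF t] T_eq_0_iff by auto
  obtain \<kappa>0 where \<kappa>0: "\<kappa>0 \<in> B" "c t \<in> fst \<kappa>0" using smooth_curve_points[OF I c t] unfolding points_iff by blast
  have \<kappa>0': "act (cb t) H \<in> fst \<kappa>0" using \<kappa>0 l(3)[OF t] by simp
  have "(\<lambda>s. pushforward B B (act (cb s)) H (P (y s)) \<kappa>0) differentiable (at t)"
    by (rule dif_cong(2)[THEN iffD1, OF I t _ Y_diff[OF \<kappa>0]]) (simp add: Yy)
  then obtain z' where z': "\<And>\<kappa>'. ((\<lambda>s. y s \<kappa>') has_vector_derivative J z' \<kappa>') (at t)" "tvec_deriv y t = J z'"
    using translated_field_differentiable[OF I cb t \<kappa>0(1) \<kappa>0', of y] y by blast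
  let ?z = "z' + (N0 (T (y t \<epsilon>)) (T (?w \<epsilon>)) + Q (?w \<epsilon>) (y t \<epsilon>))"
  have comp: "cov_deriv B S c Y t \<kappa> = dif (actrep (cb t) \<kappa>) x0 ?z" if "\<kappa> \<in> B" "c t \<in> fst \<kappa>" for \<kappa>
    using cov_deriv_component[OF I cb t that(1) _ l(3) _ yt z'(1) Yy] that(2) l(3)[OF t] y m_tangent by (simp add: J)
  have "cov_deriv B S c Y t = 0 \<longleftrightarrow> ?z = 0"
  proof
    assume "cov_deriv B S c Y t = 0"
    then have "dif (actrep (cb t) \<kappa>0) x0 ?z = 0" using comp[OF \<kappa>0] by simp
    then show "?z = 0" by (rule act_rep(6)[OF g \<kappa>0(1) \<kappa>0'])
  next
    assume z: "?z = 0"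
    show "cov_deriv B S c Y t = 0"
    proof
      fix \<kappa>
      show "cov_deriv B S c Y t \<kappa> = 0 \<kappa>"
      proof (cases "\<kappa> \<in> B \<and> c t \<in> fst \<kappa>")
        case True
        then have "act (cb t) H \<in> fst \<kappa>" using l(3)[OF t] by simp
        then show ?thesis using comp[of \<kappa>] True z linear_0[OF act_rep(5)[OF g]] by simp
      next
        case False
        then show ?thesis by (auto simp: cov_deriv_def)
      qed
    qed
  qed
  also have "\<dots> \<longleftrightarrow> J ?z = 0" by (simp only: J_eq_0_iff)
  also have "J ?z = tvec_deriv y t + connection_operator G A H B S m (y t) ?w"
    using y[OF t] by (simp add: connection_operator_eq l(1)[OF t] z'(2) linear_add[OF linear_J])
  finally show ?thesis .
qed

end

theorem theoremD:
  fixes G :: "('g, 'z) monoid_scheme"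
    and A :: "('g, 'e::euclidean_space) chart set"
    and H :: "'g set"
    and B :: "('g set, 'f::euclidean_space) chart set"
    and S :: "('g set, 'f) slit_field"
    and m :: "('g, 'e) tvec set"
    and I :: "real set"
    and c :: "real \<Rightarrow> 'g set"
    and cb :: "real \<Rightarrow> 'g"
    and w y :: "real \<Rightarrow> ('g, 'e) tvec"
    and Y :: "real \<Rightarrow> ('g set, 'f) tvec"
  assumes "homogeneous_spray_manifold G A H B S"
    and "linear_decomposition G A H m"
    and "open_interval I" and "0 \<in> I"
    and "smooth_curve B I c" and "c 0 = H" and "\<And>t. t \<in> I \<Longrightarrow> velocity B c t \<noteq> 0"
    and "horizontal_lift G A H m I c cb"
    and "\<And>t. t \<in> I \<Longrightarrow> w t = left_velocity G A cb t"
    and "smooth_field_along B I c Y" and "\<And>t. t \<in> I \<Longrightarrow> Y t \<noteq> 0"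
    and "\<And>t. t \<in> I \<Longrightarrow> y t \<in> m - {0}"
    and "\<And>t. t \<in> I \<Longrightarrow>
           Y t = pushforward B B (\<lambda>C. cb t <#\<^bsub>G\<^esub> C) H (m_to_tangent G A H B (y t))"
  shows "nonlinearly_parallel B S I c Y \<longleftrightarrow>
    (\<forall>t\<in>I. tvec_deriv y t + connection_operator G A H B S m (y t) (w t) = 0)"
proof -
  interpret homogeneous_decomposition G A H B m
    using assms(1,2) by unfold_locales (simp_all add: homogeneous_spray_manifold_def)
  obtain \<epsilon> where \<epsilon>: "\<epsilon> \<in> A" "\<one>\<^bsub>G\<^esub> \<in> fst \<epsilon>" using unit_point unfolding points_iff by blast
  obtain \<beta> where \<beta>: "\<beta> \<in> B" "H \<in> fst \<beta>" using H_point unfolding points_iff by blast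
  interpret homogeneous_spray G A H B m \<epsilon> \<beta> S
    using \<epsilon> \<beta> assms(1) by unfold_locales
  have I: "open I" using assms(3) by (simp add: open_interval_def)
  have "cov_deriv B S c Y t = 0 \<longleftrightarrow> tvec_deriv y t + connection_operator G A H B S m (y t) (w t) = 0"
    if "t \<in> I" for t
    using cov_deriv_eq_0_iff[OF I that assms(5,8,10,12,13)] assms(9)[OF that] by simp
  then show ?thesis using assms(10,11) by (simp add: nonlinearly_parallel_def)
qed

end
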